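(* Let $f\in F_r$, $\varphi\in(0,1)$, and let $\phi$ be any method satisfying assumption A (see context) with $\bar\beta=2$. Then there exists $\varepsilon_0\in(0,1)$ such that for all $0<\varepsilon\le\varepsilon_0$ $$\hat m_{\phi}(p_1\varepsilon)\;\le\;\hat m_{\phi^*}(\varepsilon)\;\le\; m^*(\varepsilon)\;\le\;\hat m_{\phi}(p\,\varepsilon),$$ where $p_1=\dfrac{1+\varphi}{1-\varphi}$ and $p=\dfrac{(1-\varphi)^2}{2(1+\varphi)^2}$. Hence $$\frac{2\kappa^*(r)}{\kappa_\phi(r)}\,\mathrm{cost}\bigl(\phi,\hat m_\phi(p_1\varepsilon)\bigr)\;\le\;\mathrm{cost}\bigl(\phi^*,m^*(\varepsilon)\bigr)\;\le\;\frac{2\kappa^*(r)}{\kappa_\phi(r)}\,\mathrm{cost}\bigl(\phi,\hat m_\phi(p\,\varepsilon)\bigr).$$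
   Context: **Problem.** Let $a<b$, $d,r\ge 1$ integers, $\eta\in\mathbb R^d$, and let $\|\cdot\|$ be the maximum norm in $\mathbb R^d$. Consider $z'(t)=f(t,z(t))$, $t\in[a,b]$, $z(a)=\eta$. $F_r$ is the class of continuous $f:[a,b]\times\mathbb R^d\to\mathbb R^d$ such that for some $L\ge0$, $\|f(t,y)-f(t,\bar y)\|\le L\|y-\bar y\|$ for all $t\in[a,b]$, $y,\bar y\in\mathbb R^d$, and $f\in C^r([a,b]\times D)$, where $D=\{y\in\mathbb R^d:\|y\|\le \sup_{t\in[a,b]}\|z(t)\|+1\}$ and $z$ is the unique solution. **Meshes.** For a mesh $a=x_0<x_1<\dots<x_m=b$ let $h_i=x_{i+1}-x_i$. Fix a nonincreasing sequence $\ell(m)\to0$ and constants $K,k_0$ (which may depend on $f,a,b,\eta$). A mesh with $m$ subintervals is admissible if, when $m\ge k_0$, $\max_{0\le i\le m-1}h_i\le K\ell(m)$. It is assumed that $\ell,K$ are such that the meshes produced by ADAPT-MESH below are admissible for all sufficiently small $\varepsilon$. **Methods.** A method $\phi$ computes successively, for a mesh $\{x_i\}$ and starting with $y_0=\eta$, in each $[x_i,x_{i+1}]$ an approximation $l_i$ with $l_i(x_i)=y_i$, and sets $y_{i+1}=l_i(x_{i+1})$. Here $z_i$ denotes the local solution: $z_i'(t)=f(t,z_i(t))$, $z_i(x_i)=y_i$. The computation of $l_i$ uses $\kappa_\phi(r)$ evaluations of functionals of $f$ per subinterval, $\kappa_\phi(r)$ being independent of $i$ and $m$. **Assumption A** (with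 constants $\bar\beta,\beta>0$ not depending on $f$): for any $f\in F_r$ there is $m_0$ such that for all $m\ge m_0$ and any admissible $\{x_i\}_{i=0}^m$, $$\sup_{t\in[x_i,x_{i+1}]}\|z_i(t)-l_i(t)\|\le c_i h_i^{r+1},\qquad c_i=\bar\beta\Bigl(\frac1{r!}\sup_{\alpha\in[x_i,x_{i+1}]}\|z_i^{(r+1)}(\alpha)\|+\beta\Bigr),\quad i=0,\dots,m-1.$$ (Convention: $c_i=+\infty$ if $z_i^{(r+1)}$ does not exist on the whole interval.) **Reference quantities.** For a method $\phi$, $$\hat k_\phi(m)=\inf\Bigl\{\max_{0\le i\le m-1}c_ih_i^{r+1}:\ a=x_0\le x_1\le\dots\le x_m=b\ \text{admissible}\Bigr\},\qquad \hat m_\phi(\varepsilon)=\min\{m\in\mathbb N:\hat k_\phi(m)\le\varepsilon\},$$ where $c_i$ is formed with the local solutions $z_i$ arising from $\phi$ on that mesh. (Convention: on a degenerate subinterval $x_i=x_{i+1}$ one has $y_{i+1}=y_i$ and the corresponding term is $0$.) **Method $\phi^*$.** Given $y_i$ ($y_0=\eta$), let $t_0,\dots,t_{r-1}$ be equidistant nodes in $[x_i,x_{i+1}]$ with $t_0=x_i$ if $r=1$, and $t_0=x_i$, $t_{r-1}=x_{i+1}$ if $r\ge2$. Put $l_{i,0}\equiv y_i$; given $l_{i,j}$, let $q_{i,j}$ be the Lagrange interpolation polynomial of degree at most $r-1$ of $t\mapsto f(t,l_{i,j}(t))$ at $t_0,\dots,t_{r-1}$, and $l_{i,j+1}(t)=y_i+\int_{x_i}^tq_{i,j}(\xi)\,d\xi$.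 The final approximation on $[x_i,x_{i+1}]$ is $l_i=l_{i,r+1}$, and $y_{i+1}=l_{i,r+1}(x_{i+1})$. The number of evaluations of $f$ needed per subinterval is denoted $\kappa^*(r)$. The method $\phi^*$ is considered with $\bar\beta=2$ and with the same $\beta$ as $\phi$ in the definition of $c_i$. **Algorithm ADAPT-MESH** (parameters $\varepsilon\in(0,1)$, $\varphi\in(0,1)$, and the same constant $\beta>0$ that appears in the definition $c_i=\bar\beta\bigl(\frac1{r!}\sup_{\alpha\in[x_i,x_{i+1}]}\|z_i^{(r+1)}(\alpha)\|+\beta\bigr)$ for $\phi$ and $\phi^*$; $h:(0,1)\to\mathbb R_+$ is a fixed function with $h(\varepsilon)=O(\varepsilon^{1/(r+1)})$ as $\varepsilon\to0^+$). Set $x_0^*=a$, $y_0^*=\eta$. Given $x_i^*<b$ and $y_i^*$: (1) $\bar x_{i+1}=x_i^*+\min\{h(\varepsilon),b-x_i^*\}$; let $\bar t_0=x_i^*,\bar t_1,\dots,\bar t_r=\bar x_{i+1}$ be equidistant. (2) Compute $\bar l_{i,r+1}$ on $[x_i^*,\bar x_{i+1}]$ by the iteration defining $l_{i,r+1}$ (started from the constant $y_i^*$), with interpolation nodes $\bar t_0,\dots,\bar t_{r-1}$. (3) With $\tilde H_i(t)=f(t,\bar l_{i,r+1}(t))$ compute componentwise the divided difference $\tilde H_i[\bar t_0,\dots,\bar t_r]$ and $G_i=\frac83\bigl(\|\tilde H_i[\bar t_0,\dots,\bar t_r]\|+\beta\bigr)(1+\varphi)$. (4) $x_{i+1}^*=x_i^*+\min\{(\varepsilon/G_i)^{1/(r+1)},\,b-x_i^*\}$.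 (5) Compute $l_{i,r+1}$ on $[x_i^*,x_{i+1}^*]$ as in $\phi^*$ and set $y_{i+1}^*=l_{i,r+1}(x_{i+1}^* )$. Stop if $x_{i+1}^*=b$; otherwise continue with $i+1$. $m^*(\varepsilon)$ denotes the number of subintervals produced. **Cost.** $\mathrm{cost}(\phi,m)=\kappa_\phi(r)\,m$; the cost of ADAPT-MESH is $\mathrm{cost}(\phi^*,m^*(\varepsilon))=2\kappa^*(r)m^*(\varepsilon)$ (the factor 2 accounts for the mesh selection). *)

theory Defs
  imports "HOL-Analysis.Analysis" "HOL-Library.Landau_Symbols"
begin

text \<open>The maximum norm on \<open>real ^ 'd\<close> is \<^const>\<open>infnorm\<close>.\<close>

type_synonym 'd rhs = "real \<Rightarrow> real ^ 'd \<Rightarrow> real ^ 'd"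


section \<open>Initial value problems and the class of right-hand sides\<close>

definition solves_ivp ::
    "('d::finite) rhs \<Rightarrow> real \<Rightarrow> real \<Rightarrow> real ^ 'd \<Rightarrow> (real \<Rightarrow> real ^ 'd) \<Rightarrow> bool" where
  "solves_ivp f u v y z \<longleftrightarrow>
     z u = y \<and> (\<forall>t\<in>{u..v}. (z has_vector_derivative f t (z t)) (at t within {u..v}))"

text \<open>For \<open>f\<close> continuous and Lipschitz in its second argument a solution exists and is unique
  on \<open>{u..v}\<close>; only its values on \<open>{u..v}\<close> are used below.\<close>

definition ivp_solution ::
    "('d::finite) rhs \<Rightarrow> real \<Rightarrow> real \<Rightarrow> real ^ 'd \<Rightarrow> real \<Rightarrow> real ^ 'd" where
  "ivp_solution f u v y = (SOME z. solves_ivp f u v y z)"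

text \<open>\<open>C\<^sup>k\<close> on a set, with derivatives taken within the set. On a convex set with nonempty interior,
  such as \<open>{a..b} \<times> D\<close> below, these are unique, and the notion agrees with having partial
  derivatives up to order \<open>k\<close> in the interior that extend continuously to the whole set.\<close>

primrec C_k_on ::
    "nat \<Rightarrow> 'a::euclidean_space set \<Rightarrow> ('a \<Rightarrow> 'b::real_normed_vector) \<Rightarrow> bool" where
  "C_k_on 0 S g \<longleftrightarrow> continuous_on S g"
| "C_k_on (Suc k) S g \<longleftrightarrow>
     (\<exists>g'. (\<forall>x\<in>S. (g has_derivative g' x) (at x within S)) \<and>
           (\<forall>e\<in>Basis. C_k_on k S (\<lambda>x. g' x e)))"

definition F_class :: "nat \<Rightarrow> real \<Rightarrow> real \<Rightarrow> real ^ 'd \<Rightarrow> ('d::finite) rhs set" where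
  "F_class r a b \<eta> =
     {f. continuous_on ({a..b} \<times> UNIV) (\<lambda>(t, y). f t y) \<and>
         (\<exists>L\<ge>0. \<forall>t\<in>{a..b}. \<forall>y y'. infnorm (f t y - f t y') \<le> L * infnorm (y - y')) \<and>
         C_k_on r
           ({a..b} \<times> {y. infnorm y \<le> (SUP t\<in>{a..b}. infnorm (ivp_solution f a b \<eta> t)) + 1})
           (\<lambda>(t, y). f t y)}"


section \<open>Meshes\<close>

definition mesh :: "real \<Rightarrow> real \<Rightarrow> nat \<Rightarrow> (nat \<Rightarrow> real) \<Rightarrow> bool" where
  "mesh a b m x \<longleftrightarrow> x 0 = a \<and> x m = b \<and> (\<forall>i<m. x i < x (Suc i))"

definition weak_mesh :: "real \<Rightarrow> real \<Rightarrow> nat \<Rightarrow> (nat \<Rightarrow> real) \<Rightarrow> bool" where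
  "weak_mesh a b m x \<longleftrightarrow> x 0 = a \<and> x m = b \<and> (\<forall>i<m. x i \<le> x (Suc i))"

definition admissible ::
    "(nat \<Rightarrow> real) \<Rightarrow> real \<Rightarrow> nat \<Rightarrow> nat \<Rightarrow> (nat \<Rightarrow> real) \<Rightarrow> bool" where
  "admissible lseq K k0 m x \<longleftrightarrow> (k0 \<le> m \<longrightarrow> (\<forall>i<m. x (Suc i) - x i \<le> K * lseq m))"


section \<open>Methods\<close>

text \<open>A history lists the pairs \<open>(x\<^sub>j, y\<^sub>j)\<close> computed so far, the most recent one first.
  \<open>approx \<phi> f H v\<close> is the approximation on \<open>[x\<^sub>i, v]\<close>, where \<open>(x\<^sub>i, y\<^sub>i)\<close> is the head of \<open>H\<close>.\<close>

type_synonym 'd history = "(real \<times> (real ^ 'd)) list"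

record 'd ivp_method =
  evals :: nat
  approx :: "('d::finite) rhs \<Rightarrow> 'd history \<Rightarrow> real \<Rightarrow> real \<Rightarrow> real ^ 'd"

text \<open>The values of all functionals evaluated up to and including the subinterval from the head
  of the history to \<open>v\<close>: \<open>\<kappa>\<close> new ones per subinterval. Each functional may be chosen
  adaptively, using the history, the next mesh point and the values obtained so far. Functionals are
  allowed to be vector-valued, so that a value of \<open>f\<close> counts as one evaluation.\<close>

primrec information ::
    "('d history \<Rightarrow> real \<Rightarrow> (real ^ 'd) list \<Rightarrow> ('d::finite) rhs \<Rightarrow> real ^ 'd) \<Rightarrow>
     nat \<Rightarrow> 'd rhs \<Rightarrow> 'd history \<Rightarrow> real \<Rightarrow> (real ^ 'd) list" where
  "information N \<kappa> f [] v = []"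
| "information N \<kappa> f (p # H) v =
     ((\<lambda>vs. vs @ [N (p # H) v vs f]) ^^ \<kappa>) (information N \<kappa> f H (fst p))"

definition is_method :: "('d::finite) rhs set \<Rightarrow> 'd ivp_method \<Rightarrow> bool" where
  "is_method F \<phi> \<longleftrightarrow>
     (\<forall>f\<in>F. \<forall>u y H v. u < v \<longrightarrow> approx \<phi> f ((u, y) # H) v u = y) \<and>
     (\<exists>N A. \<forall>f\<in>F. \<forall>H v. H \<noteq> [] \<longrightarrow> approx \<phi> f H v = A H v (information N (evals \<phi>) f H v))"

text \<open>Degenerate subintervals are skipped, so that \<open>y\<^sub>i\<^sub>+\<^sub>1 = y\<^sub>i\<close> there.\<close>

primrec history ::
    "('d::finite) ivp_method \<Rightarrow> 'd rhs \<Rightarrow> real ^ 'd \<Rightarrow> (nat \<Rightarrow> real) \<Rightarrow> nat \<Rightarrow> 'd history" where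
  "history \<phi> f \<eta> x 0 = [(x 0, \<eta>)]"
| "history \<phi> f \<eta> x (Suc i) =
     (let H = history \<phi> f \<eta> x i
      in if x (Suc i) = x i then H
         else (x (Suc i), approx \<phi> f H (x (Suc i)) (x (Suc i))) # H)"

definition node_value ::
    "('d::finite) ivp_method \<Rightarrow> 'd rhs \<Rightarrow> real ^ 'd \<Rightarrow> (nat \<Rightarrow> real) \<Rightarrow> nat \<Rightarrow> real ^ 'd" where
  "node_value \<phi> f \<eta> x i = snd (hd (history \<phi> f \<eta> x i))"

definition local_approx ::
    "('d::finite) ivp_method \<Rightarrow> 'd rhs \<Rightarrow> real ^ 'd \<Rightarrow> (nat \<Rightarrow> real) \<Rightarrow> nat \<Rightarrow> real \<Rightarrow> real ^ 'd" where
  "local_approx \<phi> f \<eta> x i = approx \<phi> f (history \<phi> f \<eta> x i) (x (Suc i))"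

definition local_solution ::
    "('d::finite) ivp_method \<Rightarrow> 'd rhs \<Rightarrow> real ^ 'd \<Rightarrow> (nat \<Rightarrow> real) \<Rightarrow> nat \<Rightarrow> real \<Rightarrow> real ^ 'd" where
  "local_solution \<phi> f \<eta> x i = ivp_solution f (x i) (x (Suc i)) (node_value \<phi> f \<eta> x i)"

definition cost :: "('d::finite) ivp_method \<Rightarrow> enat \<Rightarrow> ereal" where
  "cost \<phi> m = ereal (real (evals \<phi>)) * ereal_of_enat m"


section \<open>Local error bounds and reference quantities\<close>

primrec nth_vderiv ::
    "nat \<Rightarrow> real set \<Rightarrow> (real \<Rightarrow> 'a::real_normed_vector) \<Rightarrow> real \<Rightarrow> 'a" where
  "nth_vderiv 0 S g = g"
| "nth_vderiv (Suc n) S g = (\<lambda>t. vector_derivative (nth_vderiv n S g) (at t within S))"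

definition nth_vderiv_exists ::
    "nat \<Rightarrow> real set \<Rightarrow> (real \<Rightarrow> 'a::real_normed_vector) \<Rightarrow> bool" where
  "nth_vderiv_exists n S g \<longleftrightarrow> (\<forall>k<n. \<forall>t\<in>S. nth_vderiv k S g differentiable (at t within S))"

definition error_coeff ::
    "real \<Rightarrow> real \<Rightarrow> nat \<Rightarrow> real set \<Rightarrow> (real \<Rightarrow> real ^ 'd::finite) \<Rightarrow> ereal" where
  "error_coeff \<beta>' \<beta> r S z =
     (if nth_vderiv_exists (r + 1) S z
      then ereal \<beta>' *
        (ereal (1 / fact r) * (SUP \<alpha>\<in>S. ereal (infnorm (nth_vderiv (r + 1) S z \<alpha>))) + ereal \<beta>)
      else \<infinity>)"

definition local_bound ::
    "real \<Rightarrow> real \<Rightarrow> nat \<Rightarrow> ('d::finite) ivp_method \<Rightarrow> 'd rhs \<Rightarrow> real ^ 'd \<Rightarrow> (nat \<Rightarrow> real) \<Rightarrow> nat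
     \<Rightarrow> ereal" where
  "local_bound \<beta>' \<beta> r \<phi> f \<eta> x i =
     (if x i = x (Suc i) then 0
      else error_coeff \<beta>' \<beta> r {x i..x (Suc i)} (local_solution \<phi> f \<eta> x i) *
           ereal ((x (Suc i) - x i) ^ (r + 1)))"

text \<open>\<open>K\<close> and \<open>k0\<close> may depend on the right-hand side; \<open>\<beta>'\<close> and \<open>\<beta>\<close> may not.\<close>

definition assumption_A ::
    "real \<Rightarrow> real \<Rightarrow> nat \<Rightarrow> real \<Rightarrow> real \<Rightarrow> real ^ 'd \<Rightarrow> (nat \<Rightarrow> real) \<Rightarrow>
     ('d rhs \<Rightarrow> real) \<Rightarrow> ('d rhs \<Rightarrow> nat) \<Rightarrow> ('d::finite) ivp_method \<Rightarrow> bool" where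
  "assumption_A \<beta>' \<beta> r a b \<eta> lseq K k0 \<phi> \<longleftrightarrow>
     (\<forall>f\<in>F_class r a b \<eta>. \<exists>m0. \<forall>m\<ge>m0. \<forall>x.
        mesh a b m x \<and> admissible lseq (K f) (k0 f) m x \<longrightarrow>
        (\<forall>i<m. (SUP t\<in>{x i..x (Suc i)}.
                  ereal (infnorm (local_solution \<phi> f \<eta> x i t - local_approx \<phi> f \<eta> x i t)))
               \<le> local_bound \<beta>' \<beta> r \<phi> f \<eta> x i))"

definition k_hat ::
    "real \<Rightarrow> real \<Rightarrow> nat \<Rightarrow> real \<Rightarrow> real \<Rightarrow> real ^ 'd \<Rightarrow> (nat \<Rightarrow> real) \<Rightarrow> real \<Rightarrow> nat \<Rightarrow>
     ('d::finite) ivp_method \<Rightarrow> 'd rhs \<Rightarrow> nat \<Rightarrow> ereal" where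
  "k_hat \<beta>' \<beta> r a b \<eta> lseq K k0 \<phi> f m =
     Inf {Max (local_bound \<beta>' \<beta> r \<phi> f \<eta> x ` {..<m}) | x.
            weak_mesh a b m x \<and> admissible lseq K k0 m x}"

text \<open>The minimum over the empty set is \<open>\<infinity>\<close>.\<close>

definition m_hat ::
    "real \<Rightarrow> real \<Rightarrow> nat \<Rightarrow> real \<Rightarrow> real \<Rightarrow> real ^ 'd \<Rightarrow> (nat \<Rightarrow> real) \<Rightarrow> real \<Rightarrow> nat \<Rightarrow>
     ('d::finite) ivp_method \<Rightarrow> 'd rhs \<Rightarrow> real \<Rightarrow> enat" where
  "m_hat \<beta>' \<beta> r a b \<eta> lseq K k0 \<phi> f \<epsilon> =
     Inf (enat ` {m. k_hat \<beta>' \<beta> r a b \<eta> lseq K k0 \<phi> f m \<le> ereal \<epsilon>})"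


section \<open>Interpolation and the method \<open>\<phi>\<^sup>*\<close>\<close>

definition lagrange ::
    "nat \<Rightarrow> (nat \<Rightarrow> real) \<Rightarrow> (real \<Rightarrow> 'a::real_vector) \<Rightarrow> real \<Rightarrow> 'a" where
  "lagrange r t g s = (\<Sum>k<r. (\<Prod>j\<in>{..<r} - {k}. (s - t j) / (t k - t j)) *\<^sub>R g (t k))"

text \<open>\<open>divided_difference n t g i\<close> is \<open>g[t\<^sub>i, \<dots>, t\<^sub>i\<^sub>+\<^sub>n]\<close>.\<close>

primrec divided_difference ::
    "nat \<Rightarrow> (nat \<Rightarrow> real) \<Rightarrow> (real \<Rightarrow> 'a::real_vector) \<Rightarrow> nat \<Rightarrow> 'a" where
  "divided_difference 0 t g i = g (t i)"
| "divided_difference (Suc n) t g i =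
     (1 / (t (i + Suc n) - t i)) *\<^sub>R
       (divided_difference n t g (Suc i) - divided_difference n t g i)"

primrec iterate ::
    "('d::finite) rhs \<Rightarrow> nat \<Rightarrow> (nat \<Rightarrow> real) \<Rightarrow> real \<Rightarrow> real ^ 'd \<Rightarrow> nat \<Rightarrow> real \<Rightarrow> real ^ 'd" where
  "iterate f r t u y 0 = (\<lambda>s. y)"
| "iterate f r t u y (Suc j) =
     (\<lambda>s. y + integral {u..s} (lagrange r t (\<lambda>\<xi>. f \<xi> (iterate f r t u y j \<xi>))))"

text \<open>For \<open>r = 1\<close> only \<open>k = 0\<close> is used, and the node is \<open>u\<close>.\<close>

definition star_nodes :: "nat \<Rightarrow> real \<Rightarrow> real \<Rightarrow> nat \<Rightarrow> real" where
  "star_nodes r u v k = u + real k * ((v - u) / real (r - 1))"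

text \<open>The number of evaluations of \<open>f\<close>: the iterate \<open>l\<^sub>0\<close> needs \<open>r\<close> values, and each of
  \<open>l\<^sub>1, \<dots>, l\<^sub>r\<close> needs \<open>r - 1\<close> new ones, as all iterates agree at the node \<open>t\<^sub>0 = u\<close>.
  In total this is \<open>r + r (r - 1) = r\<^sup>2\<close>.\<close>

definition phi_star :: "nat \<Rightarrow> ('d::finite) ivp_method" where
  "phi_star r =
     \<lparr>evals = r\<^sup>2,
      approx = (\<lambda>f H v. let (u, y) = hd H in iterate f r (star_nodes r u v) u y (r + 1))\<rparr>"


section \<open>Adaptive mesh selection\<close>

text \<open>One step from \<open>(x\<^sub>i\<^sup>*, y\<^sub>i\<^sup>*)\<close>; \<open>hbar\<close> is \<open>h(\<epsilon>)\<close>, and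
  \<open>\<theta> \<in> (0, 1)\<close> is the relative tolerance in the choice of the step size. The pair is left unchanged
  once \<open>b\<close> has been reached.\<close>

definition adapt_step ::
    "nat \<Rightarrow> real \<Rightarrow> real \<Rightarrow> real \<Rightarrow> real \<Rightarrow> real \<Rightarrow> ('d::finite) rhs \<Rightarrow>
     real \<times> (real ^ 'd) \<Rightarrow> real \<times> (real ^ 'd)" where
  "adapt_step r b \<beta> \<theta> hbar \<epsilon> f = (\<lambda>(x, y).
     if x < b then
       (let xbar = x + min hbar (b - x);
            tbar = (\<lambda>k. x + real k * ((xbar - x) / real r));
            H = (\<lambda>t. f t (iterate f r tbar x y (r + 1) t));
            G = 8 / 3 * (infnorm (divided_difference r tbar H 0) + \<beta>) * (1 + \<theta>);
            x' = x + min ((\<epsilon> / G) powr (1 / real (r + 1))) (b - x)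
        in (x', approx (phi_star r) f [(x, y)] x' x'))
     else (x, y))"

definition adapt_mesh ::
    "nat \<Rightarrow> real \<Rightarrow> real \<Rightarrow> real ^ 'd \<Rightarrow> real \<Rightarrow> real \<Rightarrow> (real \<Rightarrow> real) \<Rightarrow> ('d::finite) rhs \<Rightarrow>
     real \<Rightarrow> nat \<Rightarrow> real" where
  "adapt_mesh r a b \<eta> \<beta> \<theta> h f \<epsilon> i = fst ((adapt_step r b \<beta> \<theta> (h \<epsilon>) \<epsilon> f ^^ i) (a, \<eta>))"

text \<open>This is \<open>\<infinity>\<close> if the algorithm does not terminate.\<close>

definition m_star ::
    "nat \<Rightarrow> real \<Rightarrow> real \<Rightarrow> real ^ 'd \<Rightarrow> real \<Rightarrow> real \<Rightarrow> (real \<Rightarrow> real) \<Rightarrow> ('d::finite) rhs \<Rightarrow>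
     real \<Rightarrow> enat" where
  "m_star r a b \<eta> \<beta> \<theta> h f \<epsilon> = Inf (enat ` {i. adapt_mesh r a b \<eta> \<beta> \<theta> h f \<epsilon> i = b})"

text \<open>The factor 2 accounts for the mesh selection.\<close>

definition adapt_cost ::
    "nat \<Rightarrow> real \<Rightarrow> real \<Rightarrow> real ^ 'd \<Rightarrow> real \<Rightarrow> real \<Rightarrow> (real \<Rightarrow> real) \<Rightarrow> ('d::finite) rhs \<Rightarrow>
     real \<Rightarrow> ereal" where
  "adapt_cost r a b \<eta> \<beta> \<theta> h f \<epsilon> =
     2 * cost (phi_star r :: 'd ivp_method) (m_star r a b \<eta> \<beta> \<theta> h f \<epsilon>)"

end

theory Submission
  imports Defs "HOL-Computational_Algebra.Polynomial"
begin

text \<open>Let \<open>z\<close> be the solution on \<open>{a..b}\<close> and put \<open>w s = \<parallel>z\<^bsup>(r + 1)\<^esup> s\<parallel> / r! + \<beta>\<close>; this is the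
function \<open>weight\<close> below. Everything rests on the observation that, as the tolerance tends to 0, each
quantity in the theorem is governed by \<open>w\<close> alone, whatever the method.

Error coefficients. An estimate \<open>C h\<^bsup>r + 1\<^esup>\<close> of the local error makes the node values converge to
\<open>z\<close> (\<open>global_error_small\<close>), provided the local solutions stay in the tube around \<open>z\<close> where
\<open>f\<close> is smooth; this is part of the induction over the mesh. There the derivative of order
\<open>r + 1\<close> of a local solution is a continuous function of the point \<open>(t, y)\<close>, so it is uniformly
close to that of \<open>z\<close>, and \<open>c\<^sub>i\<close> is uniformly close to \<open>2 w\<close> on the \<open>i\<close>-th subinterval. As
\<open>w \<ge> \<beta> > 0\<close>, closeness is also relative. The lemmas are \<open>error_coeff_close\<close>,
\<open>phi_star_coeffs_follow_weight\<close> and \<open>method_coeffs_follow_weight\<close>. Smallness of the subintervals is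
free of charge: \<open>c\<^sub>i \<ge> 2 \<beta>\<close>, so a local bound of size \<open>\<epsilon>\<close> forces
\<open>h\<^sub>i\<^bsup>r + 1\<^esup> \<le> \<epsilon> / (2 \<beta>)\<close>.

First inequality. On a common mesh the local bounds of two methods differ by a factor that tends to
1, and \<open>p1 > 1\<close> absorbs it (\<open>k_hat_compare\<close>).

Second inequality. The iterates that define \<open>\<phi>\<^sup>*\<close> have local error \<open>O(h\<^bsup>r + 1\<^esup>)\<close>. A divided
difference of order \<open>r\<close> magnifies this by \<open>h\<^bsup>-r\<^esup>\<close> only, so what the algorithm computes tends
to \<open>z\<^bsup>(r + 1)\<^esup> / r!\<close>, and \<open>G\<^sub>i\<close> is close to \<open>8/3 (1 + \<theta>) w\<close>. This exceeds
\<open>c\<^sub>i\<close>, and the step length satisfies \<open>G\<^sub>i h\<^sub>i\<^bsup>r + 1\<^esup> \<le> \<epsilon>\<close>, so the local bounds are at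
most \<open>\<epsilon>\<close> (\<open>balanced_mesh_bound\<close>).

Third inequality. Measure subintervals by their \<open>mass\<close>, the integral of \<open>w\<^bsup>1 / (r + 1)\<^esup>\<close>. If
\<open>k h\<^bsup>r + 1\<^esup> \<le> B\<close> for some upper bound \<open>k\<close> of \<open>w\<close> on a subinterval of length \<open>h\<close>, then
its mass is at most \<open>B\<^bsup>1 / (r + 1)\<^esup>\<close>; lower bounds give the reverse. All steps of the algorithm except
the last have \<open>G\<^sub>i h\<^sub>i\<^bsup>r + 1\<^esup> = \<epsilon>\<close>, hence mass at least \<open>A\<^bsup>1 / (r + 1)\<^esup>\<close> with \<open>A\<close> about
\<open>\<epsilon> / (8/3 (1 + \<theta>))\<close>. A competing mesh for the tolerance \<open>p \<epsilon>\<close> has masses at most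
\<open>B\<^bsup>1 / (r + 1)\<^esup>\<close> with \<open>B\<close> about \<open>p \<epsilon> / 2\<close>. The constant \<open>p\<close> is small enough to give \<open>B \<le> A\<close>
even after the perturbations, and since the total mass is the same, the competing mesh needs at least
as many subintervals (\<open>balanced_mesh_count\<close>).\<close>

section \<open>Initial value problems with a Lipschitz right-hand side\<close>

lemma vector_differentiable_bound:
  fixes g :: "real \<Rightarrow> 'a::real_normed_vector"
  assumes "convex S"
    and "\<And>x. x \<in> S \<Longrightarrow> (g has_vector_derivative g' x) (at x within S)"
    and "\<And>x. x \<in> S \<Longrightarrow> norm (g' x) \<le> B"
    and "x \<in> S" "y \<in> S"
  shows "norm (g x - g y) \<le> B * \<bar>x - y\<bar>"
proof -
  have "onorm (\<lambda>h. h *\<^sub>R g' x) \<le> B" if "x \<in> S" for x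
    using assms(3)[OF that]
    by (intro onorm_le) (simp add: mult_left_mono mult.commute[of B])
  then show ?thesis
    using assms differentiable_bound[of S g "\<lambda>x h. h *\<^sub>R g' x" B x y]
    by (simp add: has_vector_derivative_def)
qed

text \<open>The Euclidean norm replaces the maximum norm in all qualitative estimates, since calculus for
vector-valued functions is formulated with it; only the value of the Lipschitz constant is affected.\<close>

locale lipschitz_rhs =
  fixes f :: "('d::finite) rhs" and a b L :: real
  assumes L_nonneg: "0 \<le> L"
    and cont: "continuous_on ({a..b} \<times> UNIV) (\<lambda>(t, y). f t y)"
    and lip: "\<And>t y y'. t \<in> {a..b} \<Longrightarrow> norm (f t y - f t y') \<le> L * norm (y - y')"
begin

lemma continuous_along:
  assumes "a \<le> u" "v \<le> b" "continuous_on {u..v} z"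
  shows "continuous_on {u..v} (\<lambda>t. f t (z t))"
proof -
  have "continuous_on {u..v} ((\<lambda>(t, y). f t y) \<circ> (\<lambda>t. (t, z t)))"
    using assms by (intro continuous_on_compose continuous_intros continuous_on_subset[OF cont]) auto
  then show ?thesis by (simp add: o_def)
qed

lemma solvesI_integral:
  assumes "a \<le> u" "v \<le> b" "continuous_on {u..v} z"
    and z: "\<And>t. t \<in> {u..v} \<Longrightarrow> z t = y + integral {u..t} (\<lambda>s. f s (z s))"
    and "u \<le> v"
  shows "solves_ivp f u v y z"
proof -
  have "(z has_vector_derivative f t (z t)) (at t within {u..v})" if t: "t \<in> {u..v}" for t
  proof -
    have "((\<lambda>t. y + integral {u..t} (\<lambda>s. f s (z s))) has_vector_derivative 0 + f t (z t))
            (at t within {u..v})"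
      using assms(1-3) t
      by (intro has_vector_derivative_add has_vector_derivative_const
            integral_has_vector_derivative continuous_along)
    then show ?thesis
      by (rule has_vector_derivative_transform[rotated 2, THEN has_vector_derivative_eq_rhs])
         (use t z in auto)
  qed
  moreover have "z u = y" using z[of u] \<open>u \<le> v\<close> by simp
  ultimately show ?thesis unfolding solves_ivp_def by blast
qed

fun picard :: "real \<Rightarrow> real ^ 'd \<Rightarrow> nat \<Rightarrow> real \<Rightarrow> real ^ 'd" where
  "picard u y 0 = (\<lambda>t. y)"
| "picard u y (Suc n) = (\<lambda>t. y + integral {u..t} (\<lambda>s. f s (picard u y n s)))"

lemma continuous_picard:
  assumes "a \<le> u" "v \<le> b"
  shows "continuous_on {u..v} (picard u y n)"
proof (cases n)
  case (Suc k)
  have "continuous_on {u..v} (picard u y k)"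
  proof (induction k)
    case (Suc k)
    have "(\<lambda>s. f s (picard u y k s)) integrable_on {u..v}"
      using continuous_along[OF assms Suc] by (rule integrable_continuous_real)
    then show ?case by (simp add: continuous_on_add indefinite_integral_continuous_1)
  qed simp
  then have "(\<lambda>s. f s (picard u y k s)) integrable_on {u..v}"
    using continuous_along[OF assms] integrable_continuous_real by blast
  then show ?thesis using Suc by (simp add: continuous_on_add indefinite_integral_continuous_1)
qed simp

text \<open>The factorial comes from integrating the previous estimate. It makes the Picard iteration converge
on the whole of \<open>{u..v}\<close>, so that no continuation argument for short intervals is needed.\<close>

lemma picard_difference:
  assumes "a \<le> u" "v \<le> b" and M: "\<And>t. t \<in> {u..v} \<Longrightarrow> norm (f t y) \<le> M" and t: "t \<in> {u..v}"
  shows "norm (picard u y (Suc n) t - picard u y n t) \<le> M * L ^ n * (t - u) ^ Suc n / fact (Suc n)"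
  using t
proof (induction n arbitrary: t)
  case 0
  have "norm (integral {u..t} (\<lambda>s. f s y)) \<le> integral {u..t} (\<lambda>s. M)"
    using 0 assms
    by (intro integral_norm_bound_integral integrable_continuous_real
          continuous_along[of u t "\<lambda>_. y"] continuous_intros) auto
  then show ?case using 0 by (simp add: mult.commute)
next
  case (Suc n)
  let ?p = "picard u y"
  have int: "(\<lambda>s. f s (?p k s)) integrable_on {u..t}" for k
    using Suc.prems assms by (intro integrable_continuous_real continuous_along continuous_picard) auto
  let ?B = "\<lambda>s. L * (M * L ^ n * (s - u) ^ Suc n / fact (Suc n))"
  have B: "(?B has_integral
       M * L ^ Suc n * (t - u) ^ Suc (Suc n) / fact (Suc (Suc n)) -
       M * L ^ Suc n * (u - u) ^ Suc (Suc n) / fact (Suc (Suc n))) {u..t}"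
  proof (rule fundamental_theorem_of_calculus)
    fix x assume "x \<in> {u..t}"
    have "((\<lambda>s. M * L ^ Suc n * (s - u) ^ Suc (Suc n) / fact (Suc (Suc n)))
        has_real_derivative M * L ^ Suc n * (real (Suc (Suc n)) * (x - u) ^ Suc n) / fact (Suc (Suc n)))
        (at x within {u..t})"
      by (rule DERIV_cdivide DERIV_cmult derivative_eq_intros refl)+ auto
    moreover have "M * L ^ Suc n * (real (Suc (Suc n)) * (x - u) ^ Suc n) / fact (Suc (Suc n)) = ?B x"
      by (subst fact_Suc) (simp del: fact_Suc of_nat_Suc add: divide_simps)
    ultimately show "((\<lambda>s. M * L ^ Suc n * (s - u) ^ Suc (Suc n) / fact (Suc (Suc n)))
        has_vector_derivative ?B x) (at x within {u..t})"
      unfolding has_real_derivative_iff_has_vector_derivative[symmetric] by (rule DERIV_cong)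
  qed (use Suc.prems in auto)
  have "?p (Suc (Suc n)) t - ?p (Suc n) t
      = integral {u..t} (\<lambda>s. f s (?p (Suc n) s)) - integral {u..t} (\<lambda>s. f s (?p n s))"
    by simp
  also have "\<dots> = integral {u..t} (\<lambda>s. f s (?p (Suc n) s) - f s (?p n s))"
    by (rule integral_diff[symmetric]) (rule int)+
  also have "norm \<dots> \<le> integral {u..t} ?B"
  proof (rule integral_norm_bound_integral)
    show "(\<lambda>s. f s (?p (Suc n) s) - f s (?p n s)) integrable_on {u..t}"
      using int[of "Suc n"] int[of n] by (rule integrable_diff)
    show "?B integrable_on {u..t}" using B by blast
    fix s assume s: "s \<in> {u..t}"
    have "norm (f s (?p (Suc n) s) - f s (?p n s)) \<le> L * norm (?p (Suc n) s - ?p n s)"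
      using s Suc.prems assms by (intro lip) auto
    also have "\<dots> \<le> ?B s"
      using s Suc.prems by (intro mult_left_mono Suc.IH L_nonneg) auto
    finally show "norm (f s (?p (Suc n) s) - f s (?p n s)) \<le> ?B s" .
  qed
  also have "\<dots> = M * L ^ Suc n * (t - u) ^ Suc (Suc n) / fact (Suc (Suc n))"
    using integral_unique[OF B] by simp
  finally show ?case .
qed

text \<open>The Picard iterates form a series of increments that is dominated by an exponential series. Their
uniform limit solves the integral equation, because the Lipschitz condition carries uniform convergence
through the right-hand side.\<close>

lemma solution_exists:
  assumes "a \<le> u" "u \<le> v" "v \<le> b"
  shows "\<exists>z. solves_ivp f u v y z"
proof -
  let ?p = "picard u y"
  have "compact ((\<lambda>t. f t y) ` {u..v})"
    using assms by (intro compact_continuous_image continuous_along[of u v "\<lambda>_. y"] continuous_intros) auto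
  then obtain M where M: "\<And>t. t \<in> {u..v} \<Longrightarrow> norm (f t y) \<le> M"
    using compact_imp_bounded bounded_iff by (metis imageI)
  have M0: "0 \<le> M" using M[of u] assms norm_ge_zero order_trans by (metis atLeastAtMost_iff order_refl)
  define d where "d = (\<lambda>n t. ?p (Suc n) t - ?p n t)"
  define B where "B = (\<lambda>n. M * L ^ n * (v - u) ^ Suc n / fact (Suc n))"
  have d_le: "norm (d n t) \<le> B n" if "t \<in> {u..v}" for n t
  proof -
    have "norm (d n t) \<le> M * L ^ n * (t - u) ^ Suc n / fact (Suc n)"
      unfolding d_def using assms M that by (intro picard_difference) auto
    also have "\<dots> \<le> B n"
      unfolding B_def using that M0 L_nonneg
      by (intro divide_right_mono mult_left_mono power_mono) auto
    finally show ?thesis .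
  qed
  have "summable B"
  proof (rule summable_comparison_test)
    show "summable (\<lambda>n. M * (v - u) * ((L * (v - u)) ^ n /\<^sub>R fact n))"
      by (intro summable_mult summable_exp_generic)
    have "norm (B n) \<le> M * (v - u) * ((L * (v - u)) ^ n /\<^sub>R fact n)" for n
    proof -
      have "0 \<le> B n" using assms M0 L_nonneg by (simp add: B_def)
      moreover have "B n \<le> M * L ^ n * (v - u) ^ Suc n / fact n"
        unfolding B_def using assms M0 L_nonneg by (intro divide_left_mono fact_mono) auto
      moreover have "M * L ^ n * (v - u) ^ Suc n / fact n = M * (v - u) * ((L * (v - u)) ^ n /\<^sub>R fact n)"
        by (simp add: power_mult_distrib divide_inverse)
      ultimately show ?thesis by simp
    qed
    then show "\<exists>N. \<forall>n\<ge>N. norm (B n) \<le> M * (v - u) * ((L * (v - u)) ^ n /\<^sub>R fact n)" by blast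
  qed
  then have lim_d: "uniform_limit {u..v} (\<lambda>n t. \<Sum>i<n. d i t) (\<lambda>t. suminf (\<lambda>i. d i t)) sequentially"
    using d_le by (intro Weierstrass_m_test)
  have sum_d: "?p n t = y + (\<Sum>i<n. d i t)" for n t
    unfolding d_def by (subst sum_lessThan_telescope) simp
  define z where "z = (\<lambda>t. y + suminf (\<lambda>i. d i t))"
  have lim: "uniform_limit {u..v} ?p z sequentially"
    unfolding z_def sum_d[abs_def] by (intro uniform_limit_add uniform_limit_const lim_d)
  have z_cont: "continuous_on {u..v} z"
    using lim by (rule uniform_limit_theorem[rotated]) (use assms continuous_picard in auto)
  have "z t = y + integral {u..t} (\<lambda>s. f s (z s))" if t: "t \<in> {u..v}" for t
  proof -
    have int_z: "(\<lambda>s. f s (z s)) integrable_on {u..t}"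
      using z_cont t assms
      by (intro integrable_continuous_real continuous_along) (auto intro: continuous_on_subset)
    have int_p: "(\<lambda>s. f s (?p n s)) integrable_on {u..t}" for n
      using assms t by (intro integrable_continuous_real continuous_along continuous_picard) auto
    have "(\<lambda>n. ?p (Suc n) t) \<longlonglongrightarrow> y + integral {u..t} (\<lambda>s. f s (z s))"
    proof (rule LIMSEQ_I)
      fix e :: real assume e: "0 < e"
      define e' where "e' = e / (2 * (L * (v - u) + 1))"
      have q: "0 \<le> L * (v - u)" using assms L_nonneg by simp
      have "0 < e'" unfolding e'_def using e q by (simp add: add_nonneg_pos)
      with lim have "\<forall>\<^sub>F n in sequentially. \<forall>s\<in>{u..v}. dist (?p n s) (z s) < e'"
        by (rule uniform_limitD)
      then obtain N where N: "\<And>n s. n \<ge> N \<Longrightarrow> s \<in> {u..v} \<Longrightarrow> norm (?p n s - z s) < e'"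
        unfolding eventually_sequentially dist_norm by blast
      have "norm (?p (Suc n) t - (y + integral {u..t} (\<lambda>s. f s (z s)))) < e" if "n \<ge> N" for n
      proof -
        have "?p (Suc n) t - (y + integral {u..t} (\<lambda>s. f s (z s)))
            = integral {u..t} (\<lambda>s. f s (?p n s) - f s (z s))"
          using int_z int_p by (simp add: integral_diff)
        also have "norm \<dots> \<le> integral {u..t} (\<lambda>s. L * e')"
        proof (rule integral_norm_bound_integral)
          fix s assume s: "s \<in> {u..t}"
          have "norm (f s (?p n s) - f s (z s)) \<le> L * norm (?p n s - z s)"
            using s t assms by (intro lip) auto
          also have "\<dots> \<le> L * e'"
            using N[OF that, of s] s t by (intro mult_left_mono L_nonneg) auto
          finally show "norm (f s (?p n s) - f s (z s)) \<le> L * e'" .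
        qed (use int_z int_p in \<open>auto intro: integrable_diff\<close>)
        also have "\<dots> = (t - u) * L * e'" using t by simp
        also have "\<dots> \<le> (v - u) * L * e'"
          using t L_nonneg \<open>0 < e'\<close> by (intro mult_right_mono) auto
        also have "\<dots> \<le> (L * (v - u) + 1) * e'" using \<open>0 < e'\<close> by (simp add: algebra_simps)
        also have "\<dots> = e / 2" unfolding e'_def using q by (simp add: field_simps add_nonneg_eq_0_iff)
        also have "\<dots> < e" using e by simp
        finally show ?thesis .
      qed
      then show "\<exists>N. \<forall>n\<ge>N. norm (?p (Suc n) t - (y + integral {u..t} (\<lambda>s. f s (z s)))) < e" by blast
    qed
    moreover have "(\<lambda>n. ?p (Suc n) t) \<longlonglongrightarrow> z t"
      using tendsto_uniform_limitI[OF lim t] by (rule LIMSEQ_Suc)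
    ultimately show ?thesis using LIMSEQ_unique by blast
  qed
  then have "solves_ivp f u v y z"
    using assms z_cont by (intro solvesI_integral) auto
  then show ?thesis by blast
qed

lemma ivp_solution_solves:
  assumes "a \<le> u" "u \<le> v" "v \<le> b"
  shows "solves_ivp f u v y (ivp_solution f u v y)"
  unfolding ivp_solution_def using solution_exists[OF assms] by (rule someI_ex)

lemma solves_ivp_continuous: "solves_ivp f u v y z \<Longrightarrow> continuous_on {u..v} z"
  unfolding solves_ivp_def
  by (auto simp: continuous_on_eq_continuous_within intro: has_vector_derivative_continuous)

lemma solves_ivp_subinterval:
  assumes "solves_ivp f u v y z" "u \<le> u'" "v' \<le> v" "u' \<le> v'"
  shows "solves_ivp f u' v' (z u') z"
  using assms unfolding solves_ivp_def
  by (auto intro: has_vector_derivative_within_subset[of _ _ _ "{u..v}"])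

text \<open>Stability over one short step. At the point where the difference of the solutions is largest, the
mean value inequality bounds it by its initial value plus \<open>L (v - u)\<close> times itself, and
\<open>1 / (1 - q) \<le> 1 + 2 q\<close> for \<open>q \<le> 1 / 2\<close>. Multiplying these factors along a mesh replaces
Gronwall's inequality.\<close>

lemma solutions_stay_close:
  assumes z1: "solves_ivp f u v y1 z1" and z2: "solves_ivp f u v y2 z2"
    and "a \<le> u" "v \<le> b" and small: "L * (v - u) \<le> 1 / 2" and t: "t \<in> {u..v}"
  shows "norm (z1 t - z2 t) \<le> (1 + 2 * L * (v - u)) * norm (y1 - y2)"
proof -
  let ?d = "\<lambda>t. z1 t - z2 t"
  have "continuous_on {u..v} (\<lambda>t. norm (?d t))"
    using z1 z2 by (intro continuous_intros solves_ivp_continuous)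
  then obtain s where s: "s \<in> {u..v}" and s_max: "\<And>t. t \<in> {u..v} \<Longrightarrow> norm (?d t) \<le> norm (?d s)"
    using continuous_attains_sup[of "{u..v}" "\<lambda>t. norm (?d t)"] t by auto
  have "norm (?d s - ?d u) \<le> L * norm (?d s) * \<bar>s - u\<bar>"
  proof (rule vector_differentiable_bound[of "{u..v}" ?d "\<lambda>t. f t (z1 t) - f t (z2 t)"])
    fix x assume x: "x \<in> {u..v}"
    show "(?d has_vector_derivative f x (z1 x) - f x (z2 x)) (at x within {u..v})"
      using z1 z2 x unfolding solves_ivp_def by (intro has_vector_derivative_diff) auto
    have "norm (f x (z1 x) - f x (z2 x)) \<le> L * norm (?d x)"
      using x assms by (intro lip) auto
    also have "\<dots> \<le> L * norm (?d s)" using s_max[OF x] L_nonneg by (rule mult_left_mono)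
    finally show "norm (f x (z1 x) - f x (z2 x)) \<le> L * norm (?d s)" .
  qed (use s in auto)
  also have "\<dots> \<le> L * norm (?d s) * (v - u)"
    using s L_nonneg by (intro mult_left_mono) auto
  finally have "norm (?d s) \<le> norm (?d u) + L * (v - u) * norm (?d s)"
    using norm_triangle_sub[of "?d s" "?d u"] by (simp add: algebra_simps)
  then have 1: "(1 - L * (v - u)) * norm (?d s) \<le> norm (y1 - y2)"
    using z1 z2 by (simp add: solves_ivp_def algebra_simps)
  define q where "q = L * (v - u)"
  have q: "0 \<le> q" "q \<le> 1 / 2" using small s L_nonneg by (auto simp: q_def)
  have "q * q \<le> q * (1 / 2)" using q by (intro mult_left_mono) auto
  then have "1 \<le> (1 + 2 * q) * (1 - q)" by (simp add: algebra_simps)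
  then have "norm (?d s) \<le> (1 + 2 * q) * (1 - q) * norm (?d s)"
    using mult_right_mono[of 1 "(1 + 2 * q) * (1 - q)" "norm (?d s)"] by simp
  also have "\<dots> \<le> (1 + 2 * q) * norm (y1 - y2)"
    using mult_left_mono[OF 1, of "1 + 2 * q"] q unfolding q_def by (simp add: mult.assoc)
  finally show ?thesis using s_max[OF t] by (simp add: q_def mult.assoc)
qed

end

section \<open>Differentiation along solutions\<close>

lemma C_k_on_continuous: "C_k_on k S g \<Longrightarrow> continuous_on S g"
  by (cases k) (auto intro: has_derivative_continuous_on)

lemma C_k_on_mono_Suc: "C_k_on (Suc k) S g \<Longrightarrow> C_k_on k S g"
proof (induction k arbitrary: g)
  case 0
  then show ?case using C_k_on_continuous[of "Suc 0"] by simp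
next
  case (Suc k)
  then show ?case by (metis C_k_on.simps(2))
qed

lemma C_k_on_const: "C_k_on k S (\<lambda>x. c)"
proof (induction k arbitrary: c)
  case (Suc k)
  then show ?case by (auto intro!: exI[of _ "\<lambda>x h. 0"])
qed simp

lemma C_k_on_add: "C_k_on k S g \<Longrightarrow> C_k_on k S h \<Longrightarrow> C_k_on k S (\<lambda>x. g x + h x)"
proof (induction k arbitrary: g h)
  case (Suc k)
  then obtain g' h' where
    "\<forall>x\<in>S. (g has_derivative g' x) (at x within S)" "\<forall>e\<in>Basis. C_k_on k S (\<lambda>x. g' x e)"
    "\<forall>x\<in>S. (h has_derivative h' x) (at x within S)" "\<forall>e\<in>Basis. C_k_on k S (\<lambda>x. h' x e)"
    by auto
  then show ?case
    using Suc.IH by (auto intro!: exI[of _ "\<lambda>x e. g' x e + h' x e"] has_derivative_add)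
qed (simp add: continuous_on_add)

lemma C_k_on_sum:
  assumes "\<And>i. i \<in> I \<Longrightarrow> C_k_on k S (g i)"
  shows "C_k_on k S (\<lambda>x. \<Sum>i\<in>I. g i x)"
  using assms by (induction I rule: infinite_finite_induct) (auto simp: C_k_on_const C_k_on_add)

lemma C_k_on_scaleR:
  fixes g :: "'a::euclidean_space \<Rightarrow> 'b::real_normed_vector"
  shows "C_k_on k S c \<Longrightarrow> C_k_on k S g \<Longrightarrow> C_k_on k S (\<lambda>x. c x *\<^sub>R g x)"
proof (induction k arbitrary: c g)
  case (Suc k)
  then obtain c' g' where
    c: "\<forall>x\<in>S. (c has_derivative c' x) (at x within S)" "\<forall>e\<in>Basis. C_k_on k S (\<lambda>x. c' x e)" and
    g: "\<forall>x\<in>S. (g has_derivative g' x) (at x within S)" "\<forall>e\<in>Basis. C_k_on k S (\<lambda>x. g' x e)"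
    by auto
  have "C_k_on k S (\<lambda>x. c x *\<^sub>R g' x e + c' x e *\<^sub>R g x)" if "e \<in> Basis" for e
    using c(2) g(2) Suc.prems[THEN C_k_on_mono_Suc] that by (intro C_k_on_add Suc.IH) blast+
  moreover have "\<forall>x\<in>S. ((\<lambda>x. c x *\<^sub>R g x) has_derivative
      (\<lambda>h. c x *\<^sub>R g' x h + c' x h *\<^sub>R g x)) (at x within S)"
    using c g by (auto intro: has_derivative_scaleR)
  ultimately show ?case
    unfolding C_k_on.simps by (intro exI[of _ "\<lambda>x e. c x *\<^sub>R g' x e + c' x e *\<^sub>R g x"]) auto
qed (simp add: continuous_on_scaleR)

lemma C_k_on_bounded_linear:
  assumes "bounded_linear A"
  shows "C_k_on k S g \<Longrightarrow> C_k_on k S (\<lambda>x. A (g x))"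
proof (induction k arbitrary: g)
  case 0
  then show ?case using assms by (simp add: bounded_linear.continuous_on)
next
  case (Suc k)
  then obtain g' where
    g: "\<forall>x\<in>S. (g has_derivative g' x) (at x within S)" "\<forall>e\<in>Basis. C_k_on k S (\<lambda>x. g' x e)"
    by auto
  moreover have "\<forall>x\<in>S. ((\<lambda>x. A (g x)) has_derivative (\<lambda>e. A (g' x e))) (at x within S)"
    using g(1) bounded_linear.has_derivative[OF assms] by blast
  moreover have "\<forall>e\<in>Basis. C_k_on k S (\<lambda>x. A (g' x e))"
    using Suc.IH g(2) by blast
  ultimately show ?case
    unfolding C_k_on.simps by (intro exI[of _ "\<lambda>x e. A (g' x e)"] conjI)
qed

text \<open>The chain rule: \<open>d/dt g (t, z t)\<close> is the derivative of \<open>g\<close> in the direction \<open>(1, f t (z t))\<close>. Expanded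
in the standard basis, this is a function of \<open>(t, z t)\<close> with one degree of smoothness less, and the
same function serves for all solutions \<open>z\<close>. That is what later makes derivatives of different
solutions comparable.\<close>

lemma derivative_along_flow:
  fixes f :: "('d::finite) rhs" and g :: "real \<times> (real ^ 'd) \<Rightarrow> real ^ 'd"
  assumes g: "C_k_on (Suc k) S g" and f: "C_k_on k S (\<lambda>(t, y). f t y)"
  obtains g1 where "C_k_on k S g1"
    and "\<And>u v y z t. solves_ivp f u v y z \<Longrightarrow> \<forall>t\<in>{u..v}. (t, z t) \<in> S \<Longrightarrow> t \<in> {u..v} \<Longrightarrow>
      ((\<lambda>t. g (t, z t)) has_vector_derivative g1 (t, z t)) (at t within {u..v})"
proof -
  from g obtain g' where
    g': "\<And>x. x \<in> S \<Longrightarrow> (g has_derivative g' x) (at x within S)"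
        "\<And>e. e \<in> Basis \<Longrightarrow> C_k_on k S (\<lambda>x. g' x e)"
    by auto
  define w where "w = (\<lambda>x::real \<times> (real ^ 'd). (1::real, case x of (t, y) \<Rightarrow> f t y))"
  define g1 where "g1 = (\<lambda>x. \<Sum>e\<in>Basis. (w x \<bullet> e) *\<^sub>R g' x e)"
  have w: "C_k_on k S w"
  proof -
    have "bounded_linear (\<lambda>y. (0::real, y::real ^ 'd))"
      by (rule bounded_linear_Pair[OF bounded_linear_zero bounded_linear_ident])
    from C_k_on_add[OF C_k_on_const C_k_on_bounded_linear[OF this f], of "(1, 0)"]
    show ?thesis by (simp add: w_def)
  qed
  have "C_k_on k S g1"
    unfolding g1_def
    by (intro C_k_on_sum C_k_on_scaleR w[THEN C_k_on_bounded_linear[OF bounded_linear_inner_left]] g')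
  moreover have "((\<lambda>t. g (t, z t)) has_vector_derivative g1 (t, z t)) (at t within {u..v})"
    if z: "solves_ivp f u v y z" and S: "\<forall>t\<in>{u..v}. (t, z t) \<in> S" and t: "t \<in> {u..v}"
    for u v y z t
  proof -
    let ?w = "w (t, z t)"
    have "((\<lambda>t. (t, z t)) has_vector_derivative (1, f t (z t))) (at t within {u..v})"
      using z t unfolding solves_ivp_def by (intro has_vector_derivative_Pair) auto
    then have 1: "((\<lambda>t. (t, z t)) has_derivative (\<lambda>h. h *\<^sub>R ?w)) (at t within {u..v})"
      by (simp add: has_vector_derivative_def w_def)
    have 2: "(g has_derivative g' (t, z t)) (at (t, z t) within (\<lambda>t. (t, z t)) ` {u..v})"
      using g'(1)[of "(t, z t)"] S t by (auto intro: has_derivative_subset)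
    have lin: "linear (g' (t, z t))" using 2 by (simp add: has_derivative_linear)
    have "((\<lambda>t. g (t, z t)) has_derivative (\<lambda>h. g' (t, z t) (h *\<^sub>R ?w))) (at t within {u..v})"
      using has_derivative_in_compose[OF 1 2] .
    moreover have "g' (t, z t) (h *\<^sub>R ?w) = h *\<^sub>R g1 (t, z t)" for h
    proof -
      have "g' (t, z t) ?w = g' (t, z t) (\<Sum>e\<in>Basis. (?w \<bullet> e) *\<^sub>R e)"
        by (simp add: euclidean_representation)
      also have "\<dots> = g1 (t, z t)"
        unfolding g1_def by (simp add: linear_sum[OF lin] linear_scale[OF lin])
      finally show ?thesis by (simp add: linear_scale[OF lin])
    qed
    ultimately show ?thesis by (simp add: has_vector_derivative_def)
  qed
  ultimately show thesis using that by blast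
qed

lemma derivatives_along_flow_exist:
  fixes f :: "('d::finite) rhs" and g :: "real \<times> (real ^ 'd) \<Rightarrow> real ^ 'd"
  assumes "C_k_on k S g" and "C_k_on k S (\<lambda>(t, y). f t y)"
  shows "\<exists>G. G 0 = g \<and> (\<forall>j\<le>k. continuous_on S (G j)) \<and>
    (\<forall>j<k. \<forall>u v y z t. solves_ivp f u v y z \<longrightarrow> (\<forall>t\<in>{u..v}. (t, z t) \<in> S) \<longrightarrow> t \<in> {u..v} \<longrightarrow>
      ((\<lambda>t. G j (t, z t)) has_vector_derivative G (Suc j) (t, z t)) (at t within {u..v}))"
  using assms
proof (induction k arbitrary: g)
  case 0
  then show ?case by auto
next
  case (Suc k)
  have f: "C_k_on k S (\<lambda>(t, y). f t y)" using Suc.prems(2) by (rule C_k_on_mono_Suc)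
  obtain g1 where g1: "C_k_on k S g1"
    "\<And>u v y z t. solves_ivp f u v y z \<Longrightarrow> \<forall>t\<in>{u..v}. (t, z t) \<in> S \<Longrightarrow> t \<in> {u..v} \<Longrightarrow>
      ((\<lambda>t. g (t, z t)) has_vector_derivative g1 (t, z t)) (at t within {u..v})"
    using derivative_along_flow[OF Suc.prems(1) f] by blast
  from Suc.IH[OF g1(1) f] obtain G where G: "G 0 = g1" "\<forall>j\<le>k. continuous_on S (G j)"
    "\<forall>j<k. \<forall>u v y z t. solves_ivp f u v y z \<longrightarrow> (\<forall>t\<in>{u..v}. (t, z t) \<in> S) \<longrightarrow> t \<in> {u..v} \<longrightarrow>
      ((\<lambda>t. G j (t, z t)) has_vector_derivative G (Suc j) (t, z t)) (at t within {u..v})"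
    by blast
  define G' where "G' = (\<lambda>j. case j of 0 \<Rightarrow> g | Suc i \<Rightarrow> G i)"
  have "G' 0 = g" by (simp add: G'_def)
  moreover have "\<forall>j\<le>Suc k. continuous_on S (G' j)"
    using G(2) C_k_on_continuous[OF Suc.prems(1)] by (auto simp: G'_def split: nat.split)
  moreover have "\<forall>j<Suc k. \<forall>u v y z t. solves_ivp f u v y z \<longrightarrow> (\<forall>t\<in>{u..v}. (t, z t) \<in> S) \<longrightarrow>
      t \<in> {u..v} \<longrightarrow>
      ((\<lambda>t. G' j (t, z t)) has_vector_derivative G' (Suc j) (t, z t)) (at t within {u..v})"
  proof (intro allI impI)
    fix j u v y z t
    assume *: "j < Suc k" "solves_ivp f u v y z" "\<forall>t\<in>{u..v}. (t, z t) \<in> S" "t \<in> {u..v}"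
    show "((\<lambda>t. G' j (t, z t)) has_vector_derivative G' (Suc j) (t, z t)) (at t within {u..v})"
    proof (cases j)
      case 0
      then show ?thesis using g1(2)[OF *(2-4)] G(1) by (simp add: G'_def)
    next
      case (Suc i)
      then show ?thesis using G(3)[rule_format, of i u v y z t] * by (simp add: G'_def)
    qed
  qed
  ultimately show ?case by blast
qed

text \<open>Identifies iterated derivatives within a closed interval. Only values on the interval matter,
because derivatives are taken within it.\<close>

lemma nth_vderiv_eqI:
  fixes z :: "real \<Rightarrow> 'a::euclidean_space"
  assumes "u < v"
    and "\<And>t. t \<in> {u..v} \<Longrightarrow> g 0 t = z t"
    and der: "\<And>j t. j < n \<Longrightarrow> t \<in> {u..v} \<Longrightarrow>
      (g j has_vector_derivative g (Suc j) t) (at t within {u..v})"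
  shows "j \<le> n \<Longrightarrow> t \<in> {u..v} \<Longrightarrow> nth_vderiv j {u..v} z t = g j t"
    and "nth_vderiv_exists n {u..v} z"
proof -
  have *: "(nth_vderiv j {u..v} z has_vector_derivative g (Suc j) t) (at t within {u..v})"
    if "j < n" "t \<in> {u..v}" "\<forall>t\<in>{u..v}. nth_vderiv j {u..v} z t = g j t" for j t
    using that by (intro has_vector_derivative_transform[OF _ _ der]) auto
  have eq: "j \<le> n \<longrightarrow> (\<forall>t\<in>{u..v}. nth_vderiv j {u..v} z t = g j t)" for j
  proof (induction j)
    case (Suc j)
    show ?case
    proof (intro impI ballI)
      fix t assume t: "t \<in> {u..v}" and j: "Suc j \<le> n"
      have "(nth_vderiv j {u..v} z has_vector_derivative g (Suc j) t) (at t within {u..v})"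
        using Suc j t by (intro *) auto
      then show "nth_vderiv (Suc j) {u..v} z t = g (Suc j) t"
        using vector_derivative_within_closed_interval[OF \<open>u < v\<close> t] by simp
    qed
  qed (use assms in auto)
  then show "j \<le> n \<Longrightarrow> t \<in> {u..v} \<Longrightarrow> nth_vderiv j {u..v} z t = g j t" by blast
  show "nth_vderiv_exists n {u..v} z"
    unfolding nth_vderiv_exists_def
  proof (intro allI impI ballI)
    fix k t assume "k < n" "t \<in> {u..v}"
    then have "(nth_vderiv k {u..v} z has_vector_derivative g (Suc k) t) (at t within {u..v})"
      using eq[of k] by (intro *) auto
    then show "nth_vderiv k {u..v} z differentiable (at t within {u..v})"
      by (rule differentiableI_vector)
  qed
qed

section \<open>Taylor remainders, interpolation and divided differences\<close>

text \<open>The remainder of the full polynomial of degree \<open>n\<close> is controlled by the oscillation of the \<open>n\<close>-th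
derivative, so it is \<open>o((v - u)\<^sup>n)\<close> without a derivative of order \<open>n + 1\<close>. This matters
because \<open>f\<close> is of class \<open>C\<^sup>r\<close> only. By induction: the derivative of the remainder is the remainder of the
derivative.\<close>

lemma taylor_remainder_bound:
  fixes g :: "nat \<Rightarrow> real \<Rightarrow> 'a::real_normed_vector"
  assumes "\<And>j t. j < n \<Longrightarrow> t \<in> {u..v} \<Longrightarrow>
      (g j has_vector_derivative g (Suc j) t) (at t within {u..v})"
    and "\<And>t. t \<in> {u..v} \<Longrightarrow> norm (g n t - g n u) \<le> B"
    and "t \<in> {u..v}"
  shows "norm (g 0 t - (\<Sum>k\<le>n. ((t - u) ^ k / fact k) *\<^sub>R g k u)) \<le> B * (v - u) ^ n"
  using assms
proof (induction n arbitrary: g t)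
  case 0
  then show ?case by simp
next
  case (Suc n)
  let ?P = "\<lambda>t. \<Sum>k\<le>n. ((t - u) ^ k / fact k) *\<^sub>R g (Suc k) u"
  let ?Q = "\<lambda>t. \<Sum>k\<le>Suc n. ((t - u) ^ k / fact k) *\<^sub>R g k u"
  let ?D = "\<lambda>t. g 0 t - ?Q t"
  have B: "0 \<le> B" using Suc.prems(2)[OF Suc.prems(3)] norm_ge_zero order_trans by blast
  have Q: "?Q t = g 0 u + (\<Sum>k\<le>n. ((t - u) ^ Suc k / fact (Suc k)) *\<^sub>R g (Suc k) u)" for t
    by (subst sum.atMost_Suc_shift) simp
  have pow: "((\<lambda>t. (t - u) ^ Suc k / fact (Suc k)) has_real_derivative (x - u) ^ k / fact k)
      (at x within {u..v})" for k x
  proof -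
    have "((\<lambda>t. (t - u) ^ Suc k / fact (Suc k)) has_real_derivative
        real (Suc k) * (x - u) ^ k / fact (Suc k)) (at x within {u..v})"
      by (rule DERIV_cdivide derivative_eq_intros refl)+ auto
    then show ?thesis by (rule DERIV_cong) (simp only: fact_Suc of_nat_mult, simp del: of_nat_Suc)
  qed
  have "norm (?D t - ?D u) \<le> B * (v - u) ^ n * \<bar>t - u\<bar>"
  proof (rule vector_differentiable_bound)
    fix x assume x: "x \<in> {u..v}"
    have "(?Q has_vector_derivative 0 + ?P x) (at x within {u..v})"
      unfolding Q
      by (intro has_vector_derivative_add has_vector_derivative_const has_vector_derivative_sum)
         (use pow in \<open>auto simp: has_vector_derivative_def has_field_derivative_def mult.commute
             simp del: power_Suc fact_Suc intro!: has_derivative_eq_rhs[OF has_derivative_scaleR_left]\<close>)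
    then show "(?D has_vector_derivative g (Suc 0) x - ?P x) (at x within {u..v})"
      using Suc.prems(1)[of 0 x] x by (intro has_vector_derivative_diff) auto
    show "norm (g (Suc 0) x - ?P x) \<le> B * (v - u) ^ n"
      using Suc.IH[of "\<lambda>j. g (Suc j)", OF _ _ x] Suc.prems by simp
  qed (use Suc.prems in auto)
  also have "\<dots> \<le> B * (v - u) ^ n * (v - u)"
    using Suc.prems B by (intro mult_left_mono) auto
  finally have "norm (?D t - ?D u) \<le> B * (v - u) ^ Suc n" by (simp add: mult_ac)
  moreover have "?D u = 0" by (subst Q) simp
  ultimately show ?case by simp
qed

lemma lagrange_diff:
  "lagrange r t (\<lambda>x. g x - h x) s = lagrange r t g s - lagrange r t h s"
  by (simp add: lagrange_def scaleR_diff_right sum_subtractf)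

lemma continuous_lagrange:
  fixes g :: "real \<Rightarrow> 'a::real_normed_vector"
  shows "continuous_on A (lagrange r t g)"
  unfolding lagrange_def divide_inverse by (intro continuous_intros)

text \<open>Both sides are polynomials in \<open>s\<close> of degree less than \<open>r\<close> that agree at the \<open>r\<close> nodes.\<close>

lemma lagrange_poly:
  fixes q :: "real poly"
  assumes "inj_on t {..<r}" and "degree q < r"
  shows "lagrange r t (poly q) s = poly q s"
proof -
  define ell where "ell = (\<lambda>k. \<Prod>j\<in>{..<r} - {k}. [:- t j / (t k - t j), 1 / (t k - t j):])"
  define p where "p = (\<Sum>k<r. smult (poly q (t k)) (ell k))"
  have ell: "poly (ell k) s = (\<Prod>j\<in>{..<r} - {k}. (s - t j) / (t k - t j))" for k s
    by (simp add: ell_def poly_prod diff_divide_distrib)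
  have p: "poly p s = lagrange r t (poly q) s" for s
    by (simp add: p_def lagrange_def poly_sum ell mult.commute)
  have "degree (ell k) \<le> r - 1" if "k < r" for k
  proof -
    have "degree (ell k) \<le> (\<Sum>j\<in>{..<r} - {k}. degree [:- t j / (t k - t j), 1 / (t k - t j):])"
      unfolding ell_def by (rule degree_prod_sum_le[unfolded o_def]) simp
    also have "\<dots> \<le> (\<Sum>j\<in>{..<r} - {k}. 1)" by (intro sum_mono) simp
    finally show ?thesis using that by simp
  qed
  then have "degree p \<le> r - 1"
    unfolding p_def by (intro degree_sum_le) (auto intro: order_trans[OF degree_smult_le])
  then have deg: "degree p < r" using assms(2) by simp
  have "poly p (t i) = poly q (t i)" if i: "i < r" for i
  proof -
    have "poly (ell k) (t i) = (if k = i then 1 else 0)" if "k < r" for k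
    proof (cases "k = i")
      case True
      have "t i \<noteq> t j" if "j \<in> {..<r} - {i}" for j
        using inj_onD[OF assms(1), of i j] that i by auto
      then show ?thesis using True by (simp add: ell)
    next
      case False
      then show ?thesis using i by (auto simp: ell intro!: prod_zero bexI[of _ i])
    qed
    then show ?thesis
      using i by (simp add: p_def poly_sum if_distrib[of "(*) _"] cong: if_cong)
  qed
  then have "p = q"
    using deg assms by (intro poly_eqI_degree[of "t ` {..<r}"]) (auto simp: card_image)
  then show ?thesis using p by simp
qed

lemma lagrange_reproduces_polynomial:
  assumes "inj_on t {..<r}"
  shows "lagrange r t (\<lambda>x. \<Sum>k<r. (x - u) ^ k *\<^sub>R c k) s = (\<Sum>k<r. (s - u) ^ k *\<^sub>R c k)"
proof -
  have *: "lagrange r t (\<lambda>x. (x - u) ^ m) s = (s - u) ^ m" if "m < r" for m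
    using lagrange_poly[OF assms, of "[:- u, 1:] ^ m" s] that
    by (simp add: degree_linear_power poly_power[abs_def])
  have "lagrange r t (\<lambda>x. \<Sum>k<r. (x - u) ^ k *\<^sub>R c k) s
      = (\<Sum>m<r. lagrange r t (\<lambda>x. (x - u) ^ m) s *\<^sub>R c m)"
    unfolding lagrange_def scaleR_sum_right
    by (subst sum.swap) (simp add: scaleR_sum_left[symmetric] sum_distrib_left sum_distrib_right mult_ac)
  then show ?thesis using * by simp
qed

text \<open>Captures what the two families of equidistant nodes, those of \<open>\<phi>\<^sup>*\<close> and the first \<open>r\<close> nodes of
the step selection, have in common and what bounds the Lebesgue constant independently of the interval.\<close>

definition separated_nodes :: "nat \<Rightarrow> real \<Rightarrow> real \<Rightarrow> (nat \<Rightarrow> real) \<Rightarrow> bool" where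
  "separated_nodes r u v t \<longleftrightarrow>
     (\<forall>k<r. t k \<in> {u..v}) \<and> (\<forall>j<r. \<forall>k<r. j \<noteq> k \<longrightarrow> (v - u) / real r \<le> \<bar>t j - t k\<bar>)"

lemma lagrange_bound:
  assumes "u < v" "separated_nodes r u v t" "s \<in> {u..v}"
    and B: "\<And>k. k < r \<Longrightarrow> norm (g (t k)) \<le> B" and "1 \<le> r"
  shows "norm (lagrange r t g s) \<le> real r ^ (r + 1) * B"
proof -
  have "0 \<le> B" using B[of 0] \<open>1 \<le> r\<close> norm_ge_zero order_trans by (metis less_le_trans zero_less_one)
  have "norm (lagrange r t g s) \<le> (\<Sum>k<r. real r ^ r * B)"
    unfolding lagrange_def
  proof (rule sum_norm_le)
    fix k assume "k \<in> {..<r}"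
    then have k: "k < r" by simp
    have "\<bar>\<Prod>j\<in>{..<r} - {k}. (s - t j) / (t k - t j)\<bar> \<le> (\<Prod>j\<in>{..<r} - {k}. real r)"
      unfolding abs_prod
    proof (rule prod_mono)
      fix j assume j: "j \<in> {..<r} - {k}"
      have 1: "\<bar>s - t j\<bar> \<le> v - u" and 2: "(v - u) / real r \<le> \<bar>t k - t j\<bar>"
        using assms(2,3) k j by (auto simp: separated_nodes_def abs_le_iff)
      have 3: "0 < (v - u) / real r" using \<open>u < v\<close> \<open>1 \<le> r\<close> by simp
      have "\<bar>(s - t j) / (t k - t j)\<bar> = \<bar>s - t j\<bar> / \<bar>t k - t j\<bar>" by (rule abs_divide)
      also have "\<dots> \<le> (v - u) / ((v - u) / real r)"
        using 1 2 3 \<open>u < v\<close> by (intro frac_le) auto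
      also have "\<dots> = real r" using \<open>u < v\<close> by simp
      finally show "0 \<le> \<bar>(s - t j) / (t k - t j)\<bar> \<and> \<bar>(s - t j) / (t k - t j)\<bar> \<le> real r" by simp
    qed
    also have "\<dots> = real r ^ (r - 1)" using k by simp
    also have "\<dots> \<le> real r ^ r" using \<open>1 \<le> r\<close> by (intro power_increasing) auto
    finally show "norm ((\<Prod>j\<in>{..<r} - {k}. (s - t j) / (t k - t j)) *\<^sub>R g (t k)) \<le> real r ^ r * B"
      using B[OF k] \<open>0 \<le> B\<close> by (auto intro!: mult_mono)
  qed
  then show ?thesis by (simp add: mult_ac)
qed

lemma separated_nodes_inj:
  assumes "separated_nodes r u v t" "u < v"
  shows "inj_on t {..<r}"
proof (rule inj_onI, rule ccontr)
  fix j k assume *: "j \<in> {..<r}" "k \<in> {..<r}" "t j = t k" "j \<noteq> k"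
  then have "(v - u) / real r \<le> 0" using assms(1) unfolding separated_nodes_def by force
  then show False using * assms(2) by (simp add: divide_le_0_iff)
qed

text \<open>Interpolation reproduces the Taylor polynomial of degree less than \<open>r\<close>, so the error is the
distance to that polynomial, magnified at most by 1 plus the Lebesgue constant.\<close>

lemma interpolation_error:
  fixes g :: "nat \<Rightarrow> real \<Rightarrow> 'a::real_normed_vector"
  assumes der: "\<And>j t. j < r \<Longrightarrow> t \<in> {u..v} \<Longrightarrow>
      (g j has_vector_derivative g (Suc j) t) (at t within {u..v})"
    and M: "\<And>t. t \<in> {u..v} \<Longrightarrow> norm (g r t) \<le> M"
    and "u < v" and nodes: "separated_nodes r u v t" and "s \<in> {u..v}" and "1 \<le> r"
  shows "norm (lagrange r t (g 0) s - g 0 s) \<le> (real r ^ (r + 1) + 1) * (3 * M * (v - u) ^ r)"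
proof -
  define P where "P = (\<lambda>x. \<Sum>k<r. (x - u) ^ k *\<^sub>R ((1 / fact k) *\<^sub>R g k u))"
  have M0: "0 \<le> M" using M[OF \<open>s \<in> {u..v}\<close>] norm_ge_zero order_trans by blast
  have near: "norm (g 0 x - P x) \<le> 3 * M * (v - u) ^ r" if x: "x \<in> {u..v}" for x
  proof -
    have "norm (g r y - g r u) \<le> 2 * M" if "y \<in> {u..v}" for y
      using norm_triangle_ineq4[of "g r y" "g r u"] M[OF that] M[of u] \<open>u < v\<close> by simp
    then have 1: "norm (g 0 x - (\<Sum>k\<le>r. ((x - u) ^ k / fact k) *\<^sub>R g k u)) \<le> 2 * M * (v - u) ^ r"
      using der x by (intro taylor_remainder_bound)
    have "(x - u) ^ r / fact r \<le> (v - u) ^ r / 1"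
      using x by (intro frac_le power_mono) auto
    then have "norm (((x - u) ^ r / fact r) *\<^sub>R g r u) \<le> (v - u) ^ r * M"
      unfolding norm_scaleR using x M[of u] by (intro mult_mono) auto
    moreover have eq: "(\<Sum>k\<le>r. ((x - u) ^ k / fact k) *\<^sub>R g k u) = P x + ((x - u) ^ r / fact r) *\<^sub>R g r u"
      by (simp add: P_def lessThan_Suc_atMost[symmetric])
    moreover have "norm (A - Q) \<le> norm (A - (Q + w)) + norm w" for A Q w :: 'a
      using norm_triangle_ineq[of "A - (Q + w)" w] by simp
    ultimately have "norm (g 0 x - P x) \<le> 2 * M * (v - u) ^ r + (v - u) ^ r * M"
      using 1 unfolding eq by (meson add_mono order_trans)
    then show ?thesis by (simp add: algebra_simps)
  qed
  have "lagrange r t P s = P s"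
    unfolding P_def by (rule lagrange_reproduces_polynomial[OF separated_nodes_inj[OF nodes \<open>u < v\<close>]])
  then have "lagrange r t (g 0) s - g 0 s = lagrange r t (\<lambda>x. g 0 x - P x) s - (g 0 s - P s)"
    by (simp add: lagrange_diff)
  also have "norm \<dots> \<le> norm (lagrange r t (\<lambda>x. g 0 x - P x) s) + norm (g 0 s - P s)"
    by (rule norm_triangle_ineq4)
  also have "\<dots> \<le> real r ^ (r + 1) * (3 * M * (v - u) ^ r) + 3 * M * (v - u) ^ r"
  proof (rule add_mono)
    show "norm (lagrange r t (\<lambda>x. g 0 x - P x) s) \<le> real r ^ (r + 1) * (3 * M * (v - u) ^ r)"
      using assms(3-6) near by (intro lagrange_bound[of u v]) (auto simp: separated_nodes_def)
    show "norm (g 0 s - P s) \<le> 3 * M * (v - u) ^ r" using near \<open>s \<in> {u..v}\<close> .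
  qed
  finally show ?thesis by (simp add: algebra_simps)
qed

lemma divided_difference_diff:
  "divided_difference n t (\<lambda>x. g x - h x) i = divided_difference n t g i - divided_difference n t h i"
proof (induction n arbitrary: i)
  case (Suc n)
  show ?case by (simp only: divided_difference.simps Suc) (simp add: algebra_simps)
qed simp

lemma divided_difference_sum:
  "divided_difference n t (\<lambda>x. \<Sum>k\<in>I. g k x) i = (\<Sum>k\<in>I. divided_difference n t (g k) i)"
  by (induction n arbitrary: i) (simp_all add: scaleR_sum_right sum_subtractf scaleR_diff_right)

lemma divided_difference_bound:
  assumes c: "0 < c" "\<And>j k. j \<noteq> k \<Longrightarrow> c \<le> \<bar>t j - t k\<bar>"
    and "\<And>j. i \<le> j \<Longrightarrow> j \<le> i + n \<Longrightarrow> norm (g (t j)) \<le> B"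
  shows "norm (divided_difference n t g i) \<le> (2 / c) ^ n * B"
  using assms(3)
proof (induction n arbitrary: i)
  case (Suc n)
  let ?d = "divided_difference n t g"
  have "norm (?d i) \<le> (2 / c) ^ n * B" "norm (?d (Suc i)) \<le> (2 / c) ^ n * B"
    using Suc.prems by (auto intro!: Suc.IH)
  then have "norm (?d (Suc i) - ?d i) \<le> 2 * ((2 / c) ^ n * B)"
    using norm_triangle_ineq4[of "?d (Suc i)" "?d i"] by linarith
  moreover have "\<bar>1 / (t (i + Suc n) - t i)\<bar> \<le> 1 / c"
    using c(1) c(2)[of "i + Suc n" i] by (simp add: abs_divide frac_le)
  ultimately have "norm (divided_difference (Suc n) t g i) \<le> (1 / c) * (2 * ((2 / c) ^ n * B))"
    unfolding divided_difference.simps norm_scaleR using c(1) by (intro mult_mono) auto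
  then show ?case by (simp add: field_simps)
qed simp

text \<open>The Leibniz rule for a linear factor. It reduces the divided differences of powers to an induction on
the exponent.\<close>

lemma divided_difference_times_linear:
  assumes "inj t"
  shows "divided_difference (Suc n) t (\<lambda>x. (x - u) *\<^sub>R g x) i =
    (t i - u) *\<^sub>R divided_difference (Suc n) t g i + divided_difference n t g (Suc i)"
proof (induction n arbitrary: i)
  case 0
  define T where "T = t (Suc i) - t i"
  have T: "T \<noteq> 0" using injD[OF assms, of "Suc i" i] by (auto simp: T_def)
  have "(t (Suc i) - u) *\<^sub>R g (t (Suc i)) - (t i - u) *\<^sub>R g (t i)
     = (t i - u) *\<^sub>R (g (t (Suc i)) - g (t i)) + T *\<^sub>R g (t (Suc i))"
    by (simp add: T_def algebra_simps)
  then show ?case using T by (simp add: T_def[symmetric] scaleR_right_distrib mult.commute)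
next
  case (Suc n)
  define T where "T = t (i + Suc (Suc n)) - t i"
  define U where "U = t (Suc i + Suc n) - t (Suc i)"
  have T: "T \<noteq> 0" using injD[OF assms, of "i + Suc (Suc n)" i] by (auto simp: T_def)
  have U: "U \<noteq> 0" using injD[OF assms, of "Suc i + Suc n" "Suc i"] by (auto simp: U_def)
  define d D0 D1 where "d = divided_difference n t g"
    and "D0 = divided_difference (Suc n) t g i" and "D1 = divided_difference (Suc n) t g (Suc i)"
  have "D1 = (1 / U) *\<^sub>R (d (Suc (Suc i)) - d (Suc i))" by (simp add: D1_def U_def d_def)
  then have d: "d (Suc (Suc i)) - d (Suc i) = U *\<^sub>R D1" using U by simp
  have "divided_difference (Suc (Suc n)) t (\<lambda>x. (x - u) *\<^sub>R g x) i
      = (1 / T) *\<^sub>R (((t (Suc i) - u) *\<^sub>R D1 + d (Suc (Suc i))) - ((t i - u) *\<^sub>R D0 + d (Suc i)))"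
    by (subst divided_difference.simps(2), unfold Suc.IH) (simp only: T_def D0_def D1_def d_def)
  also have "((t (Suc i) - u) *\<^sub>R D1 + d (Suc (Suc i))) - ((t i - u) *\<^sub>R D0 + d (Suc i))
      = (t (Suc i) - u) *\<^sub>R D1 - (t i - u) *\<^sub>R D0 + U *\<^sub>R D1"
    using d by (simp add: algebra_simps)
  also have "\<dots> = (t i - u) *\<^sub>R (D1 - D0) + T *\<^sub>R D1"
    by (simp add: T_def U_def algebra_simps)
  also have "(1 / T) *\<^sub>R \<dots> = (t i - u) *\<^sub>R ((1 / T) *\<^sub>R (D1 - D0)) + D1"
    using T by (simp add: scaleR_right_distrib)
  also have "(1 / T) *\<^sub>R (D1 - D0) = divided_difference (Suc (Suc n)) t g i"
    by (simp only: divided_difference.simps(2)[of "Suc n"] T_def D0_def D1_def)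
  finally show ?case unfolding D1_def .
qed

lemma divided_difference_const: "divided_difference (Suc n) t (\<lambda>x. c) i = 0"
proof (induction n arbitrary: i)
  case (Suc n)
  show ?case by (subst divided_difference.simps(2)) (simp only: Suc diff_self scaleR_zero_right)
qed simp

lemma divided_difference_power:
  assumes "inj t"
  shows "k \<le> n \<Longrightarrow> divided_difference n t (\<lambda>x. (x - u) ^ k *\<^sub>R c) i = (if k = n then c else 0)"
proof (induction k arbitrary: n i)
  case 0
  then show ?case by (cases n) (simp_all add: divided_difference_const del: divided_difference.simps(2))
next
  case (Suc k)
  then obtain m where m: "n = Suc m" by (cases n) auto
  have "(\<lambda>x. (x - u) ^ Suc k *\<^sub>R c) = (\<lambda>x. (x - u) *\<^sub>R ((x - u) ^ k *\<^sub>R c))" by simp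
  then show ?case
    using Suc.IH[of "Suc m"] Suc.IH[of m] Suc.prems unfolding m
    by (simp only: divided_difference_times_linear[OF assms]) simp
qed

text \<open>The divided difference of the Taylor polynomial is exactly its leading coefficient. The Taylor
remainder and the perturbation of the data are both of size \<open>(v - u)\<^sup>r\<close>, and the \<open>r\<close> divisions
by node distances cancel this power.\<close>

lemma divided_difference_near_derivative:
  fixes g :: "nat \<Rightarrow> real \<Rightarrow> 'a::real_normed_vector"
  assumes der: "\<And>j t. j < r \<Longrightarrow> t \<in> {u..v} \<Longrightarrow>
      (g j has_vector_derivative g (Suc j) t) (at t within {u..v})"
    and B: "\<And>t. t \<in> {u..v} \<Longrightarrow> norm (g r t - g r u) \<le> B"
    and "u < v" and "1 \<le> r"
    and t: "\<And>j. j \<le> r \<Longrightarrow> t j \<in> {u..v}" "\<And>j k. j \<noteq> k \<Longrightarrow> (v - u) / real r \<le> \<bar>t j - t k\<bar>"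
    and E: "\<And>j. j \<le> r \<Longrightarrow> norm (H (t j) - g 0 (t j)) \<le> E * (v - u) ^ r"
  shows "norm (divided_difference r t H 0 - (1 / fact r) *\<^sub>R g r u) \<le> (2 * real r) ^ r * (B + E)"
proof -
  define c where "c = (v - u) / real r"
  have c: "0 < c" using assms by (simp add: c_def)
  have sep: "c \<le> \<bar>t j - t k\<bar>" if "j \<noteq> k" for j k using t(2)[OF that] by (simp add: c_def)
  have "inj t" using sep c by (metis abs_zero diff_self injI not_le)
  define P where "P = (\<lambda>x. \<Sum>k\<le>r. ((x - u) ^ k / fact k) *\<^sub>R g k u)"
  have "divided_difference r t P 0 = (\<Sum>k\<le>r. divided_difference r t (\<lambda>x. (x - u) ^ k *\<^sub>R ((1 / fact k) *\<^sub>R g k u)) 0)"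
    unfolding P_def divided_difference_sum by simp
  also have "\<dots> = (\<Sum>k\<le>r. if k = r then (1 / fact k) *\<^sub>R g k u else 0)"
    by (intro sum.cong refl divided_difference_power[OF \<open>inj t\<close>]) auto
  also have "\<dots> = (1 / fact r) *\<^sub>R g r u" by simp
  finally have P: "divided_difference r t P 0 = (1 / fact r) *\<^sub>R g r u" .
  have "norm (H (t j) - P (t j)) \<le> (B + E) * (v - u) ^ r" if "j \<le> r" for j
  proof -
    have "norm (g 0 (t j) - P (t j)) \<le> B * (v - u) ^ r"
      unfolding P_def using der B t(1)[OF that] by (intro taylor_remainder_bound)
    then show ?thesis
      using norm_triangle_ineq[of "H (t j) - g 0 (t j)" "g 0 (t j) - P (t j)"] E[OF that]
      by (simp add: algebra_simps)
  qed
  then have "norm (divided_difference r t (\<lambda>x. H x - P x) 0) \<le> (2 / c) ^ r * ((B + E) * (v - u) ^ r)"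
    using c sep by (intro divided_difference_bound) auto
  also have "\<dots> = ((2 / c) * (v - u)) ^ r * (B + E)"
    by (simp only: power_mult_distrib mult_ac)
  also have "(2 / c) * (v - u) = 2 * real r" using assms by (simp add: c_def)
  finally show ?thesis by (simp add: divided_difference_diff P)
qed

section \<open>Local solutions near a smooth solution\<close>

lemma (in lipschitz_rhs) solves_ivp_integral:
  assumes "solves_ivp f u v y z" "s \<in> {u..v}"
  shows "((\<lambda>\<xi>. f \<xi> (z \<xi>)) has_integral z s - y) {u..s}"
proof -
  have "((\<lambda>\<xi>. f \<xi> (z \<xi>)) has_integral z s - z u) {u..s}"
    using solves_ivp_subinterval[OF assms(1), of u s] assms(2) unfolding solves_ivp_def
    by (intro fundamental_theorem_of_calculus) auto
  then show ?thesis using assms(1) by (simp add: solves_ivp_def)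
qed

text \<open>\<open>G j\<close> is the \<open>j\<close>-th total derivative of \<open>f\<close> along the flow, so that the derivative of order
\<open>j + 1\<close> of any solution \<open>w\<close> running in \<open>S\<close> is \<open>G j (t, w t)\<close>. The set \<open>S\<close> is a
compact neighbourhood of the graph of \<open>z\<close>. The radius 1 of the tube matches the domain on which
functions in the class \<open>F_class\<close> are smooth.\<close>

locale smooth_ivp = lipschitz_rhs f a b L
  for f :: "('d::finite) rhs" and a b L :: real +
  fixes r :: nat and z :: "real \<Rightarrow> real ^ 'd" and S :: "(real \<times> (real ^ 'd)) set"
    and G :: "nat \<Rightarrow> real \<times> (real ^ 'd) \<Rightarrow> real ^ 'd"
  assumes ab: "a < b" and r_pos: "1 \<le> r"
    and z: "solves_ivp f a b (z a) z"
    and S_compact: "compact S"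
    and tube: "\<And>t y. t \<in> {a..b} \<Longrightarrow> norm (y - z t) \<le> 1 \<Longrightarrow> (t, y) \<in> S"
    and G_0: "G 0 = (\<lambda>(t, y). f t y)"
    and G_cont: "\<And>j. j \<le> r \<Longrightarrow> continuous_on S (G j)"
    and G_deriv: "\<And>j u v y z t. j < r \<Longrightarrow> solves_ivp f u v y z \<Longrightarrow> \<forall>t\<in>{u..v}. (t, z t) \<in> S \<Longrightarrow>
      t \<in> {u..v} \<Longrightarrow>
      ((\<lambda>t. G j (t, z t)) has_vector_derivative G (Suc j) (t, z t)) (at t within {u..v})"
begin

lemma G_bounded: obtains M where "0 \<le> M" "\<And>j x. j \<le> r \<Longrightarrow> x \<in> S \<Longrightarrow> norm (G j x) \<le> M"
proof -
  have "bounded (G j ` S)" if "j \<le> r" for j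
    using G_cont[OF that] S_compact by (intro compact_imp_bounded compact_continuous_image)
  then have "bounded (\<Union>j\<in>{..r}. G j ` S)" by (simp add: bounded_UN)
  then obtain M where M: "\<And>x. x \<in> (\<Union>j\<in>{..r}. G j ` S) \<Longrightarrow> norm x \<le> M"
    unfolding bounded_iff by auto
  have "norm (G j x) \<le> max M 0" if "j \<le> r" "x \<in> S" for j x
    using M[of "G j x"] that by force
  with max.cobounded2[of 0 M] show thesis by (rule that)
qed

lemma z_in_S: "t \<in> {a..b} \<Longrightarrow> (t, z t) \<in> S"
  by (rule tube) auto

lemma z_solves_subinterval: "a \<le> u \<Longrightarrow> u \<le> v \<Longrightarrow> v \<le> b \<Longrightarrow> solves_ivp f u v (z u) z"
  using solves_ivp_subinterval[OF z] by simp

lemma local_solution_in_tube: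
  assumes "a \<le> u" "v \<le> b" "L * (v - u) \<le> 1 / 2" "norm (y - z u) \<le> 1 / 2"
    and "solves_ivp f u v y w" "t \<in> {u..v}"
  shows "norm (w t - z t) \<le> 2 * norm (y - z u)" and "(t, w t) \<in> S"
proof -
  have "norm (w t - z t) \<le> (1 + 2 * L * (v - u)) * norm (y - z u)"
    using assms by (intro solutions_stay_close[OF assms(5) z_solves_subinterval]) auto
  also have "\<dots> \<le> 2 * norm (y - z u)" using assms(3) by (intro mult_right_mono) auto
  finally show *: "norm (w t - z t) \<le> 2 * norm (y - z u)" .
  show "(t, w t) \<in> S" using * assms by (intro tube) auto
qed

text \<open>Each iteration integrates the error of the previous one and thereby gains a factor \<open>v - u\<close>, until the
interpolation error, of size \<open>(v - u)\<^bsup>r + 1\<^esup>\<close> after integration, dominates. Starting from a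
constant, which is wrong by \<open>O(v - u)\<close>, the order \<open>r + 1\<close> is reached after \<open>r\<close> iterations and
then persists.\<close>

lemma iterate_error_exists:
  obtains C where "0 \<le> C"
    and "\<And>u v y w t s. a \<le> u \<Longrightarrow> u < v \<Longrightarrow> v \<le> b \<Longrightarrow> v - u \<le> 1 \<Longrightarrow> solves_ivp f u v y w \<Longrightarrow>
      \<forall>t\<in>{u..v}. (t, w t) \<in> S \<Longrightarrow> separated_nodes r u v t \<Longrightarrow> s \<in> {u..v} \<Longrightarrow>
      norm (iterate f r t u y (r + 1) s - w s) \<le> C * (v - u) ^ (r + 1)"
proof -
  obtain M where M0: "0 \<le> M" and M: "\<And>j x. j \<le> r \<Longrightarrow> x \<in> S \<Longrightarrow> norm (G j x) \<le> M"
    by (rule G_bounded) blast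
  define \<Lambda> where "\<Lambda> = real r ^ (r + 1)"
  \<comment> \<open>\<open>\<Lambda>\<close> bounds the Lebesgue constant, \<open>E\<close> the interpolation error, and \<open>A j\<close>
    solves the recursion for the constants in the successive error estimates.\<close>
  define E where "E = (\<Lambda> + 1) * (3 * M)"
  define A where "A = (\<lambda>j. ((\<lambda>A. \<Lambda> * L * A + E) ^^ j) M)"
  have pos: "0 \<le> \<Lambda>" "0 \<le> E" using M0 by (auto simp: \<Lambda>_def E_def)
  have A0: "0 \<le> A j" for j by (induction j) (auto simp: A_def M0 pos L_nonneg)
  have main: "norm (iterate f r t u y j s - w s) \<le> A j * (v - u) ^ (min j r + 1)"
    if uv: "a \<le> u" "u < v" "v \<le> b" "v - u \<le> 1" and w: "solves_ivp f u v y w"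
      and S: "\<forall>t\<in>{u..v}. (t, w t) \<in> S" and t: "separated_nodes r u v t" and s: "s \<in> {u..v}"
    for u v y w t s j
    using s
  proof (induction j arbitrary: s)
    case 0
    have "norm (w s - w u) \<le> M * \<bar>s - u\<bar>"
    proof (rule vector_differentiable_bound[of "{u..v}" w "\<lambda>t. f t (w t)"])
      fix x assume x: "x \<in> {u..v}"
      then show "norm (f x (w x)) \<le> M" using M[of 0 "(x, w x)"] S by (simp add: G_0)
    qed (use w 0 uv in \<open>auto simp: solves_ivp_def\<close>)
    also have "\<dots> \<le> M * (v - u)" using 0 M0 by (intro mult_left_mono) auto
    finally show ?case using w by (simp add: solves_ivp_def A_def norm_minus_commute)
  next
    case (Suc j)
    let ?h = "v - u"
    let ?l = "lagrange r t (\<lambda>\<xi>. f \<xi> (iterate f r t u y j \<xi>))"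
    let ?B = "A (Suc j) * ?h ^ min (Suc j) r"
    have nodes: "t k \<in> {u..v}" if "k < r" for k using t that by (auto simp: separated_nodes_def)
    have bound: "norm (?l \<xi> - f \<xi> (w \<xi>)) \<le> ?B" if \<xi>: "\<xi> \<in> {u..v}" for \<xi>
    proof -
      let ?q = "lagrange r t (\<lambda>\<xi>. f \<xi> (w \<xi>))"
      have "norm (?l \<xi> - ?q \<xi>) = norm (lagrange r t (\<lambda>\<xi>. f \<xi> (iterate f r t u y j \<xi>) - f \<xi> (w \<xi>)) \<xi>)"
        by (simp add: lagrange_diff)
      also have "\<dots> \<le> \<Lambda> * (L * (A j * ?h ^ (min j r + 1)))"
        unfolding \<Lambda>_def
      proof (rule lagrange_bound[OF \<open>u < v\<close> t \<xi> _ r_pos])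
        fix k assume k: "k < r"
        have "norm (f (t k) (iterate f r t u y j (t k)) - f (t k) (w (t k)))
            \<le> L * norm (iterate f r t u y j (t k) - w (t k))"
          using nodes[OF k] uv by (intro lip) auto
        also have "\<dots> \<le> L * (A j * ?h ^ (min j r + 1))"
          using Suc.IH[OF nodes[OF k]] L_nonneg by (rule mult_left_mono)
        finally show "norm (f (t k) (iterate f r t u y j (t k)) - f (t k) (w (t k)))
            \<le> L * (A j * ?h ^ (min j r + 1))" .
      qed
      also have "\<dots> \<le> \<Lambda> * (L * (A j * ?h ^ min (Suc j) r))"
        using pos L_nonneg A0 uv by (intro mult_left_mono power_decreasing) auto
      finally have 1: "norm (?l \<xi> - ?q \<xi>) \<le> \<Lambda> * (L * (A j * ?h ^ min (Suc j) r))" .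
      have "norm (?q \<xi> - f \<xi> (w \<xi>)) \<le> (\<Lambda> + 1) * (3 * M * ?h ^ r)"
        using interpolation_error[of r u v "\<lambda>j t. G j (t, w t)" M t \<xi>] G_deriv[OF _ w S] M S t \<xi> uv r_pos
        by (simp add: \<Lambda>_def G_0)
      also have "\<dots> = E * ?h ^ r" by (simp add: E_def)
      also have "\<dots> \<le> E * ?h ^ min (Suc j) r"
        using pos uv by (intro mult_left_mono power_decreasing) auto
      finally have 2: "norm (?q \<xi> - f \<xi> (w \<xi>)) \<le> E * ?h ^ min (Suc j) r" .
      have "norm (?l \<xi> - f \<xi> (w \<xi>)) \<le> norm (?l \<xi> - ?q \<xi>) + norm (?q \<xi> - f \<xi> (w \<xi>))"
        using norm_triangle_ineq[of "?l \<xi> - ?q \<xi>" "?q \<xi> - f \<xi> (w \<xi>)"] by simp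
      also have "\<dots> \<le> \<Lambda> * (L * (A j * ?h ^ min (Suc j) r)) + E * ?h ^ min (Suc j) r"
        using 1 2 by (rule add_mono)
      also have "\<dots> = ?B" by (simp add: A_def algebra_simps)
      finally show ?thesis .
    qed
    have l: "(?l has_integral integral {u..s} ?l) {u..s}"
      by (intro integrable_integral integrable_continuous_real continuous_lagrange)
    have "((\<lambda>\<xi>. ?l \<xi> - f \<xi> (w \<xi>)) has_integral integral {u..s} ?l - (w s - y)) {u..s}"
      using solves_ivp_integral[OF w Suc.prems] by (intro has_integral_diff l)
    then have "norm (integral {u..s} ?l - (w s - y)) \<le> ?B * (s - u)"
      using has_integral_bound_real[of ?B "{}" "\<lambda>\<xi>. ?l \<xi> - f \<xi> (w \<xi>)" _ u s] bound Suc.prems A0 uv by auto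
    also have "\<dots> \<le> ?B * ?h" using Suc.prems A0 uv by (intro mult_left_mono) auto
    also have "\<dots> = A (Suc j) * ?h ^ (min (Suc j) r + 1)" by simp
    finally show ?case by (simp add: algebra_simps)
  qed
  have "min (r + 1) r = r" by simp
  from main[where j = "r + 1", unfolded this] show thesis by (rule that[OF A0])
qed

text \<open>Uniform continuity of \<open>G r\<close> on the compact set \<open>S\<close>. The points \<open>s\<close> and \<open>t\<close> are independent: over a
short interval both the choice of the solution and the choice of the evaluation point are negligible.\<close>

lemma highest_derivative_close:
  assumes "0 < e"
  obtains d where "0 < d" "d \<le> 1 / 2" "L * d \<le> 1 / 2"
    and "\<And>u v y w s t. a \<le> u \<Longrightarrow> v \<le> b \<Longrightarrow> v - u \<le> d \<Longrightarrow> norm (y - z u) \<le> d \<Longrightarrow>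
      solves_ivp f u v y w \<Longrightarrow> s \<in> {u..v} \<Longrightarrow> t \<in> {u..v} \<Longrightarrow>
      norm (G r (t, w t) - G r (s, z s)) \<le> e"
proof -
  have "uniformly_continuous_on S (G r)"
    using G_cont S_compact by (intro compact_uniformly_continuous) auto
  with \<open>0 < e\<close> obtain d0 where d0: "0 < d0"
    "\<forall>x\<in>S. \<forall>x'\<in>S. dist x' x < d0 \<longrightarrow> dist (G r x') (G r x) < e"
    unfolding uniformly_continuous_on_def by blast
  obtain M where M0: "0 \<le> M" and M: "\<And>j x. j \<le> r \<Longrightarrow> x \<in> S \<Longrightarrow> norm (G j x) \<le> M"
    by (rule G_bounded) blast
  define d where "d = min (1 / 2) (min (1 / (2 * (L + 1))) (d0 / (2 * (M + 3))))"
  have "0 < d" using d0 M0 L_nonneg by (simp add: d_def)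
  have "L * d \<le> L * (1 / (2 * (L + 1)))" using L_nonneg by (intro mult_left_mono) (auto simp: d_def)
  also have "\<dots> \<le> 1 / 2" using L_nonneg by (simp add: field_simps)
  finally have Ld: "L * d \<le> 1 / 2" .
  have "(M + 3) * d \<le> (M + 3) * (d0 / (2 * (M + 3)))"
    using M0 by (intro mult_left_mono) (auto simp: d_def)
  also have "\<dots> = d0 / 2" using M0 by (simp add: field_simps)
  also have "\<dots> < d0" using d0 by simp
  finally have Md: "(M + 3) * d < d0" .
  show thesis
  proof (rule that[OF \<open>0 < d\<close> _ Ld])
    show "d \<le> 1 / 2" unfolding d_def by (rule min.cobounded1)
    fix u v y w s t
    assume *: "a \<le> u" "v \<le> b" "v - u \<le> d" "norm (y - z u) \<le> d" "solves_ivp f u v y w"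
      "s \<in> {u..v}" "t \<in> {u..v}"
    have "L * (v - u) \<le> L * d" using * L_nonneg by (intro mult_left_mono)
    then have Lh: "L * (v - u) \<le> 1 / 2" using Ld by simp
    have y: "norm (y - z u) \<le> 1 / 2" using * \<open>d \<le> 1 / 2\<close> by simp
    have wt: "norm (w t - z t) \<le> 2 * d" "(t, w t) \<in> S"
      using local_solution_in_tube[OF *(1,2) Lh y *(5,7)] *(4) by auto
    have "norm (z t - z s) \<le> M * \<bar>t - s\<bar>"
    proof (rule vector_differentiable_bound[of "{a..b}" z "\<lambda>t. f t (z t)"])
      fix x assume x: "x \<in> {a..b}"
      then show "norm (f x (z x)) \<le> M" using M[of 0 "(x, z x)"] z_in_S by (simp add: G_0)
    qed (use z * in \<open>auto simp: solves_ivp_def\<close>)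
    also have "\<dots> \<le> M * d" using * M0 by (intro mult_left_mono) auto
    finally have "norm (w t - z s) \<le> 2 * d + M * d"
      using norm_triangle_ineq[of "w t - z t" "z t - z s"] wt by simp
    moreover have "dist (t, w t) (s, z s) \<le> \<bar>t - s\<bar> + norm (w t - z s)"
      using norm_Pair_le[of "t - s" "w t - z s"] by (simp add: dist_norm)
    moreover have "\<bar>t - s\<bar> \<le> d" using * by auto
    ultimately have "dist (t, w t) (s, z s) < d0" using Md by (simp add: algebra_simps)
    then show "norm (G r (t, w t) - G r (s, z s)) \<le> e"
      using d0(2)[rule_format, of "(s, z s)" "(t, w t)"] wt z_in_S[of s] * by (simp add: dist_norm)
  qed
qed

lemma highest_derivative:
  assumes "u < v" "solves_ivp f u v y w" "\<forall>t\<in>{u..v}. (t, w t) \<in> S"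
  shows "nth_vderiv_exists (r + 1) {u..v} w"
    and "t \<in> {u..v} \<Longrightarrow> nth_vderiv (r + 1) {u..v} w t = G r (t, w t)"
proof -
  define g where "g = (\<lambda>j. case j of 0 \<Rightarrow> w | Suc i \<Rightarrow> \<lambda>t. G i (t, w t))"
  have 0: "g 0 t = w t" for t by (simp add: g_def)
  have 1: "(g j has_vector_derivative g (Suc j) t) (at t within {u..v})"
    if "j < r + 1" "t \<in> {u..v}" for j t
  proof (cases j)
    case 0
    then show ?thesis using assms that by (simp add: g_def G_0 solves_ivp_def)
  next
    case (Suc i)
    then show ?thesis using G_deriv[OF _ assms(2,3)] that by (simp add: g_def)
  qed
  show "nth_vderiv_exists (r + 1) {u..v} w"
    using nth_vderiv_eqI(2)[of u v g w "r + 1"] assms(1) 0 1 by blast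
  show "nth_vderiv (r + 1) {u..v} w t = G r (t, w t)" if "t \<in> {u..v}"
    using nth_vderiv_eqI(1)[of u v g w "r + 1" "r + 1" t] assms(1) 0 1 that by (simp add: g_def)
qed

end

lemma infnorm_diff_le_norm: "\<bar>infnorm x - infnorm y\<bar> \<le> norm (x - y)"
  using absdiff_infnorm[of x y] infnorm_le_norm[of "x - y"] by linarith

text \<open>Turns the supremum in the error coefficient into a real number that lies near \<open>X s\<close> for all \<open>s\<close>
at once.\<close>

lemma SUP_ereal_close:
  assumes "A \<noteq> {}" and "\<And>\<alpha> s. \<alpha> \<in> A \<Longrightarrow> s \<in> A \<Longrightarrow> \<bar>g \<alpha> - X s\<bar> \<le> e"
  obtains c where "(SUP \<alpha>\<in>A. ereal (g \<alpha>)) = ereal c" "\<And>s. s \<in> A \<Longrightarrow> \<bar>c - X s\<bar> \<le> e"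
proof -
  have up: "(SUP \<alpha>\<in>A. ereal (g \<alpha>)) \<le> ereal (X s + e)" if "s \<in> A" for s
    using assms(2)[OF _ that] by (intro SUP_least) (auto simp: abs_le_iff algebra_simps)
  have low: "ereal (X s - e) \<le> (SUP \<alpha>\<in>A. ereal (g \<alpha>))" if "s \<in> A" for s
    using assms(2)[OF that that] by (intro SUP_upper2[OF that]) (auto simp: abs_le_iff algebra_simps)
  from assms(1) obtain s0 where "s0 \<in> A" by blast
  from up[OF this] low[OF this] obtain c where c: "(SUP \<alpha>\<in>A. ereal (g \<alpha>)) = ereal c"
    by (cases "SUP \<alpha>\<in>A. ereal (g \<alpha>)") auto
  have "\<bar>c - X s\<bar> \<le> e" if "s \<in> A" for s
    using up[OF that] low[OF that] by (simp add: c abs_le_iff)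
  with c show thesis by (rule that)
qed

locale weighted_ivp = smooth_ivp f a b L r z S G
  for f :: "('d::finite) rhs" and a b L :: real and r z S G +
  fixes \<beta> :: real
  assumes \<beta>: "0 < \<beta>"
begin

definition weight :: "real \<Rightarrow> real" where
  "weight s = infnorm (G r (s, z s)) / fact r + \<beta>"

lemma weight_ge: "\<beta> \<le> weight s"
  by (simp add: weight_def infnorm_pos_le)

lemma weight_continuous: "continuous_on {a..b} weight"
proof -
  have "continuous_on {a..b} (\<lambda>s. G r (s, z s))"
    using z_in_S
    by (intro continuous_on_compose2[OF G_cont] continuous_intros solves_ivp_continuous[OF z]) auto
  then show ?thesis unfolding weight_def by (intro continuous_intros continuous_on_infnorm) auto
qed

text \<open>The error coefficient depends asymptotically neither on the initial value nor on the position in the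
subinterval.\<close>

lemma error_coeff_close:
  assumes "0 < e"
  obtains d where "0 < d"
    and "\<And>u v y. a \<le> u \<Longrightarrow> u < v \<Longrightarrow> v \<le> b \<Longrightarrow> v - u \<le> d \<Longrightarrow> norm (y - z u) \<le> d \<Longrightarrow>
      \<exists>c. error_coeff 2 \<beta> r {u..v} (ivp_solution f u v y) = ereal c \<and> (\<forall>s\<in>{u..v}. \<bar>c - 2 * weight s\<bar> \<le> e)"
proof -
  obtain d where d: "0 < d" "d \<le> 1 / 2" "L * d \<le> 1 / 2"
    "\<And>u v y w s t. a \<le> u \<Longrightarrow> v \<le> b \<Longrightarrow> v - u \<le> d \<Longrightarrow> norm (y - z u) \<le> d \<Longrightarrow>
      solves_ivp f u v y w \<Longrightarrow> s \<in> {u..v} \<Longrightarrow> t \<in> {u..v} \<Longrightarrow>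
      norm (G r (t, w t) - G r (s, z s)) \<le> e / 2"
    using highest_derivative_close[of "e / 2"] assms by auto
  show thesis
  proof (rule that[OF d(1)])
    fix u v y
    assume *: "a \<le> u" "u < v" "v \<le> b" "v - u \<le> d" "norm (y - z u) \<le> d"
    define w where "w = ivp_solution f u v y"
    have w: "solves_ivp f u v y w" unfolding w_def using * by (intro ivp_solution_solves) auto
    have "L * (v - u) \<le> L * d" using * L_nonneg by (intro mult_left_mono)
    then have S: "\<forall>t\<in>{u..v}. (t, w t) \<in> S"
      using local_solution_in_tube(2)[OF *(1,3) _ _ w] d * by auto
    note hd = highest_derivative[OF *(2) w S]
    have "\<bar>infnorm (G r (\<alpha>, w \<alpha>)) - infnorm (G r (s, z s))\<bar> \<le> e / 2"
      if "\<alpha> \<in> {u..v}" "s \<in> {u..v}" for \<alpha> s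
      using d(4)[OF *(1,3,4,5) w that(2,1)] infnorm_diff_le_norm order_trans by blast
    then obtain c where c: "(SUP \<alpha>\<in>{u..v}. ereal (infnorm (G r (\<alpha>, w \<alpha>)))) = ereal c"
      "\<And>s. s \<in> {u..v} \<Longrightarrow> \<bar>c - infnorm (G r (s, z s))\<bar> \<le> e / 2"
      using SUP_ereal_close[of "{u..v}" "\<lambda>\<alpha>. infnorm (G r (\<alpha>, w \<alpha>))" "\<lambda>s. infnorm (G r (s, z s))" "e / 2"]
        \<open>u < v\<close> by auto
    have "error_coeff 2 \<beta> r {u..v} w = ereal (2 * (1 / fact r * c + \<beta>))"
      using hd c(1) by (simp add: error_coeff_def cong: SUP_cong_simp)
    moreover have "\<bar>2 * (1 / fact r * c + \<beta>) - 2 * weight s\<bar> \<le> e" if "s \<in> {u..v}" for s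
    proof -
      have "2 * (1 / fact r * c + \<beta>) - 2 * weight s = 2 * (c - infnorm (G r (s, z s))) / fact r"
        by (simp add: weight_def diff_divide_distrib algebra_simps)
      also have "\<bar>\<dots>\<bar> = 2 * \<bar>c - infnorm (G r (s, z s))\<bar> / fact r"
        unfolding abs_divide abs_mult by simp
      also have "\<dots> \<le> e / 1" using c(2)[OF that] assms by (intro frac_le) auto
      finally show ?thesis by simp
    qed
    ultimately show "\<exists>c. error_coeff 2 \<beta> r {u..v} (ivp_solution f u v y) = ereal c \<and>
        (\<forall>s\<in>{u..v}. \<bar>c - 2 * weight s\<bar> \<le> e)"
      unfolding w_def by blast
  qed
qed

text \<open>The quantity from which the algorithm derives the step length estimates the weight. The iterates are accurate
to \<open>O(h\<^bsup>r + 1\<^esup>)\<close>, and division by \<open>h\<^sup>r\<close> leaves an error that vanishes with \<open>h\<close>.\<close>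

lemma divided_difference_close:
  assumes "0 < e"
  obtains d where "0 < d"
    and "\<And>u v y t. a \<le> u \<Longrightarrow> u < v \<Longrightarrow> v \<le> b \<Longrightarrow> v - u \<le> d \<Longrightarrow> norm (y - z u) \<le> d \<Longrightarrow>
      t = (\<lambda>k. u + real k * ((v - u) / real r)) \<Longrightarrow>
      \<bar>infnorm (divided_difference r t (\<lambda>s. f s (iterate f r t u y (r + 1) s)) 0) + \<beta>
        - weight u\<bar> \<le> e"
proof -
  obtain C where C: "0 \<le> C"
    "\<And>u v y w t s. a \<le> u \<Longrightarrow> u < v \<Longrightarrow> v \<le> b \<Longrightarrow> v - u \<le> 1 \<Longrightarrow> solves_ivp f u v y w \<Longrightarrow>
      \<forall>t\<in>{u..v}. (t, w t) \<in> S \<Longrightarrow> separated_nodes r u v t \<Longrightarrow> s \<in> {u..v} \<Longrightarrow>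
      norm (iterate f r t u y (r + 1) s - w s) \<le> C * (v - u) ^ (r + 1)"
    by (rule iterate_error_exists) blast
  define Q where "Q = (2 * real r) ^ r"
  have Q: "0 < Q" using r_pos by (simp add: Q_def)
  define e' where "e' = e / (4 * Q + 4)"
  have e': "0 < e'" using assms Q by (simp add: e'_def)
  obtain d where d: "0 < d" "d \<le> 1 / 2" "L * d \<le> 1 / 2"
    "\<And>u v y w s t. a \<le> u \<Longrightarrow> v \<le> b \<Longrightarrow> v - u \<le> d \<Longrightarrow> norm (y - z u) \<le> d \<Longrightarrow>
      solves_ivp f u v y w \<Longrightarrow> s \<in> {u..v} \<Longrightarrow> t \<in> {u..v} \<Longrightarrow>
      norm (G r (t, w t) - G r (s, z s)) \<le> e'"
    using highest_derivative_close[OF e'] by blast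
  define d' where "d' = min d (e' / (L * C + 1))"
  have LC: "0 \<le> L * C" using L_nonneg C by simp
  have d': "0 < d'" "d' \<le> d" using d e' LC by (auto simp: d'_def)
  have "L * C * d' \<le> L * C * (e' / (L * C + 1))"
    using LC by (intro mult_left_mono) (auto simp: d'_def)
  also have "\<dots> \<le> e'" using LC e' by (simp add: field_simps)
  finally have LCd: "L * C * d' \<le> e'" .
  show thesis
  proof (rule that[OF d'(1)])
    fix u v y and t :: "nat \<Rightarrow> real"
    assume *: "a \<le> u" "u < v" "v \<le> b" "v - u \<le> d'" "norm (y - z u) \<le> d'"
      and t: "t = (\<lambda>k. u + real k * ((v - u) / real r))"
    define w where "w = ivp_solution f u v y"
    define H where "H = (\<lambda>s. f s (iterate f r t u y (r + 1) s))"
    have w: "solves_ivp f u v y w" unfolding w_def using * by (intro ivp_solution_solves) auto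
    have "L * (v - u) \<le> L * d" using * L_nonneg d' by (intro mult_left_mono) auto
    then have S: "\<forall>t\<in>{u..v}. (t, w t) \<in> S"
      using local_solution_in_tube(2)[OF *(1,3) _ _ w] d d' * by auto
    have close: "norm (G r (s, w s) - G r (u, z u)) \<le> e'" if "s \<in> {u..v}" for s
      using * d' that w by (intro d(4)) auto
    have t_in: "t j \<in> {u..v}" if "j \<le> r" for j
    proof -
      have "real j / real r * (v - u) \<le> 1 * (v - u)"
        using that r_pos * by (intro mult_right_mono) auto
      then show ?thesis using * by (simp add: t)
    qed
    have t_sep: "(v - u) / real r \<le> \<bar>t j - t k\<bar>" if "j \<noteq> k" for j k
    proof -
      have "t j - t k = (real j - real k) * ((v - u) / real r)"
        unfolding t left_diff_distrib by simp
      then have "\<bar>t j - t k\<bar> = \<bar>real j - real k\<bar> * ((v - u) / real r)"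
        using * by (simp add: abs_mult)
      moreover have "1 \<le> \<bar>real j - real k\<bar>" using that by linarith
      ultimately show ?thesis
        using mult_right_mono[of 1 "\<bar>real j - real k\<bar>" "(v - u) / real r"] * by simp
    qed
    have nodes: "separated_nodes r u v t" using t_in t_sep by (auto simp: separated_nodes_def)
    have E: "norm (H (t j) - G 0 (t j, w (t j))) \<le> (L * C * (v - u)) * (v - u) ^ r" if "j \<le> r" for j
    proof -
      have "norm (H (t j) - G 0 (t j, w (t j))) \<le> L * norm (iterate f r t u y (r + 1) (t j) - w (t j))"
        unfolding H_def G_0 prod.case using t_in[OF that] * by (intro lip) auto
      also have "\<dots> \<le> L * (C * (v - u) ^ (r + 1))"
        using t_in[OF that] * d d' L_nonneg w S nodes by (intro mult_left_mono C(2)) auto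
      finally show ?thesis by (simp add: mult_ac)
    qed
    have "norm (divided_difference r t H 0 - (1 / fact r) *\<^sub>R G r (u, w u)) \<le> Q * (2 * e' + L * C * (v - u))"
      unfolding Q_def
    proof (rule divided_difference_near_derivative[where g = "\<lambda>j t. G j (t, w t)"])
      show "norm (G r (s, w s) - G r (u, w u)) \<le> 2 * e'" if "s \<in> {u..v}" for s
        using close[OF that] close[of u] *
          norm_triangle_ineq4[of "G r (s, w s) - G r (u, z u)" "G r (u, w u) - G r (u, z u)"] by simp
    qed (use G_deriv[OF _ w S] * r_pos t_in t_sep E in auto)
    also have "\<dots> \<le> Q * (2 * e' + e')"
      using LCd * LC Q mult_left_mono[of "v - u" d' "L * C"] by (intro mult_left_mono add_mono) auto
    finally have 1: "norm (divided_difference r t H 0 - (1 / fact r) *\<^sub>R G r (u, w u)) \<le> Q * (3 * e')" by simp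
    have "norm ((1 / fact r) *\<^sub>R G r (u, w u) - (1 / fact r) *\<^sub>R G r (u, z u))
        = norm (G r (u, w u) - G r (u, z u)) / fact r"
      by (simp add: scaleR_diff_right[symmetric])
    also have "\<dots> \<le> e' / 1" using close[of u] * e' by (intro frac_le) auto
    finally have 2: "norm ((1 / fact r) *\<^sub>R G r (u, w u) - (1 / fact r) *\<^sub>R G r (u, z u)) \<le> e'" by simp
    have "norm (divided_difference r t H 0 - (1 / fact r) *\<^sub>R G r (u, z u)) \<le> Q * (3 * e') + e'"
      using norm_triangle_mono[OF 1 2] by simp
    also have "\<dots> = (3 * Q + 1) * e'" by (simp add: algebra_simps)
    also have "\<dots> \<le> (4 * Q + 4) * e'" using Q e' by (intro mult_right_mono) auto
    also have "\<dots> = e" using Q by (simp add: e'_def)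
    finally have "\<bar>infnorm (divided_difference r t H 0) - infnorm ((1 / fact r) *\<^sub>R G r (u, z u))\<bar> \<le> e"
      using infnorm_diff_le_norm order_trans by blast
    then show "\<bar>infnorm (divided_difference r t (\<lambda>s. f s (iterate f r t u y (r + 1) s)) 0) + \<beta>
        - weight u\<bar> \<le> e"
      by (simp add: weight_def H_def infnorm_mul)
  qed
qed

end

section \<open>Global error, and meshes with empty subintervals\<close>

context smooth_ivp begin

text \<open>Convergence of one-step schemes. The local error estimate is demanded only at nodes where the
computed value is already close to \<open>z\<close>, since only there local solutions are known to be smooth; the
induction establishes closeness together with the error estimate. The comparison function \<open>E\<close> in the
proof is the usual bound for accumulated and amplified local errors. Empty subintervals are allowed.\<close>

lemma global_error_small:
  assumes C: "0 \<le> C" and \<rho>: "0 < \<rho>" "\<rho> \<le> 1 / 2"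
  obtains d where "0 < d"
    and "\<And>m x y. x 0 = a \<Longrightarrow> y 0 = z a \<Longrightarrow>
      (\<And>i. i < m \<Longrightarrow> x i \<le> x (Suc i) \<and> x (Suc i) \<le> b \<and> x (Suc i) - x i \<le> d) \<Longrightarrow>
      (\<And>i. i < m \<Longrightarrow> x (Suc i) = x i \<Longrightarrow> y (Suc i) = y i) \<Longrightarrow>
      (\<And>i. i < m \<Longrightarrow> x i < x (Suc i) \<Longrightarrow> a \<le> x i \<Longrightarrow> norm (y i - z (x i)) \<le> \<rho> \<Longrightarrow>
        norm (y (Suc i) - ivp_solution f (x i) (x (Suc i)) (y i) (x (Suc i))) \<le> C * (x (Suc i) - x i) ^ (r + 1)) \<Longrightarrow>
      \<forall>i\<le>m. norm (y i - z (x i)) \<le> \<rho>"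
proof -
  define Q where "Q = C * (exp (2 * L * (b - a)) * (b - a))"
  have Q: "0 \<le> Q" using C ab by (simp add: Q_def)
  define d where "d = min 1 (min (1 / (2 * (L + 1))) (\<rho> / (Q + 1)))"
  have d: "0 < d" "d \<le> 1" using \<rho> Q L_nonneg by (auto simp: d_def)
  have "L * d \<le> L * (1 / (2 * (L + 1)))" using L_nonneg by (intro mult_left_mono) (auto simp: d_def)
  also have "\<dots> \<le> 1 / 2" using L_nonneg by (simp add: field_simps)
  finally have Ld: "L * d \<le> 1 / 2" .
  have "Q * d \<le> Q * (\<rho> / (Q + 1))" using Q by (intro mult_left_mono) (auto simp: d_def)
  also have "\<dots> \<le> \<rho>" using Q \<rho> by (simp add: field_simps)
  finally have Qd: "Q * d \<le> \<rho>" .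
  define E where "E = (\<lambda>t. C * d * (exp (2 * L * (t - a)) * (t - a)))"
  have E_le: "E t \<le> \<rho>" if "t \<in> {a..b}" for t
  proof -
    have "E t \<le> C * d * (exp (2 * L * (b - a)) * (b - a))"
      unfolding E_def using that C d L_nonneg by (intro mult_left_mono mult_mono) (auto intro: mult_left_mono)
    also have "\<dots> = Q * d" by (simp add: Q_def)
    finally show ?thesis using Qd by simp
  qed
  show thesis
  proof (rule that[OF d(1)])
    fix m and x :: "nat \<Rightarrow> real" and y :: "nat \<Rightarrow> real ^ 'd"
    assume 0: "x 0 = a" "y 0 = z a"
      and x: "\<And>i. i < m \<Longrightarrow> x i \<le> x (Suc i) \<and> x (Suc i) \<le> b \<and> x (Suc i) - x i \<le> d"
      and deg: "\<And>i. i < m \<Longrightarrow> x (Suc i) = x i \<Longrightarrow> y (Suc i) = y i"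
      and step: "\<And>i. i < m \<Longrightarrow> x i < x (Suc i) \<Longrightarrow> a \<le> x i \<Longrightarrow> norm (y i - z (x i)) \<le> \<rho> \<Longrightarrow>
        norm (y (Suc i) - ivp_solution f (x i) (x (Suc i)) (y i) (x (Suc i))) \<le> C * (x (Suc i) - x i) ^ (r + 1)"
    have "i \<le> m \<longrightarrow> x i \<in> {a..b} \<and> norm (y i - z (x i)) \<le> E (x i)" for i
    proof (induction i)
      case 0
      then show ?case using \<open>x 0 = a\<close> \<open>y 0 = z a\<close> ab by (simp add: E_def)
    next
      case (Suc i)
      show ?case
      proof
        assume i: "Suc i \<le> m"
        then have IH: "x i \<in> {a..b}" "norm (y i - z (x i)) \<le> E (x i)" using Suc by auto
        have xi: "x i \<le> x (Suc i)" "x (Suc i) \<le> b" "x (Suc i) - x i \<le> d" using x[of i] i by auto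
        have "norm (y (Suc i) - z (x (Suc i))) \<le> E (x (Suc i))"
        proof (cases "x (Suc i) = x i")
          case True
          then show ?thesis using IH deg[of i] i by simp
        next
          case False
          define h where "h = x (Suc i) - x i"
          define w where "w = ivp_solution f (x i) (x (Suc i)) (y i)"
          have h: "0 < h" "h \<le> d" using xi False by (auto simp: h_def)
          have Lh: "L * h \<le> 1 / 2" using Ld h L_nonneg mult_left_mono[of h d L] by simp
          have w: "solves_ivp f (x i) (x (Suc i)) (y i) w"
            unfolding w_def using IH xi by (intro ivp_solution_solves) auto
          have "h ^ r \<le> h ^ 1" using h d r_pos by (intro power_decreasing) auto
          then have "C * h ^ (r + 1) \<le> C * (d * h)"
            using h C by (intro mult_left_mono) (auto intro: mult_mono)
          moreover have "norm (y (Suc i) - w (x (Suc i))) \<le> C * h ^ (r + 1)"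
            unfolding w_def h_def
            using step[of i] i xi False IH E_le[OF IH(1)] by auto
          ultimately have 1: "norm (y (Suc i) - w (x (Suc i))) \<le> C * d * h" by simp
          have "norm (w (x (Suc i)) - z (x (Suc i))) \<le> (1 + 2 * L * h) * norm (y i - z (x i))"
            unfolding h_def using IH xi Lh
            by (intro solutions_stay_close[OF w z_solves_subinterval]) (auto simp: h_def)
          also have "\<dots> \<le> exp (2 * L * h) * E (x i)"
            using IH exp_ge_add_one_self[of "2 * L * h"] by (intro mult_mono) auto
          finally have 2: "norm (w (x (Suc i)) - z (x (Suc i))) \<le> exp (2 * L * h) * E (x i)" .
          have "norm (y (Suc i) - z (x (Suc i))) \<le> C * d * h + exp (2 * L * h) * E (x i)"
            using norm_triangle_mono[OF 1 2] by simp
          also have "exp (2 * L * h) * E (x i) = C * d * (exp (2 * L * (x (Suc i) - a)) * (x i - a))"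
            by (simp add: E_def h_def exp_add[symmetric] algebra_simps)
          also have "C * d * h + \<dots> \<le> C * d * (exp (2 * L * (x (Suc i) - a)) * h) + \<dots>"
          proof -
            have "1 \<le> exp (2 * L * (x (Suc i) - a))" using IH xi L_nonneg by simp
            then show ?thesis using C d h by (simp add: mult_left_mono)
          qed
          also have "\<dots> = E (x (Suc i))" by (simp add: E_def h_def algebra_simps)
          finally show ?thesis .
        qed
        then show "x (Suc i) \<in> {a..b} \<and> norm (y (Suc i) - z (x (Suc i))) \<le> E (x (Suc i))"
          using IH xi by auto
      qed
    qed
    then show "\<forall>i\<le>m. norm (y i - z (x i)) \<le> \<rho>" using E_le order_trans by blast
  qed
qed

end

lemma hd_history: "hd (history \<phi> f \<eta> x i) = (x i, node_value \<phi> f \<eta> x i)"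
proof -
  have "fst (hd (history \<phi> f \<eta> x i)) = x i" by (induction i) (auto simp: Let_def)
  then show ?thesis by (simp add: node_value_def prod_eq_iff)
qed

lemma node_value_0: "node_value \<phi> f \<eta> x 0 = \<eta>"
  by (simp add: node_value_def)

lemma node_value_Suc:
  "node_value \<phi> f \<eta> x (Suc i) =
     (if x (Suc i) = x i then node_value \<phi> f \<eta> x i else local_approx \<phi> f \<eta> x i (x (Suc i)))"
  by (simp add: node_value_def local_approx_def Let_def)

lemma weak_mesh_step:
  assumes "weak_mesh a b m x" "i < m"
  shows "x i \<le> x (Suc i)" "a \<le> x i" "x (Suc i) \<le> b"
proof -
  have mono: "i \<le> j \<Longrightarrow> j \<le> m \<Longrightarrow> x i \<le> x j" for i j
    by (induction j rule: dec_induct) (use assms(1) in \<open>auto simp: weak_mesh_def intro: order_trans\<close>)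
  show "x i \<le> x (Suc i)" using assms by (simp add: weak_mesh_def)
  show "a \<le> x i" using mono[of 0 i] assms by (simp add: weak_mesh_def)
  show "x (Suc i) \<le> b" using mono[of "Suc i" m] assms by (simp add: weak_mesh_def)
qed

text \<open>Omits the empty subintervals of a mesh. Since methods skip them, the histories agree up to the
renumbering \<open>\<sigma>\<close>, where \<open>\<sigma> i\<close> counts the nonempty subintervals before the node \<open>i\<close>.\<close>

lemma weak_mesh_compress:
  assumes "weak_mesh a b m x"
  obtains m' x' \<sigma> where "m' \<le> m" "mesh a b m' x'"
    and "\<And>i. i < m \<Longrightarrow> x i < x (Suc i) \<Longrightarrow>
      \<sigma> i < m' \<and> x' (\<sigma> i) = x i \<and> x' (Suc (\<sigma> i)) = x (Suc i)"
    and "\<And>(\<phi> :: ('d::finite) ivp_method) f \<eta> i. history \<phi> f \<eta> x i = history \<phi> f \<eta> x' (\<sigma> i)"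
    and "\<And>j. j < m' \<Longrightarrow> \<exists>i<m. x i < x (Suc i) \<and> x' j = x i \<and> x' (Suc j) = x (Suc i)"
proof -
  define \<sigma> where "\<sigma> = (\<lambda>i. \<Sum>j<i. if x j = x (Suc j) then 0 else 1 :: nat)"
  have \<sigma>_Suc: "\<sigma> (Suc i) = (if x i = x (Suc i) then \<sigma> i else Suc (\<sigma> i))" for i by (simp add: \<sigma>_def)
  have \<sigma>_mono: "i \<le> j \<Longrightarrow> \<sigma> i \<le> \<sigma> j" for i j unfolding \<sigma>_def by (intro sum_mono2) auto
  have const: "k \<le> i \<Longrightarrow> \<sigma> k = \<sigma> i \<Longrightarrow> x k = x i" for k i
  proof (induction i rule: dec_induct)
    case (step n)
    then have "\<sigma> k = \<sigma> n" "x n = x (Suc n)"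
      using \<sigma>_mono[of k n] \<sigma>_Suc[of n] by (auto split: if_splits)
    then show ?case using step by simp
  qed simp
  \<comment> \<open>The choice of the index is immaterial: \<open>x\<close> is constant where \<open>\<sigma>\<close> is.\<close>
  define x' where "x' = (\<lambda>j. x (LEAST i. \<sigma> i = j))"
  have x': "x' (\<sigma> i) = x i" for i
  proof -
    have "\<sigma> (LEAST k. \<sigma> k = \<sigma> i) = \<sigma> i" by (rule LeastI) simp
    moreover have "(LEAST k. \<sigma> k = \<sigma> i) \<le> i" by (rule Least_le) simp
    ultimately show ?thesis unfolding x'_def using const by blast
  qed
  have x'_Suc: "x' (Suc (\<sigma> i)) = x (Suc i)" if "x i \<noteq> x (Suc i)" for i
    using x'[of "Suc i"] that by (simp add: \<sigma>_Suc)
  have onto: "j < \<sigma> n \<Longrightarrow> \<exists>i<n. \<sigma> i = j \<and> x i \<noteq> x (Suc i)" for j n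
  proof (induction n)
    case 0
    then show ?case by (simp add: \<sigma>_def)
  next
    case (Suc n)
    then show ?case by (cases "j < \<sigma> n") (auto simp: \<sigma>_Suc less_Suc_eq split: if_splits)
  qed
  have le: "x i \<le> x (Suc i)" if "i < m" for i using assms that by (simp add: weak_mesh_def)
  have onto': "\<exists>i<m. x i < x (Suc i) \<and> x' j = x i \<and> x' (Suc j) = x (Suc i)" if "j < \<sigma> m" for j
    using onto[OF that] x' x'_Suc le by (metis order_less_le)
  have \<sigma>_0: "\<sigma> 0 = 0" by (simp add: \<sigma>_def)
  have hist: "history \<phi> f \<eta> x i = history \<phi> f \<eta> x' (\<sigma> i)" for \<phi> :: "'d ivp_method" and f \<eta> i
    by (induction i) (use x'[of 0] x' x'_Suc in \<open>auto simp: \<sigma>_Suc \<sigma>_0 Let_def\<close>)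
  have le_m: "\<sigma> m \<le> m" unfolding \<sigma>_def by (rule order_trans[OF sum_bounded_above[of _ _ 1]]) auto
  have mesh': "mesh a b (\<sigma> m) x'"
    unfolding mesh_def
  proof (intro conjI allI impI)
    show "x' 0 = a" "x' (\<sigma> m) = b"
      using x'[of 0] x'[of m] assms by (auto simp: weak_mesh_def \<sigma>_0)
    show "x' j < x' (Suc j)" if "j < \<sigma> m" for j using onto'[OF that] by metis
  qed
  have step: "\<sigma> i < \<sigma> m \<and> x' (\<sigma> i) = x i \<and> x' (Suc (\<sigma> i)) = x (Suc i)"
    if "i < m" "x i < x (Suc i)" for i
    using that x'[of i] x'_Suc[of i] \<sigma>_mono[of "Suc i" m] by (auto simp: \<sigma>_Suc)
  show thesis
  proof (rule that[of "\<sigma> m" x' \<sigma>])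
    show "\<sigma> i < \<sigma> m \<and> x' (\<sigma> i) = x i \<and> x' (Suc (\<sigma> i)) = x (Suc i)"
      if "i < m" "x i < x (Suc i)" for i by (rule step[OF that])
    show "\<exists>i<m. x i < x (Suc i) \<and> x' j = x i \<and> x' (Suc j) = x (Suc i)"
      if "j < \<sigma> m" for j by (rule onto'[OF that])
  qed (rule le_m mesh' hist)+
qed

text \<open>Assumption A speaks of meshes without empty subintervals and of large numbers of subintervals. Both
restrictions vanish for fine meshes: compression keeps a mesh admissible, as \<open>lseq\<close> is nonincreasing,
and a fine mesh of \<open>{a..b}\<close> has many nonempty subintervals.\<close>

lemma assumption_A_weak_mesh:
  fixes \<phi> :: "('d::finite) ivp_method"
  assumes A: "assumption_A \<beta>' \<beta> r a b \<eta> lseq K k0 \<phi>" and f: "f \<in> F_class r a b \<eta>" and "a < b"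
    and "antimono lseq" and "lseq \<longlonglongrightarrow> 0"
  obtains d where "0 < d"
    and "\<And>m x i t. weak_mesh a b m x \<Longrightarrow> admissible lseq (K f) (k0 f) m x \<Longrightarrow>
      (\<And>i. i < m \<Longrightarrow> x (Suc i) - x i \<le> d) \<Longrightarrow> i < m \<Longrightarrow> x i < x (Suc i) \<Longrightarrow>
      t \<in> {x i..x (Suc i)} \<Longrightarrow>
      ereal (infnorm (local_solution \<phi> f \<eta> x i t - local_approx \<phi> f \<eta> x i t))
        \<le> local_bound \<beta>' \<beta> r \<phi> f \<eta> x i"
proof -
  obtain m0 where m0: "\<forall>m\<ge>m0. \<forall>x. mesh a b m x \<and> admissible lseq (K f) (k0 f) m x \<longrightarrow>
      (\<forall>i<m. (SUP t\<in>{x i..x (Suc i)}.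
         ereal (infnorm (local_solution \<phi> f \<eta> x i t - local_approx \<phi> f \<eta> x i t)))
        \<le> local_bound \<beta>' \<beta> r \<phi> f \<eta> x i)"
    using bspec[OF A[unfolded assumption_A_def] f] by (elim exE)
  \<comment> \<open>With steps of this length at least \<open>m0\<close> subintervals are needed to cover \<open>{a..b}\<close>.\<close>
  define d where "d = (b - a) / (real m0 + 1)"
  have d: "0 < d" using \<open>a < b\<close> by (simp add: d_def)
  show thesis
  proof (rule that[OF d])
    fix m x i t
    assume wm: "weak_mesh a b m x" and adm: "admissible lseq (K f) (k0 f) m x"
      and small: "\<And>i. i < m \<Longrightarrow> x (Suc i) - x i \<le> d" and i: "i < m" "x i < x (Suc i)"
      and t: "t \<in> {x i..x (Suc i)}"
    obtain m' x' \<sigma> where m': "m' \<le> m" "mesh a b m' x'"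
      and \<sigma>: "\<And>i. i < m \<Longrightarrow> x i < x (Suc i) \<Longrightarrow>
        \<sigma> i < m' \<and> x' (\<sigma> i) = x i \<and> x' (Suc (\<sigma> i)) = x (Suc i)"
      and hist: "\<And>(\<phi> :: 'd ivp_method) f \<eta> i. history \<phi> f \<eta> x i = history \<phi> f \<eta> x' (\<sigma> i)"
      and onto: "\<And>j. j < m' \<Longrightarrow> \<exists>i<m. x i < x (Suc i) \<and> x' j = x i \<and> x' (Suc j) = x (Suc i)"
      by (rule weak_mesh_compress[OF wm, where 'd = 'd]) blast
    have step: "x' (Suc j) - x' j \<le> d" if "j < m'" for j
      using onto[OF that] small by metis
    have "b - a = (\<Sum>j<m'. x' (Suc j) - x' j)"
      using m' by (simp add: sum_lessThan_telescope mesh_def)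
    also have "\<dots> \<le> real m' * d"
      using sum_bounded_above[of "{..<m'}" "\<lambda>j. x' (Suc j) - x' j" d] step by simp
    finally have "(real m0 + 1) * d \<le> real m' * d" by (simp add: d_def)
    then have "real m0 + 1 \<le> real m'" using d by simp
    then have "m0 \<le> m'" by linarith
    moreover have "admissible lseq (K f) (k0 f) m' x'"
      unfolding admissible_def
    proof (intro impI allI)
      fix j assume "k0 f \<le> m'" "j < m'"
      then obtain k where k: "k < m" "x k < x (Suc k)" "x' j = x k" "x' (Suc j) = x (Suc k)"
        using onto by blast
      have le: "x (Suc k) - x k \<le> K f * lseq m"
        using adm k \<open>k0 f \<le> m'\<close> m' by (simp add: admissible_def)
      have "0 \<le> lseq m" using decseq_ge[OF assms(4,5)] .
      moreover have "0 < K f * lseq m" using le k by simp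
      ultimately have "0 < K f" by (simp add: zero_less_mult_iff)
      then have "K f * lseq m \<le> K f * lseq m'"
        using antimonoD[OF assms(4) m'(1)] by simp
      with le k show "x' (Suc j) - x' j \<le> K f * lseq m'" by simp
    qed
    moreover note \<sigma>[OF i]
    ultimately have "(SUP t\<in>{x i..x (Suc i)}.
         ereal (infnorm (local_solution \<phi> f \<eta> x' (\<sigma> i) t - local_approx \<phi> f \<eta> x' (\<sigma> i) t)))
        \<le> local_bound \<beta>' \<beta> r \<phi> f \<eta> x' (\<sigma> i)"
      using m0[rule_format, of m' x' "\<sigma> i"] m'(2) by simp
    moreover have sol: "local_solution \<phi> f \<eta> x' (\<sigma> i) = local_solution \<phi> f \<eta> x i"
      using \<sigma>[OF i] by (simp add: local_solution_def node_value_def hist[symmetric])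
    moreover have "local_approx \<phi> f \<eta> x' (\<sigma> i) = local_approx \<phi> f \<eta> x i"
      using \<sigma>[OF i] by (simp add: local_approx_def hist[symmetric])
    moreover have "local_bound \<beta>' \<beta> r \<phi> f \<eta> x' (\<sigma> i) = local_bound \<beta>' \<beta> r \<phi> f \<eta> x i"
      using \<sigma>[OF i] sol by (simp add: local_bound_def)
    ultimately have "(SUP t\<in>{x i..x (Suc i)}.
         ereal (infnorm (local_solution \<phi> f \<eta> x i t - local_approx \<phi> f \<eta> x i t)))
        \<le> local_bound \<beta>' \<beta> r \<phi> f \<eta> x i" by simp
    then show "ereal (infnorm (local_solution \<phi> f \<eta> x i t - local_approx \<phi> f \<eta> x i t))
        \<le> local_bound \<beta>' \<beta> r \<phi> f \<eta> x i"
      using t unfolding SUP_le_iff by (rule bspec)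
  qed
qed

lemma error_coeff_ge:
  assumes "S \<noteq> {}"
  shows "ereal (2 * \<beta>) \<le> error_coeff 2 \<beta> r S w"
proof (cases "nth_vderiv_exists (r + 1) S w")
  case True
  obtain s where s: "s \<in> S" using assms by blast
  let ?A = "ereal (1 / fact r) * (SUP \<alpha>\<in>S. ereal (infnorm (nth_vderiv (r + 1) S w \<alpha>)))"
  have "0 \<le> (SUP \<alpha>\<in>S. ereal (infnorm (nth_vderiv (r + 1) S w \<alpha>)))"
    by (intro SUP_upper2[OF s]) (simp add: infnorm_pos_le del: nth_vderiv.simps)
  then have "0 \<le> ?A" by (intro ereal_0_le_mult) auto
  then have "ereal 2 * (0 + ereal \<beta>) \<le> ereal 2 * (?A + ereal \<beta>)"
    by (intro ereal_mult_left_mono add_right_mono) simp_all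
  also have "\<dots> = error_coeff 2 \<beta> r S w" using True by (simp only: error_coeff_def if_True)
  finally show ?thesis by simp
qed (simp add: error_coeff_def)

section \<open>Error coefficients of convergent methods\<close>

lemma local_approx_phi_star:
  "local_approx (phi_star r) f \<eta> x i =
     iterate f r (star_nodes r (x i) (x (Suc i))) (x i) (node_value (phi_star r) f \<eta> x i) (r + 1)"
  by (simp add: local_approx_def phi_star_def hd_history)

lemma separated_star_nodes:
  assumes "u < v" "1 \<le> r"
  shows "separated_nodes r u v (star_nodes r u v)"
proof (cases "r = 1")
  case True
  then show ?thesis using assms by (auto simp: separated_nodes_def star_nodes_def)
next
  case False
  then have r: "2 \<le> r" using assms by simp
  define c where "c = (v - u) / real (r - 1)"
  have c: "0 < c" "(v - u) / real r \<le> c"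
    unfolding c_def using r assms by (auto intro!: divide_left_mono)
  have node: "star_nodes r u v k = u + real k * c" for k by (simp only: star_nodes_def c_def)
  have "star_nodes r u v k \<in> {u..v}" if "k < r" for k
  proof -
    have "real k * c \<le> real (r - 1) * c" using that c by (intro mult_right_mono) auto
    also have "\<dots> = v - u" using r by (simp add: c_def)
    finally show ?thesis using c by (simp add: node)
  qed
  moreover have "(v - u) / real r \<le> \<bar>star_nodes r u v j - star_nodes r u v k\<bar>" if "j \<noteq> k" for j k
  proof -
    have "1 \<le> \<bar>real j - real k\<bar>" using that by linarith
    then have "c \<le> \<bar>real j - real k\<bar> * c"
      using mult_right_mono[of 1 "\<bar>real j - real k\<bar>" c] c by simp
    also have "\<dots> = \<bar>(real j - real k) * c\<bar>" using c by (simp add: abs_mult)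
    also have "(real j - real k) * c = star_nodes r u v j - star_nodes r u v k"
      unfolding node left_diff_distrib by simp
    finally show ?thesis using c by simp
  qed
  ultimately show ?thesis by (simp add: separated_nodes_def)
qed

context weighted_ivp begin

text \<open>The right end \<open>b\<close> need not be reached: the estimates are needed for the beginning of the adaptively
generated mesh before it is known that the algorithm terminates.\<close>

definition fine_steps :: "real \<Rightarrow> nat \<Rightarrow> (nat \<Rightarrow> real) \<Rightarrow> bool" where
  "fine_steps d m x \<longleftrightarrow>
     x 0 = a \<and> (\<forall>i<m. x i \<le> x (Suc i) \<and> x (Suc i) \<le> b \<and> x (Suc i) - x i \<le> d)"

text \<open>The asymptotic statement on which all comparisons are based. The predicate \<open>P\<close> restricts the meshes,
because assumption A gives information only about admissible ones.\<close>

definition coeffs_follow_weight :: "'d ivp_method \<Rightarrow> (nat \<Rightarrow> (nat \<Rightarrow> real) \<Rightarrow> bool) \<Rightarrow> bool" where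
  "coeffs_follow_weight \<phi> P \<longleftrightarrow> (\<forall>e>0. \<exists>d>0. \<forall>m x. fine_steps d m x \<and> P m x \<longrightarrow>
     (\<forall>i<m. norm (node_value \<phi> f (z a) x i - z (x i)) \<le> e \<and>
       (x i < x (Suc i) \<longrightarrow>
         (\<exists>c. error_coeff 2 \<beta> r {x i..x (Suc i)} (local_solution \<phi> f (z a) x i) = ereal c \<and>
              (\<forall>s\<in>{x i..x (Suc i)}. \<bar>c - 2 * weight s\<bar> \<le> e)))))"

lemma fine_steps_mono: "fine_steps d m x \<Longrightarrow> d \<le> d' \<Longrightarrow> fine_steps d' m x"
  unfolding fine_steps_def by fastforce

lemma fine_steps_bounds:
  assumes "fine_steps d m x" "i \<le> m"
  shows "a \<le> x i" "x i \<le> b"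
proof -
  have "i \<le> m \<longrightarrow> a \<le> x i \<and> x i \<le> b"
  proof (induction i)
    case (Suc i)
    then show ?case using assms(1) by (auto simp: fine_steps_def dest!: spec[of _ i])
  qed (use assms(1) ab in \<open>auto simp: fine_steps_def\<close>)
  then show "a \<le> x i" "x i \<le> b" using assms(2) by auto
qed

lemma coeffs_follow_weightI:
  assumes C: "0 \<le> C" and d0: "0 < d0"
    and step: "\<And>m x i. fine_steps d0 m x \<Longrightarrow> P m x \<Longrightarrow> i < m \<Longrightarrow> x i < x (Suc i) \<Longrightarrow> a \<le> x i \<Longrightarrow>
      norm (node_value \<phi> f (z a) x i - z (x i)) \<le> d0 \<Longrightarrow>
      norm (local_approx \<phi> f (z a) x i (x (Suc i)) - local_solution \<phi> f (z a) x i (x (Suc i)))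
        \<le> C * (x (Suc i) - x i) ^ (r + 1)"
  shows "coeffs_follow_weight \<phi> P"
  unfolding coeffs_follow_weight_def
proof (intro allI impI)
  fix e :: real assume e: "0 < e"
  obtain d1 where d1: "0 < d1"
    "\<And>u v y. a \<le> u \<Longrightarrow> u < v \<Longrightarrow> v \<le> b \<Longrightarrow> v - u \<le> d1 \<Longrightarrow> norm (y - z u) \<le> d1 \<Longrightarrow>
      \<exists>c. error_coeff 2 \<beta> r {u..v} (ivp_solution f u v y) = ereal c \<and> (\<forall>s\<in>{u..v}. \<bar>c - 2 * weight s\<bar> \<le> e)"
    by (rule error_coeff_close[OF e]) blast
  define \<rho> where "\<rho> = min (1 / 2) (min d0 (min e d1))"
  have \<rho>: "0 < \<rho>" "\<rho> \<le> 1 / 2" "\<rho> \<le> d0" "\<rho> \<le> e" "\<rho> \<le> d1"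
    using d0 e d1 by (auto simp only: \<rho>_def min.bounded_iff intro!: min.cobounded1 min.coboundedI2 min_less_iff_conj[THEN iffD2])
  obtain d2 where d2: "0 < d2"
    "\<And>m x y. x 0 = a \<Longrightarrow> y 0 = z a \<Longrightarrow>
      (\<And>i. i < m \<Longrightarrow> x i \<le> x (Suc i) \<and> x (Suc i) \<le> b \<and> x (Suc i) - x i \<le> d2) \<Longrightarrow>
      (\<And>i. i < m \<Longrightarrow> x (Suc i) = x i \<Longrightarrow> y (Suc i) = y i) \<Longrightarrow>
      (\<And>i. i < m \<Longrightarrow> x i < x (Suc i) \<Longrightarrow> a \<le> x i \<Longrightarrow> norm (y i - z (x i)) \<le> \<rho> \<Longrightarrow>
        norm (y (Suc i) - ivp_solution f (x i) (x (Suc i)) (y i) (x (Suc i))) \<le> C * (x (Suc i) - x i) ^ (r + 1)) \<Longrightarrow>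
      \<forall>i\<le>m. norm (y i - z (x i)) \<le> \<rho>"
    by (rule global_error_small[OF C \<rho>(1,2)]) blast
  define d where "d = min d0 (min d1 d2)"
  have d: "0 < d" "d \<le> d0" "d \<le> d1" "d \<le> d2" using d0 d1(1) d2(1) by (auto simp: d_def)
  have "norm (node_value \<phi> f (z a) x i - z (x i)) \<le> e \<and>
       (x i < x (Suc i) \<longrightarrow>
         (\<exists>c. error_coeff 2 \<beta> r {x i..x (Suc i)} (local_solution \<phi> f (z a) x i) = ereal c \<and>
              (\<forall>s\<in>{x i..x (Suc i)}. \<bar>c - 2 * weight s\<bar> \<le> e)))"
    if x: "fine_steps d m x" and P: "P m x" and i: "i < m" for m x i
  proof -
    let ?y = "node_value \<phi> f (z a) x"
    have near: "norm (?y i - z (x i)) \<le> \<rho>" if "i \<le> m" for i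
    proof -
      have "\<forall>i\<le>m. norm (?y i - z (x i)) \<le> \<rho>"
      proof (rule d2(2))
        show "x 0 = a" using x by (simp add: fine_steps_def)
        show "?y 0 = z a" by (rule node_value_0)
        fix i assume i: "i < m"
        show "x i \<le> x (Suc i) \<and> x (Suc i) \<le> b \<and> x (Suc i) - x i \<le> d2"
          using fine_steps_mono[OF x d(4)] i by (simp add: fine_steps_def)
        show "?y (Suc i) = ?y i" if "x (Suc i) = x i" using that by (simp add: node_value_Suc)
        show "norm (?y (Suc i) - ivp_solution f (x i) (x (Suc i)) (?y i) (x (Suc i)))
            \<le> C * (x (Suc i) - x i) ^ (r + 1)"
          if "x i < x (Suc i)" "a \<le> x i" "norm (?y i - z (x i)) \<le> \<rho>"
          using step[OF fine_steps_mono[OF x d(2)] P i that(1,2)] that \<rho>(3)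
          by (simp add: node_value_Suc local_solution_def)
      qed
      then show ?thesis using that by blast
    qed
    have xi: "x (Suc i) \<le> b" "x (Suc i) - x i \<le> d1"
      using fine_steps_mono[OF x d(3)] i by (auto simp: fine_steps_def)
    have "norm (?y i - z (x i)) \<le> e" "norm (?y i - z (x i)) \<le> d1" using near[of i] i \<rho> by auto
    then show ?thesis
      using d1(2)[of "x i" "x (Suc i)" "?y i"] fine_steps_bounds(1)[OF x, of i] xi i
      unfolding local_solution_def by auto
  qed
  then show "\<exists>d>0. \<forall>m x. fine_steps d m x \<and> P m x \<longrightarrow>
     (\<forall>i<m. norm (node_value \<phi> f (z a) x i - z (x i)) \<le> e \<and>
       (x i < x (Suc i) \<longrightarrow>
         (\<exists>c. error_coeff 2 \<beta> r {x i..x (Suc i)} (local_solution \<phi> f (z a) x i) = ereal c \<and>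
              (\<forall>s\<in>{x i..x (Suc i)}. \<bar>c - 2 * weight s\<bar> \<le> e))))"
    using d(1) by blast
qed

lemma phi_star_coeffs_follow_weight: "coeffs_follow_weight (phi_star r) P"
proof -
  obtain C where C: "0 \<le> C"
    "\<And>u v y w t s. a \<le> u \<Longrightarrow> u < v \<Longrightarrow> v \<le> b \<Longrightarrow> v - u \<le> 1 \<Longrightarrow> solves_ivp f u v y w \<Longrightarrow>
      \<forall>t\<in>{u..v}. (t, w t) \<in> S \<Longrightarrow> separated_nodes r u v t \<Longrightarrow> s \<in> {u..v} \<Longrightarrow>
      norm (iterate f r t u y (r + 1) s - w s) \<le> C * (v - u) ^ (r + 1)"
    by (rule iterate_error_exists) blast
  define d where "d = min (1 / 2) (1 / (2 * (L + 1)))"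
  have d: "0 < d" "d \<le> 1 / 2" "d \<le> 1 / (2 * (L + 1))"
    unfolding d_def using L_nonneg by auto
  have "L * d \<le> L * (1 / (2 * (L + 1)))" using L_nonneg d by (intro mult_left_mono) auto
  also have "\<dots> \<le> 1 / 2" using L_nonneg by (simp add: field_simps)
  finally have Ld: "L * d \<le> 1 / 2" .
  show ?thesis
  proof (rule coeffs_follow_weightI[OF C(1) d(1)])
    fix m x i
    assume x: "fine_steps d m x" and i: "i < m" "x i < x (Suc i)" "a \<le> x i"
      and near: "norm (node_value (phi_star r) f (z a) x i - z (x i)) \<le> d"
    let ?w = "local_solution (phi_star r) f (z a) x i"
    have xi: "x (Suc i) \<le> b" "x (Suc i) - x i \<le> d" using x i by (auto simp: fine_steps_def)
    have w: "solves_ivp f (x i) (x (Suc i)) (node_value (phi_star r) f (z a) x i) ?w"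
      unfolding local_solution_def using i xi by (intro ivp_solution_solves) auto
    have Lh: "L * (x (Suc i) - x i) \<le> 1 / 2"
      using mult_left_mono[OF xi(2) L_nonneg] Ld by simp
    have "\<forall>t\<in>{x i..x (Suc i)}. (t, ?w t) \<in> S"
      using local_solution_in_tube(2)[OF i(3) xi(1) Lh _ w] near d(2) by simp
    then show "norm (local_approx (phi_star r) f (z a) x i (x (Suc i)) - ?w (x (Suc i)))
        \<le> C * (x (Suc i) - x i) ^ (r + 1)"
      unfolding local_approx_phi_star
      using i xi d w separated_star_nodes[OF i(2) r_pos] by (intro C(2)) auto
  qed
qed

lemma weight_bounded: obtains W where "0 \<le> W" "\<And>s. s \<in> {a..b} \<Longrightarrow> weight s \<le> W"
proof -
  obtain s0 where s0: "s0 \<in> {a..b}" "\<And>s. s \<in> {a..b} \<Longrightarrow> weight s \<le> weight s0"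
    using continuous_attains_sup[OF _ _ weight_continuous] ab by auto
  then show thesis using that[of "weight s0"] weight_ge[of s0] \<beta> by simp
qed

text \<open>Assumption A bounds the local error by the error coefficient, which near \<open>z\<close> is itself bounded in
terms of the weight.\<close>

lemma method_coeffs_follow_weight:
  fixes \<phi> :: "'d ivp_method"
  assumes A: "assumption_A 2 \<beta> r a b (z a) lseq K k0 \<phi>" and f: "f \<in> F_class r a b (z a)"
    and l: "antimono lseq" "lseq \<longlonglongrightarrow> 0"
  shows "coeffs_follow_weight \<phi> (\<lambda>m x. weak_mesh a b m x \<and> admissible lseq (K f) (k0 f) m x)"
proof -
  obtain dA where dA: "0 < dA"
    "\<And>m x i t. weak_mesh a b m x \<Longrightarrow> admissible lseq (K f) (k0 f) m x \<Longrightarrow>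
      (\<And>i. i < m \<Longrightarrow> x (Suc i) - x i \<le> dA) \<Longrightarrow> i < m \<Longrightarrow> x i < x (Suc i) \<Longrightarrow>
      t \<in> {x i..x (Suc i)} \<Longrightarrow>
      ereal (infnorm (local_solution \<phi> f (z a) x i t - local_approx \<phi> f (z a) x i t))
        \<le> local_bound 2 \<beta> r \<phi> f (z a) x i"
    by (rule assumption_A_weak_mesh[OF A f ab l]) blast
  obtain d1 where d1: "0 < d1"
    "\<And>u v y. a \<le> u \<Longrightarrow> u < v \<Longrightarrow> v \<le> b \<Longrightarrow> v - u \<le> d1 \<Longrightarrow> norm (y - z u) \<le> d1 \<Longrightarrow>
      \<exists>c. error_coeff 2 \<beta> r {u..v} (ivp_solution f u v y) = ereal c \<and> (\<forall>s\<in>{u..v}. \<bar>c - 2 * weight s\<bar> \<le> 1)"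
    by (rule error_coeff_close[OF zero_less_one]) blast
  obtain W where W: "0 \<le> W" "\<And>s. s \<in> {a..b} \<Longrightarrow> weight s \<le> W" by (rule weight_bounded) blast
  define n where "n = sqrt (real DIM(real ^ 'd))"
  define d where "d = min dA d1"
  have d: "0 < d" "d \<le> dA" "d \<le> d1" using dA(1) d1(1) by (auto simp: d_def)
  have n: "0 \<le> n" by (simp add: n_def)
  then have C: "0 \<le> n * (2 * W + 1)" using W by simp
  show ?thesis
  proof (rule coeffs_follow_weightI[OF C d(1)])
    fix m x i
    assume x: "fine_steps d m x" and P: "weak_mesh a b m x \<and> admissible lseq (K f) (k0 f) m x"
      and i: "i < m" "x i < x (Suc i)" "a \<le> x i"
      and near: "norm (node_value \<phi> f (z a) x i - z (x i)) \<le> d"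
    let ?h = "x (Suc i) - x i"
    let ?w = "local_solution \<phi> f (z a) x i" and ?l = "local_approx \<phi> f (z a) x i"
    have xi: "x (Suc i) \<le> b" "?h \<le> d" using x i by (auto simp: fine_steps_def)
    have steps: "x (Suc j) - x j \<le> dA" if "j < m" for j
      using fine_steps_mono[OF x d(2)] that by (simp add: fine_steps_def)
    obtain c where c: "error_coeff 2 \<beta> r {x i..x (Suc i)} ?w = ereal c" "\<bar>c - 2 * weight (x i)\<bar> \<le> 1"
      using d1(2)[of "x i" "x (Suc i)" "node_value \<phi> f (z a) x i"] i xi near d
      unfolding local_solution_def by auto
    have "ereal (infnorm (?w (x (Suc i)) - ?l (x (Suc i)))) \<le> local_bound 2 \<beta> r \<phi> f (z a) x i"
      using P i by (intro dA(2) steps) auto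
    also have "\<dots> = ereal (c * ?h ^ (r + 1))" using i c by (simp add: local_bound_def)
    finally have "infnorm (?w (x (Suc i)) - ?l (x (Suc i))) \<le> c * ?h ^ (r + 1)" by simp
    also have "\<dots> \<le> (2 * W + 1) * ?h ^ (r + 1)"
      using c(2) W(2)[of "x i"] i xi by (intro mult_right_mono) auto
    finally have "n * infnorm (?w (x (Suc i)) - ?l (x (Suc i))) \<le> n * ((2 * W + 1) * ?h ^ (r + 1))"
      using n by (rule mult_left_mono)
    moreover have "norm (?l (x (Suc i)) - ?w (x (Suc i))) \<le> n * infnorm (?w (x (Suc i)) - ?l (x (Suc i)))"
      unfolding n_def by (subst norm_minus_commute) (rule norm_le_infnorm)
    ultimately show "norm (?l (x (Suc i)) - ?w (x (Suc i))) \<le> n * (2 * W + 1) * ?h ^ (r + 1)"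
      unfolding mult.assoc by (rule order_trans[rotated])
  qed
qed

end

lemma local_bound_step:
  assumes "x i < x (Suc i)" and "local_bound 2 \<beta> r \<phi> f \<eta> x i \<le> ereal e"
  shows "2 * \<beta> * (x (Suc i) - x i) ^ (r + 1) \<le> e"
proof -
  have "ereal (2 * \<beta>) * ereal ((x (Suc i) - x i) ^ (r + 1)) \<le> local_bound 2 \<beta> r \<phi> f \<eta> x i"
    unfolding local_bound_def using assms(1)
    by (simp only: if_False less_imp_neq[OF assms(1)])
       (intro ereal_mult_right_mono error_coeff_ge, auto)
  then have "ereal (2 * \<beta> * (x (Suc i) - x i) ^ (r + 1)) \<le> ereal e"
    using assms(2) by (metis order_trans times_ereal.simps(1))
  then show ?thesis by simp
qed

text \<open>The infimum that defines \<open>k_hat\<close> need not be attained, so a mesh is obtained only for tolerances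
strictly above it. The factors lost in this way are absorbed by the constants in the theorem.\<close>

lemma k_hat_lessD:
  assumes "k_hat \<beta>' \<beta> r a b \<eta> lseq K k0 \<phi> f m < ereal e"
  obtains x where "weak_mesh a b m x" "admissible lseq K k0 m x"
    "\<And>i. i < m \<Longrightarrow> local_bound \<beta>' \<beta> r \<phi> f \<eta> x i \<le> ereal e"
proof -
  obtain x where x: "weak_mesh a b m x" "admissible lseq K k0 m x"
    "Max (local_bound \<beta>' \<beta> r \<phi> f \<eta> x ` {..<m}) < ereal e"
    using assms unfolding k_hat_def Inf_less_iff by blast
  have "local_bound \<beta>' \<beta> r \<phi> f \<eta> x i \<le> ereal e" if "i < m" for i
    using x(3) that Max_ge[of "local_bound \<beta>' \<beta> r \<phi> f \<eta> x ` {..<m}"]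
    by (meson finite_imageI finite_lessThan imageI lessThan_iff less_imp_le order_trans)
  with x(1,2) show thesis by (rule that)
qed

lemma k_hat_leI:
  assumes "a < b" "weak_mesh a b m x" "admissible lseq K k0 m x"
    "\<And>i. i < m \<Longrightarrow> local_bound \<beta>' \<beta> r \<phi> f \<eta> x i \<le> e"
  shows "k_hat \<beta>' \<beta> r a b \<eta> lseq K k0 \<phi> f m \<le> e"
proof -
  have "m \<noteq> 0" using assms(1,2) by (cases m) (auto simp: weak_mesh_def)
  then have "Max (local_bound \<beta>' \<beta> r \<phi> f \<eta> x ` {..<m}) \<le> e"
    using assms(4) by (subst Max_le_iff) auto
  then show ?thesis unfolding k_hat_def using assms(2,3) by (intro Inf_lower2) auto
qed

lemma m_hat_leI: "k_hat \<beta>' \<beta> r a b \<eta> lseq K k0 \<phi> f m \<le> ereal e \<Longrightarrow>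
    m_hat \<beta>' \<beta> r a b \<eta> lseq K k0 \<phi> f e \<le> enat m"
  unfolding m_hat_def by (intro Inf_lower) auto

lemma m_hat_geI: "(\<And>m. k_hat \<beta>' \<beta> r a b \<eta> lseq K k0 \<phi> f m \<le> ereal e \<Longrightarrow> M \<le> enat m) \<Longrightarrow>
    M \<le> m_hat \<beta>' \<beta> r a b \<eta> lseq K k0 \<phi> f e"
  unfolding m_hat_def by (intro Inf_greatest) auto

context weighted_ivp begin

text \<open>Because error coefficients are at least \<open>2 \<beta>\<close>, small local bounds force small subintervals.\<close>

lemma fine_steps_of_bounds:
  assumes "weak_mesh a b m x" and "\<And>i. i < m \<Longrightarrow> local_bound 2 \<beta> r \<phi> f \<eta> x i \<le> ereal e"
    and "0 < d" "e \<le> 2 * \<beta> * d ^ (r + 1)"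
  shows "fine_steps d m x"
proof -
  have "x (Suc i) - x i \<le> d" if "i < m" for i
  proof (cases "x i < x (Suc i)")
    case True
    have "2 * \<beta> * (x (Suc i) - x i) ^ (r + 1) \<le> 2 * \<beta> * d ^ (r + 1)"
      using local_bound_step[OF True assms(2)[OF that]] assms(4) by linarith
    then have "(x (Suc i) - x i) ^ (r + 1) \<le> d ^ (r + 1)"
      using \<beta> by (subst (asm) mult_le_cancel_left_pos) auto
    then show ?thesis using True \<open>0 < d\<close> by (subst (asm) power_mono_iff) auto
  qed (use \<open>0 < d\<close> in simp)
  then show ?thesis using weak_mesh_step[OF assms(1)] assms(1) by (auto simp: fine_steps_def weak_mesh_def)
qed

text \<open>The slack \<open>p\<close> is split into two equal factors: one pays for passing from the infimum to a mesh, the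
other one for the ratio of the error coefficients of the two methods on that mesh.\<close>

lemma k_hat_compare:
  assumes \<phi>1: "coeffs_follow_weight \<phi>1 (\<lambda>m x. weak_mesh a b m x \<and> admissible lseq K k0 m x)"
    and \<phi>2: "coeffs_follow_weight \<phi>2 (\<lambda>m x. weak_mesh a b m x \<and> admissible lseq K k0 m x)"
    and p: "1 < p"
  shows "\<forall>\<^sub>F \<epsilon> in at_right 0. \<forall>m. k_hat 2 \<beta> r a b (z a) lseq K k0 \<phi>2 f m \<le> ereal \<epsilon> \<longrightarrow>
      k_hat 2 \<beta> r a b (z a) lseq K k0 \<phi>1 f m \<le> ereal (p * \<epsilon>)"
proof -
  define q where "q = sqrt p"
  have q: "1 < q" "q * q = p" using p by (auto simp: q_def)
  define e where "e = (q - 1) * \<beta>"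
  have e: "0 < e" using q \<beta> by (simp add: e_def)
  obtain d1 where d1: "0 < d1" "\<And>m x i. fine_steps d1 m x \<Longrightarrow> weak_mesh a b m x \<Longrightarrow> admissible lseq K k0 m x \<Longrightarrow>
      i < m \<Longrightarrow> x i < x (Suc i) \<Longrightarrow>
      \<exists>c. error_coeff 2 \<beta> r {x i..x (Suc i)} (local_solution \<phi>1 f (z a) x i) = ereal c \<and>
              (\<forall>s\<in>{x i..x (Suc i)}. \<bar>c - 2 * weight s\<bar> \<le> e)"
    using \<phi>1[unfolded coeffs_follow_weight_def, rule_format, OF e] by blast
  obtain d2 where d2: "0 < d2" "\<And>m x i. fine_steps d2 m x \<Longrightarrow> weak_mesh a b m x \<Longrightarrow> admissible lseq K k0 m x \<Longrightarrow>
      i < m \<Longrightarrow> x i < x (Suc i) \<Longrightarrow>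
      \<exists>c. error_coeff 2 \<beta> r {x i..x (Suc i)} (local_solution \<phi>2 f (z a) x i) = ereal c \<and>
              (\<forall>s\<in>{x i..x (Suc i)}. \<bar>c - 2 * weight s\<bar> \<le> e)"
    using \<phi>2[unfolded coeffs_follow_weight_def, rule_format, OF e] by blast
  define d where "d = min d1 d2"
  have d: "0 < d" "d \<le> d1" "d \<le> d2" using d1(1) d2(1) by (auto simp: d_def)
  have "k_hat 2 \<beta> r a b (z a) lseq K k0 \<phi>1 f m \<le> ereal (p * \<epsilon>)"
    if \<epsilon>: "0 < \<epsilon>" "\<epsilon> < 2 * \<beta> * d ^ (r + 1) / q" and k: "k_hat 2 \<beta> r a b (z a) lseq K k0 \<phi>2 f m \<le> ereal \<epsilon>"
    for \<epsilon> m
  proof -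
    have "ereal \<epsilon> < ereal (q * \<epsilon>)" using q \<epsilon> by simp
    with k have "k_hat 2 \<beta> r a b (z a) lseq K k0 \<phi>2 f m < ereal (q * \<epsilon>)" by (rule order_le_less_trans)
    then obtain x where x: "weak_mesh a b m x" "admissible lseq K k0 m x"
      "\<And>i. i < m \<Longrightarrow> local_bound 2 \<beta> r \<phi>2 f (z a) x i \<le> ereal (q * \<epsilon>)"
      by (rule k_hat_lessD) blast
    have fine: "fine_steps d m x"
      using \<epsilon> q d by (intro fine_steps_of_bounds[OF x(1,3)]) (auto simp: field_simps)
    show ?thesis
    proof (rule k_hat_leI[OF ab x(1,2)])
      fix i assume i: "i < m"
      show "local_bound 2 \<beta> r \<phi>1 f (z a) x i \<le> ereal (p * \<epsilon>)"
      proof (cases "x i < x (Suc i)")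
        case True
        obtain c1 where c1: "error_coeff 2 \<beta> r {x i..x (Suc i)} (local_solution \<phi>1 f (z a) x i) = ereal c1"
            "\<forall>s\<in>{x i..x (Suc i)}. \<bar>c1 - 2 * weight s\<bar> \<le> e"
          using d1(2)[OF fine_steps_mono[OF fine d(2)] x(1,2) i True] by blast
        obtain c2 where c2: "error_coeff 2 \<beta> r {x i..x (Suc i)} (local_solution \<phi>2 f (z a) x i) = ereal c2"
            "\<forall>s\<in>{x i..x (Suc i)}. \<bar>c2 - 2 * weight s\<bar> \<le> e"
          using d2(2)[OF fine_steps_mono[OF fine d(3)] x(1,2) i True] by blast
        have "2 * \<beta> \<le> c2"
          using error_coeff_ge[of "{x i..x (Suc i)}" \<beta> r "local_solution \<phi>2 f (z a) x i"] c2(1) True by simp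
        then have "(q - 1) * (2 * \<beta>) \<le> (q - 1) * c2" using q by (intro mult_left_mono) auto
        moreover have "c1 \<le> c2 + 2 * e"
        proof -
          have "x i \<in> {x i..x (Suc i)}" using True by simp
          from bspec[OF c1(2) this] bspec[OF c2(2) this] show ?thesis by linarith
        qed
        ultimately have "c1 \<le> q * c2" by (simp add: e_def algebra_simps)
        then have "c1 * (x (Suc i) - x i) ^ (r + 1) \<le> (q * c2) * (x (Suc i) - x i) ^ (r + 1)"
          using True by (intro mult_right_mono) auto
        also have "\<dots> = q * (c2 * (x (Suc i) - x i) ^ (r + 1))" by simp
        also have "c2 * (x (Suc i) - x i) ^ (r + 1) \<le> q * \<epsilon>"
          using x(3)[OF i] True c2(1) by (simp add: local_bound_def)
        then have "q * (c2 * (x (Suc i) - x i) ^ (r + 1)) \<le> q * (q * \<epsilon>)"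
          using q by (intro mult_left_mono) auto
        also have "q * (q * \<epsilon>) = p * \<epsilon>" using q(2) by simp
        finally show ?thesis using True c1(1) by (simp add: local_bound_def)
      next
        case False
        then have "x i = x (Suc i)" using weak_mesh_step(1)[OF x(1) i] by simp
        then show ?thesis using \<epsilon> p by (simp add: local_bound_def)
      qed
    qed
  qed
  moreover have "0 < 2 * \<beta> * d ^ (r + 1) / q" using \<beta> d q by simp
  ultimately show ?thesis unfolding eventually_at_right_field by blast
qed

end

section \<open>Adaptively generated meshes\<close>

text \<open>The part of \<open>G\<^sub>i\<close> that estimates the weight; \<open>G\<^sub>i\<close> itself is \<open>8 / 3 * (1 + \<theta>)\<close> times this value.\<close>

definition step_control ::
    "nat \<Rightarrow> real \<Rightarrow> real \<Rightarrow> real \<Rightarrow> ('d::finite) rhs \<Rightarrow> real \<Rightarrow> real ^ 'd \<Rightarrow> real" where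
  "step_control r b \<beta> hbar f u y =
     (let t = (\<lambda>k. u + real k * ((u + min hbar (b - u) - u) / real r))
      in infnorm (divided_difference r t (\<lambda>s. f s (iterate f r t u y (r + 1) s)) 0) + \<beta>)"

lemma step_control_ge: "\<beta> \<le> step_control r b \<beta> hbar f u y"
  by (simp add: step_control_def Let_def infnorm_pos_le)

lemma powr_root_power:
  assumes "0 \<le> (c::real)"
  shows "(c powr (1 / real (r + 1))) ^ (r + 1) = c"
  using root_powr_inverse[of "r + 1" c] real_root_pow_pos2[of "r + 1" c] assms by auto

lemma power_powr_root:
  assumes "0 \<le> (c::real)"
  shows "(c ^ (r + 1)) powr (1 / real (r + 1)) = c"
  using root_powr_inverse[of "r + 1" "c ^ (r + 1)"] real_root_power_cancel[of "r + 1" c] assms by auto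

lemma adapt_step_stop: "\<not> x < b \<Longrightarrow> adapt_step r b \<beta> \<theta> hbar \<epsilon> f (x, y) = (x, y)"
  by (simp add: adapt_step_def)

lemma adapt_step_advance:
  assumes "x < b" "0 < \<beta>" "0 < \<theta>" "0 < \<epsilon>"
    and step: "adapt_step r b \<beta> \<theta> hbar \<epsilon> f (x, y) = (x', y')"
  shows "x < x'" "x' \<le> b"
    and "8 / 3 * (1 + \<theta>) * step_control r b \<beta> hbar f x y * (x' - x) ^ (r + 1) \<le> \<epsilon>"
    and "x' < b \<Longrightarrow> 8 / 3 * (1 + \<theta>) * step_control r b \<beta> hbar f x y * (x' - x) ^ (r + 1) = \<epsilon>"
    and "y' = approx (phi_star r) f [(x, y)] x' x'"
proof -
  define G where "G = 8 / 3 * step_control r b \<beta> hbar f x y * (1 + \<theta>)"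
  have G_eq: "8 / 3 * (1 + \<theta>) * step_control r b \<beta> hbar f x y = G" by (simp add: G_def)
  have G: "0 < G" unfolding G_def
    using step_control_ge[of \<beta> r b hbar f x y] assms by (intro mult_pos_pos) auto
  define s where "s = (\<epsilon> / G) powr (1 / real (r + 1))"
  have s: "0 < s" using G assms by (simp add: s_def)
  have "s ^ (r + 1) = \<epsilon> / G" unfolding s_def using G assms by (intro powr_root_power) auto
  then have Gs: "G * s ^ (r + 1) = \<epsilon>" using G by (simp del: power_Suc)
  have x': "x' = x + min s (b - x)" and y': "y' = approx (phi_star r) f [(x, y)] x' x'"
    using step assms(1) by (auto simp: adapt_step_def Let_def s_def G_def step_control_def)
  show "x < x'" "x' \<le> b" using s assms(1) by (auto simp: x')
  have "G * (x' - x) ^ (r + 1) \<le> G * s ^ (r + 1)"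
    using G s assms(1) by (intro mult_left_mono power_mono) (auto simp: x')
  then show "8 / 3 * (1 + \<theta>) * step_control r b \<beta> hbar f x y * (x' - x) ^ (r + 1) \<le> \<epsilon>"
    unfolding Gs G_eq .
  show "8 / 3 * (1 + \<theta>) * step_control r b \<beta> hbar f x y * (x' - x) ^ (r + 1) = \<epsilon>" if "x' < b"
  proof -
    have "x' - x = s" using that by (auto simp: x' min_def split: if_splits)
    then show ?thesis using Gs unfolding G_eq by simp
  qed
  show "y' = approx (phi_star r) f [(x, y)] x' x'" by (rule y')
qed

lemma adapt_mesh_0: "adapt_mesh r a b \<eta> \<beta> \<theta> h f \<epsilon> 0 = a"
  by (simp add: adapt_mesh_def)

text \<open>The values that the algorithm carries along are the node values of \<open>\<phi>\<^sup>*\<close> on the mesh it produces,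
so that the estimates for \<open>\<phi>\<^sup>*\<close> apply.\<close>

lemma adapt_mesh_Suc:
  fixes f :: "('d::finite) rhs" and \<eta> :: "real ^ 'd" and a b \<beta> \<theta> \<epsilon> :: real and r :: nat
    and h :: "real \<Rightarrow> real"
  assumes "0 < \<beta>" "0 < \<theta>" "0 < \<epsilon>"
  defines "X \<equiv> adapt_mesh r a b \<eta> \<beta> \<theta> h f \<epsilon>"
  shows "X i < b \<Longrightarrow> X i < X (Suc i) \<and> X (Suc i) \<le> b \<and>
      8 / 3 * (1 + \<theta>) * step_control r b \<beta> (h \<epsilon>) f (X i) (node_value (phi_star r) f \<eta> X i) *
        (X (Suc i) - X i) ^ (r + 1) \<le> \<epsilon> \<and>
      (X (Suc i) < b \<longrightarrow>
        8 / 3 * (1 + \<theta>) * step_control r b \<beta> (h \<epsilon>) f (X i) (node_value (phi_star r) f \<eta> X i) *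
        (X (Suc i) - X i) ^ (r + 1) = \<epsilon>)"
    and "\<not> X i < b \<Longrightarrow> X (Suc i) = X i"
proof -
  define Z where "Z = (\<lambda>i. (adapt_step r b \<beta> \<theta> (h \<epsilon>) \<epsilon> f ^^ i) (a, \<eta>))"
  have X: "X i = fst (Z i)" for i by (simp add: X_def Z_def adapt_mesh_def)
  have Z: "adapt_step r b \<beta> \<theta> (h \<epsilon>) \<epsilon> f (X i, snd (Z i)) = (X (Suc i), snd (Z (Suc i)))" for i
    by (simp add: X) (simp add: Z_def)
  have stop: "X (Suc i) = X i \<and> snd (Z (Suc i)) = snd (Z i)" if "\<not> X i < b" for i
    using Z[of i] adapt_step_stop[OF that, where f = f] by simp
  note adv = adapt_step_advance[OF _ assms(1-3) Z]
  have node: "node_value (phi_star r) f \<eta> X i = snd (Z i)" for i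
  proof (induction i)
    case 0
    then show ?case by (simp add: node_value_0 Z_def)
  next
    case (Suc i)
    show ?case
    proof (cases "X i < b")
      case True
      then show ?thesis
        using adv(1)[OF True] adv(5)[OF True] Suc
        by (simp add: node_value_Suc local_approx_phi_star) (simp add: phi_star_def)
    next
      case False
      then show ?thesis using stop[OF False] Suc by (simp add: node_value_Suc)
    qed
  qed
  show "X i < b \<Longrightarrow> X i < X (Suc i) \<and> X (Suc i) \<le> b \<and>
      8 / 3 * (1 + \<theta>) * step_control r b \<beta> (h \<epsilon>) f (X i) (node_value (phi_star r) f \<eta> X i) *
        (X (Suc i) - X i) ^ (r + 1) \<le> \<epsilon> \<and>
      (X (Suc i) < b \<longrightarrow>
        8 / 3 * (1 + \<theta>) * step_control r b \<beta> (h \<epsilon>) f (X i) (node_value (phi_star r) f \<eta> X i) *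
        (X (Suc i) - X i) ^ (r + 1) = \<epsilon>)"
    unfolding node using adv(1-4) by blast
  show "\<not> X i < b \<Longrightarrow> X (Suc i) = X i" using stop by blast
qed

context weighted_ivp begin

text \<open>All that is used about the output of the algorithm: up to \<open>e\<close>, step lengths are chosen by the weight,
with equality in the step length condition except for the last step, which is cut off at \<open>b\<close>.\<close>

definition balanced_mesh :: "real \<Rightarrow> real \<Rightarrow> real \<Rightarrow> nat \<Rightarrow> (nat \<Rightarrow> real) \<Rightarrow> bool" where
  "balanced_mesh e \<theta> \<epsilon> M X \<longleftrightarrow> weak_mesh a b M X \<and> (\<forall>i<M. X i < X (Suc i) \<and> X i < b \<and>
     (\<exists>g c. \<bar>g - weight (X i)\<bar> \<le> e \<and>
        error_coeff 2 \<beta> r {X i..X (Suc i)} (local_solution (phi_star r) f (z a) X i) = ereal c \<and>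
        (\<forall>s\<in>{X i..X (Suc i)}. \<bar>c - 2 * weight s\<bar> \<le> e) \<and>
        8 / 3 * (1 + \<theta>) * g * (X (Suc i) - X i) ^ (r + 1) \<le> \<epsilon> \<and>
        (Suc i < M \<longrightarrow> 8 / 3 * (1 + \<theta>) * g * (X (Suc i) - X i) ^ (r + 1) = \<epsilon>)))"

text \<open>Termination holds because the weight is bounded: unless \<open>b\<close> is reached, each step has at least a fixed
length.\<close>

lemma adapt_mesh_balanced:
  assumes e: "0 < e" and \<theta>: "0 < \<theta>"
    and h_pos: "\<forall>\<epsilon>\<in>{0<..<1}. 0 < h \<epsilon>" and h_lim: "(h \<longlongrightarrow> 0) (at_right 0)"
  shows "\<forall>\<^sub>F \<epsilon> in at_right 0. \<exists>M. m_star r a b (z a) \<beta> \<theta> h f \<epsilon> = enat M \<and>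
      balanced_mesh e \<theta> \<epsilon> M (adapt_mesh r a b (z a) \<beta> \<theta> h f \<epsilon>)"
proof -
  obtain d1 where d1: "0 < d1"
    "\<And>u v y t. a \<le> u \<Longrightarrow> u < v \<Longrightarrow> v \<le> b \<Longrightarrow> v - u \<le> d1 \<Longrightarrow> norm (y - z u) \<le> d1 \<Longrightarrow>
      t = (\<lambda>k. u + real k * ((v - u) / real r)) \<Longrightarrow>
      \<bar>infnorm (divided_difference r t (\<lambda>s. f s (iterate f r t u y (r + 1) s)) 0) + \<beta>
        - weight u\<bar> \<le> e"
    by (rule divided_difference_close[OF e]) blast
  define e' where "e' = min e d1"
  have e': "0 < e'" "e' \<le> e" "e' \<le> d1" using e d1(1) by (auto simp: e'_def)
  obtain d2 where d2: "0 < d2" "\<And>m x. fine_steps d2 m x \<Longrightarrow>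
     (\<forall>i<m. norm (node_value (phi_star r) f (z a) x i - z (x i)) \<le> e' \<and>
       (x i < x (Suc i) \<longrightarrow>
         (\<exists>c. error_coeff 2 \<beta> r {x i..x (Suc i)} (local_solution (phi_star r) f (z a) x i) = ereal c \<and>
              (\<forall>s\<in>{x i..x (Suc i)}. \<bar>c - 2 * weight s\<bar> \<le> e'))))"
    using phi_star_coeffs_follow_weight[of "\<lambda>m x. True", unfolded coeffs_follow_weight_def, rule_format, OF e'(1)] by auto
  obtain W where W: "0 \<le> W" "\<And>s. s \<in> {a..b} \<Longrightarrow> weight s \<le> W" by (rule weight_bounded) blast
  have "\<exists>M. m_star r a b (z a) \<beta> \<theta> h f \<epsilon> = enat M \<and>
      balanced_mesh e \<theta> \<epsilon> M (adapt_mesh r a b (z a) \<beta> \<theta> h f \<epsilon>)"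
    if \<epsilon>: "0 < \<epsilon>" "\<epsilon> < 1" "\<epsilon> < 8 / 3 * \<beta> * d2 ^ (r + 1)" and h: "h \<epsilon> < d1" for \<epsilon>
  proof -
    define X where "X = adapt_mesh r a b (z a) \<beta> \<theta> h f \<epsilon>"
    let ?y = "node_value (phi_star r) f (z a) X"
    define g where "g = (\<lambda>i. step_control r b \<beta> (h \<epsilon>) f (X i) (?y i))"
    have h0: "0 < h \<epsilon>" using h_pos \<epsilon> by auto
    have adv: "X i < X (Suc i)" "X (Suc i) \<le> b"
      "8 / 3 * (1 + \<theta>) * g i * (X (Suc i) - X i) ^ (r + 1) \<le> \<epsilon>"
      "X (Suc i) < b \<Longrightarrow> 8 / 3 * (1 + \<theta>) * g i * (X (Suc i) - X i) ^ (r + 1) = \<epsilon>" if "X i < b" for i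
      using adapt_mesh_Suc(1)[OF \<beta> \<theta> \<epsilon>(1), of r a b "z a" h f i] that unfolding X_def g_def by blast+
    have stop: "X (Suc i) = X i" if "\<not> X i < b" for i
      using adapt_mesh_Suc(2)[OF \<beta> \<theta> \<epsilon>(1), of r a b "z a" h f i] that unfolding X_def by blast
    have X0: "X 0 = a" by (simp add: X_def adapt_mesh_0)
    have X_le: "X i \<le> b" for i
      by (induction i) (use X0 ab adv(2) stop in \<open>auto, metis\<close>)
    have fine: "fine_steps d2 m X" for m
      unfolding fine_steps_def
    proof (intro conjI allI impI)
      fix i
      show "X i \<le> X (Suc i)" using adv(1)[of i] stop[of i] by (cases "X i < b") auto
      show "X (Suc i) - X i \<le> d2"
      proof (cases "X i < b")
        case True
        have "8 / 3 * \<beta> * (X (Suc i) - X i) ^ (r + 1) \<le> 8 / 3 * (1 + \<theta>) * g i * (X (Suc i) - X i) ^ (r + 1)"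
          using adv(1)[OF True] \<theta> \<beta> step_control_ge[of \<beta> r b "h \<epsilon>" f "X i" "?y i"]
          unfolding g_def by (intro mult_right_mono mult_mono) auto
        then have "8 / 3 * \<beta> * (X (Suc i) - X i) ^ (r + 1) \<le> 8 / 3 * \<beta> * d2 ^ (r + 1)"
          using adv(3)[OF True] \<epsilon>(3) by linarith
        then have "(X (Suc i) - X i) ^ (r + 1) \<le> d2 ^ (r + 1)"
          using \<beta> by (subst (asm) mult_le_cancel_left_pos) auto
        then show ?thesis using adv(1)[OF True] d2(1) by (subst (asm) power_mono_iff) auto
      qed (use stop d2 in simp)
    qed (use X0 X_le in auto)
    have node: "norm (?y i - z (X i)) \<le> e'" for i
      using d2(2)[OF fine[of "Suc i"]] by blast
    have coeff: "\<exists>c. error_coeff 2 \<beta> r {X i..X (Suc i)} (local_solution (phi_star r) f (z a) X i) = ereal c \<and>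
              (\<forall>s\<in>{X i..X (Suc i)}. \<bar>c - 2 * weight s\<bar> \<le> e')" if "X i < b" for i
      using d2(2)[OF fine[of "Suc i"]] adv(1)[OF that] by blast
    have X_ge: "a \<le> X i" for i using fine_steps_bounds(1)[OF fine[of i], of i] by simp
    have g: "\<bar>g i - weight (X i)\<bar> \<le> e" if "X i < b" for i
      unfolding g_def step_control_def Let_def
      using X_ge that h0 h node[of i] e' by (intro d1(2)[of _ "X i + min (h \<epsilon>) (b - X i)"]) auto
    have "\<exists>i. X i = b"
    proof (rule ccontr)
      assume "\<nexists>i. X i = b"
      then have lt: "X i < b" for i using X_le[of i] by (simp add: order_less_le)
      define D where "D = 8 / 3 * (1 + \<theta>) * (W + e)"
      have D: "0 < D" using \<theta> W e by (simp add: D_def)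
      \<comment> \<open>Since \<open>k \<le> 1\<close>, also \<open>k ^ (r + 1) \<le> k\<close>, so that no root has to be taken to see that
        \<open>k\<close> is a lower bound for the step length.\<close>
      define k where "k = min 1 (\<epsilon> / D)"
      have k: "0 < k" "k \<le> 1" "k \<le> \<epsilon> / D" using D \<epsilon> by (auto simp: k_def)
      have step: "k \<le> X (Suc i) - X i" for i
      proof -
        have "g i \<le> W + e" using g[OF lt[of i]] W(2)[of "X i"] X_ge[of i] X_le[of i] by auto
        then have "\<epsilon> \<le> D * (X (Suc i) - X i) ^ (r + 1)"
          unfolding adv(4)[OF lt lt, of i, symmetric] D_def
          using adv(1)[OF lt[of i]] \<theta> by (intro mult_right_mono mult_left_mono) auto
        then have "\<epsilon> / D \<le> (X (Suc i) - X i) ^ (r + 1)"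
          using D by (simp add: pos_divide_le_eq mult.commute)
        moreover have "k ^ (r + 1) \<le> k"
          using power_decreasing[of 1 "r + 1" k] k unfolding power_one_right by simp
        ultimately have "k ^ (r + 1) \<le> (X (Suc i) - X i) ^ (r + 1)"
          using k(3) by (meson order_trans)
        then show ?thesis using k adv(1)[OF lt[of i]] by (subst (asm) power_mono_iff) auto
      qed
      have "a + real n * k \<le> X n" for n
      proof (induction n)
        case (Suc n)
        then show ?case using step[of n] by (simp add: algebra_simps)
      qed (simp add: X0)
      moreover obtain n where "b - a < real n * k" using reals_Archimedean3[OF k(1)] by blast
      ultimately show False using X_le[of n] by (smt (verit))
    qed
    define M where "M = (LEAST i. X i = b)"
    have XM: "X M = b" unfolding M_def using \<open>\<exists>i. X i = b\<close> by (rule LeastI_ex)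
    have least: "M \<le> i" if "X i = b" for i unfolding M_def using that by (rule Least_le)
    have lt: "X i < b" if "i < M" for i using least[of i] X_le[of i] that by (auto simp: order_less_le)
    have "m_star r a b (z a) \<beta> \<theta> h f \<epsilon> = enat M"
      unfolding m_star_def X_def[symmetric] using XM least
      by (intro antisym Inf_lower Inf_greatest) auto
    moreover have "balanced_mesh e \<theta> \<epsilon> M X"
      unfolding balanced_mesh_def
    proof (intro conjI allI impI)
      show "weak_mesh a b M X"
        using X0 XM adv(1)[OF lt] by (auto simp: weak_mesh_def less_imp_le)
      fix i assume i: "i < M"
      show "X i < X (Suc i)" "X i < b" using adv(1) lt[OF i] by auto
      obtain c where c: "error_coeff 2 \<beta> r {X i..X (Suc i)} (local_solution (phi_star r) f (z a) X i) = ereal c"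
        "\<forall>s\<in>{X i..X (Suc i)}. \<bar>c - 2 * weight s\<bar> \<le> e'" using coeff[OF lt[OF i]] by blast
      then have "\<forall>s\<in>{X i..X (Suc i)}. \<bar>c - 2 * weight s\<bar> \<le> e" using e'(2) by fastforce
      then show "\<exists>g c. \<bar>g - weight (X i)\<bar> \<le> e \<and>
        error_coeff 2 \<beta> r {X i..X (Suc i)} (local_solution (phi_star r) f (z a) X i) = ereal c \<and>
        (\<forall>s\<in>{X i..X (Suc i)}. \<bar>c - 2 * weight s\<bar> \<le> e) \<and>
        8 / 3 * (1 + \<theta>) * g * (X (Suc i) - X i) ^ (r + 1) \<le> \<epsilon> \<and>
        (Suc i < M \<longrightarrow> 8 / 3 * (1 + \<theta>) * g * (X (Suc i) - X i) ^ (r + 1) = \<epsilon>)"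
        using c(1) g[OF lt[OF i]] adv(3)[OF lt[OF i]] adv(4)[OF lt[OF i] lt] by blast
    qed
    ultimately show ?thesis unfolding X_def by blast
  qed
  note main = this
  have small: "\<forall>\<^sub>F \<epsilon> in at_right 0. \<epsilon> < c" if "0 < c" for c :: real
    using that unfolding eventually_at_right_field by blast
  have "0 < 8 / 3 * \<beta> * d2 ^ (r + 1)" using \<beta> d2(1) by simp
  from eventually_at_right_less[of 0] small[OF zero_less_one] small[OF this] order_tendstoD(2)[OF h_lim d1(1)]
  show ?thesis by eventually_elim (rule main)
qed

section \<open>Counting subintervals by mass\<close>

definition mass :: "real \<Rightarrow> real" where
  "mass t = integral {a..t} (\<lambda>s. weight s powr (1 / real (r + 1)))"

text \<open>The exponent \<open>1 / (r + 1)\<close> turns the products \<open>k h\<^bsup>r + 1\<^esup>\<close>, which have the form of local error bounds,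
into an additive quantity.\<close>

lemma mass_increment:
  assumes "a \<le> u" "u \<le> v" "v \<le> b"
  shows "(\<forall>s\<in>{u..v}. weight s \<le> k) \<Longrightarrow> mass v - mass u \<le> (k * (v - u) ^ (r + 1)) powr (1 / real (r + 1))"
    and "0 \<le> k \<Longrightarrow> (\<forall>s\<in>{u..v}. k \<le> weight s) \<Longrightarrow> (k * (v - u) ^ (r + 1)) powr (1 / real (r + 1)) \<le> mass v - mass u"
proof -
  let ?q = "1 / real (r + 1)"
  let ?w = "\<lambda>s. weight s powr ?q"
  have "weight s \<noteq> 0" for s using weight_ge[of s] \<beta> by simp
  then have cont: "continuous_on {a..b} ?w"
    by (intro continuous_on_powr weight_continuous continuous_on_const) auto
  have int: "?w integrable_on {c..d}" if "a \<le> c" "d \<le> b" for c d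
    using that by (intro integrable_continuous_real continuous_on_subset[OF cont]) auto
  have "mass u + integral {u..v} ?w = mass v"
    unfolding mass_def using Henstock_Kurzweil_Integration.integral_combine[OF assms(1,2) int[OF order_refl assms(3)]] .
  then have eq: "mass v - mass u = integral {u..v} ?w" by simp
  have scale: "k powr ?q * (v - u) = (k * (v - u) ^ (r + 1)) powr ?q" if "0 \<le> k" for k
  proof -
    have "((v - u) ^ (r + 1)) powr ?q = v - u" using assms by (intro power_powr_root) simp
    moreover have "(k * (v - u) ^ (r + 1)) powr ?q = k powr ?q * ((v - u) ^ (r + 1)) powr ?q"
      by (rule powr_mult)
    ultimately show ?thesis by simp
  qed
  show "mass v - mass u \<le> (k * (v - u) ^ (r + 1)) powr ?q" if k: "\<forall>s\<in>{u..v}. weight s \<le> k"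
  proof -
    have "0 \<le> k" using bspec[OF k, of u] weight_ge[of u] \<beta> assms by auto
    have "integral {u..v} ?w \<le> integral {u..v} (\<lambda>s. k powr ?q)"
    proof (rule integral_le)
      fix s assume "s \<in> {u..v}"
      then show "?w s \<le> k powr ?q" using k weight_ge[of s] \<beta> by (intro powr_mono2) auto
    qed (use assms int in auto)
    also have "\<dots> = k powr ?q * (v - u)" using assms by simp
    finally show ?thesis using eq scale[OF \<open>0 \<le> k\<close>] by simp
  qed
  show "(k * (v - u) ^ (r + 1)) powr ?q \<le> mass v - mass u" if "0 \<le> k" and k: "\<forall>s\<in>{u..v}. k \<le> weight s"
  proof -
    have "k powr ?q * (v - u) = integral {u..v} (\<lambda>s. k powr ?q)" using assms by simp
    also have "\<dots> \<le> integral {u..v} ?w"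
    proof (rule integral_le)
      fix s assume "s \<in> {u..v}"
      then show "k powr ?q \<le> ?w s" using k \<open>0 \<le> k\<close> by (intro powr_mono2) auto
    qed (use assms int in auto)
    finally show ?thesis using eq scale[OF \<open>0 \<le> k\<close>] by simp
  qed
qed

lemma mass_le_count:
  assumes x: "weak_mesh a b m x" and B: "0 \<le> B"
    and k: "\<And>i. i < m \<Longrightarrow> x i < x (Suc i) \<Longrightarrow>
      \<exists>k. (\<forall>s\<in>{x i..x (Suc i)}. weight s \<le> k) \<and> k * (x (Suc i) - x i) ^ (r + 1) \<le> B"
  shows "mass b \<le> real m * B powr (1 / real (r + 1))"
proof -
  have "mass (x (Suc i)) - mass (x i) \<le> B powr (1 / real (r + 1))" if i: "i < m" for i
  proof (cases "x i < x (Suc i)")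
    case True
    obtain k where k: "\<forall>s\<in>{x i..x (Suc i)}. weight s \<le> k" "k * (x (Suc i) - x i) ^ (r + 1) \<le> B"
      using k[OF i True] by blast
    have "0 \<le> k" using bspec[OF k(1), of "x i"] weight_ge[of "x i"] \<beta> True by simp
    then show ?thesis
      using weak_mesh_step[OF x i] k(2) True
      by (intro order_trans[OF mass_increment(1)[OF _ _ _ k(1)] powr_mono2]) auto
  next
    case False
    then have "x i = x (Suc i)" using weak_mesh_step(1)[OF x i] by simp
    then show ?thesis by simp
  qed
  then have "(\<Sum>i<m. mass (x (Suc i)) - mass (x i)) \<le> real m * B powr (1 / real (r + 1))"
    using sum_bounded_above[of "{..<m}" "\<lambda>i. mass (x (Suc i)) - mass (x i)" "B powr (1 / real (r + 1))"] by simp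
  moreover have "(\<Sum>i<m. mass (x (Suc i)) - mass (x i)) = mass b - mass a"
    using x sum_lessThan_telescope[of "\<lambda>i. mass (x i)" m] by (simp add: weak_mesh_def)
  ultimately show ?thesis by (simp add: mass_def)
qed

text \<open>The last subinterval enters only through its positive mass. This makes the inequality strict, which
later compensates for the unknown length of the last step.\<close>

lemma count_less_mass:
  assumes x: "weak_mesh a b (Suc n) x" "x n < b" and A: "0 \<le> A"
    and k: "\<And>i. i < n \<Longrightarrow> \<exists>k\<ge>0. (\<forall>s\<in>{x i..x (Suc i)}. k \<le> weight s) \<and> A \<le> k * (x (Suc i) - x i) ^ (r + 1)"
  shows "real n * A powr (1 / real (r + 1)) < mass b"
proof -
  have "A powr (1 / real (r + 1)) \<le> mass (x (Suc i)) - mass (x i)" if i: "i < n" for i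
  proof -
    obtain k where k: "0 \<le> k" "\<forall>s\<in>{x i..x (Suc i)}. k \<le> weight s" "A \<le> k * (x (Suc i) - x i) ^ (r + 1)"
      using k[OF i] by blast
    have "i < Suc n" using i by simp
    then show ?thesis
      using weak_mesh_step[OF x(1), of i] A k(3)
      by (intro order_trans[OF powr_mono2 mass_increment(2)[OF _ _ _ k(1,2)]]) auto
  qed
  then have "real n * A powr (1 / real (r + 1)) \<le> (\<Sum>i<n. mass (x (Suc i)) - mass (x i))"
    using sum_bounded_below[of "{..<n}" "A powr (1 / real (r + 1))" "\<lambda>i. mass (x (Suc i)) - mass (x i)"] by simp
  also have "\<dots> = mass (x n)"
    using x sum_lessThan_telescope[of "\<lambda>i. mass (x i)" n] by (simp add: weak_mesh_def mass_def)
  also have "\<dots> < mass b"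
  proof -
    have "0 < (\<beta> * (b - x n) ^ (r + 1)) powr (1 / real (r + 1))" using \<beta> x(2) by simp
    also have "\<dots> \<le> mass b - mass (x n)"
      using weak_mesh_step[OF x(1), of n] x(2) weight_ge \<beta> by (intro mass_increment(2)) auto
    finally show ?thesis by simp
  qed
  finally show ?thesis .
qed

end

section \<open>Comparison of the numbers of subintervals\<close>

context weighted_ivp begin

text \<open>With \<open>e \<le> \<beta> / 6\<close> the coefficient \<open>c\<close> is at most \<open>13/6\<close> times the weight, while
\<open>8/3\<close> times the estimate \<open>g\<close> is at least \<open>20/9\<close> times the weight.\<close>

lemma balanced_mesh_bound:
  assumes X: "balanced_mesh e \<theta> \<epsilon> M X" and e: "e \<le> \<beta> / 6" and "0 < \<theta>" and i: "i < M"
  shows "local_bound 2 \<beta> r (phi_star r) f (z a) X i \<le> ereal \<epsilon>"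
proof -
  obtain g c where "X i < X (Suc i)" and g: "\<bar>g - weight (X i)\<bar> \<le> e"
    and c: "error_coeff 2 \<beta> r {X i..X (Suc i)} (local_solution (phi_star r) f (z a) X i) = ereal c"
      "\<forall>s\<in>{X i..X (Suc i)}. \<bar>c - 2 * weight s\<bar> \<le> e"
    and step: "8 / 3 * (1 + \<theta>) * g * (X (Suc i) - X i) ^ (r + 1) \<le> \<epsilon>"
    using X i unfolding balanced_mesh_def by blast
  have w: "\<beta> \<le> weight (X i)" by (rule weight_ge)
  have "0 \<le> g" using g e w \<beta> by linarith
  have "\<bar>c - 2 * weight (X i)\<bar> \<le> e" using c(2) \<open>X i < X (Suc i)\<close> by simp
  then have "c \<le> 8 / 3 * g" using g e w \<beta> by linarith
  also have "\<dots> \<le> 8 / 3 * (1 + \<theta>) * g"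
    using \<open>0 \<le> g\<close> \<open>0 < \<theta>\<close> by (intro mult_right_mono) auto
  finally have "c * (X (Suc i) - X i) ^ (r + 1) \<le> 8 / 3 * (1 + \<theta>) * g * (X (Suc i) - X i) ^ (r + 1)"
    using \<open>X i < X (Suc i)\<close> by (intro mult_right_mono) auto
  from order_trans[OF this step] show ?thesis
    using \<open>X i < X (Suc i)\<close> c(1) by (simp add: local_bound_def)
qed

text \<open>Each step of the algorithm but the last has mass at least \<open>A\<^bsup>1 / (r + 1)\<^esup>\<close>, each subinterval of \<open>x\<close> has
mass at most \<open>B\<^bsup>1 / (r + 1)\<^esup>\<close>, and \<open>B \<le> A\<close>. The total mass therefore leaves room for fewer than
\<open>m\<close> steps before the last one.\<close>

lemma balanced_mesh_count:
  assumes X: "balanced_mesh e \<theta> \<epsilon> M X" and e: "e = \<theta> / 6 * \<beta>" and \<theta>: "0 < \<theta>" "\<theta> < 1" and \<epsilon>: "0 < \<epsilon>"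
    and x: "weak_mesh a b m x"
    and c: "\<And>i. i < m \<Longrightarrow> x i < x (Suc i) \<Longrightarrow>
      \<exists>c. (\<forall>s\<in>{x i..x (Suc i)}. \<bar>c - 2 * weight s\<bar> \<le> e) \<and>
        c * (x (Suc i) - x i) ^ (r + 1) \<le> (1 + \<theta> / 3) * ((1 - \<theta>)\<^sup>2 / (2 * (1 + \<theta>)\<^sup>2) * \<epsilon>)"
  shows "M \<le> m"
proof -
  let ?q = "1 / real (r + 1)"
  \<comment> \<open>The choice \<open>\<delta> = \<theta> / 3\<close> satisfies \<open>(1 + \<delta>)\<^sup>2 \<le> 1 + \<theta>\<close>. The tolerance \<open>e\<close> is
    \<open>\<delta> \<beta> / 2\<close>: the lower estimate for the weight uses it twice, once for \<open>g\<close> and once for passing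
    from \<open>X i\<close> to \<open>s\<close>.\<close>
  define \<delta> where "\<delta> = \<theta> / 3"
  have \<delta>: "0 < \<delta>" "\<delta> < 1 / 3" using \<theta> by (auto simp: \<delta>_def)
  define A where "A = \<epsilon> / (8 / 3 * (1 + \<theta>) * (1 + \<delta>))"
  define B where "B = (1 + \<delta>) * ((1 - \<theta>)\<^sup>2 / (2 * (1 + \<theta>)\<^sup>2) * \<epsilon>) / (2 * (1 - \<delta>))"
  have A: "0 < A" using \<epsilon> \<theta> \<delta> by (simp add: A_def)
  have B: "0 \<le> B" using \<epsilon> \<theta> \<delta> by (simp add: B_def)
  have e2: "2 * e = \<delta> * \<beta>" by (simp add: e \<delta>_def)
  have "B \<le> A"
  proof -
    have \<delta>2: "(1 + \<delta>) * (1 + \<delta>) \<le> 1 + \<theta>"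
    proof -
      have "\<delta> * \<delta> \<le> \<delta> * 1" using \<delta> by (intro mult_left_mono) auto
      then show ?thesis by (simp add: \<delta>_def algebra_simps)
    qed
    have \<theta>2: "(1 - \<theta>)\<^sup>2 \<le> 1 - \<theta>"
      using \<theta> mult_left_mono[of "1 - \<theta>" 1 "1 - \<theta>"] by (simp add: power2_eq_square)
    have "(1 + \<delta>) * (1 - \<theta>)\<^sup>2 * (8 / 3 * (1 + \<theta>) * (1 + \<delta>))
        = 8 / 3 * (1 + \<theta>) * ((1 + \<delta>) * (1 + \<delta>)) * (1 - \<theta>)\<^sup>2" by simp
    also have "\<dots> \<le> 8 / 3 * (1 + \<theta>) * (1 + \<theta>) * (1 - \<theta>)"
      using \<delta>2 \<theta>2 \<theta> by (intro mult_mono mult_left_mono) auto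
    also have "\<dots> \<le> 8 / 3 * (1 + \<theta>) * (1 + \<theta>) * (3 / 2 * (1 - \<delta>))"
      using \<theta> by (intro mult_left_mono) (auto simp: \<delta>_def)
    also have "8 / 3 * t * t * (3 / 2 * s) = 2 * t\<^sup>2 * (2 * s)" for s t :: real
      by (simp add: power2_eq_square)
    finally have "(1 + \<delta>) * (1 - \<theta>)\<^sup>2 * (8 / 3 * (1 + \<theta>) * (1 + \<delta>)) \<le> 2 * (1 + \<theta>)\<^sup>2 * (2 * (1 - \<delta>))" .
    then have "(1 + \<delta>) * (1 - \<theta>)\<^sup>2 / (2 * (1 + \<theta>)\<^sup>2 * (2 * (1 - \<delta>))) \<le> 1 / (8 / 3 * (1 + \<theta>) * (1 + \<delta>))"
      using \<theta> \<delta> by (subst pos_divide_le_eq) (auto simp: pos_le_divide_eq mult.commute)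
    then have "\<epsilon> * ((1 + \<delta>) * (1 - \<theta>)\<^sup>2 / (2 * (1 + \<theta>)\<^sup>2 * (2 * (1 - \<delta>)))) \<le> \<epsilon> * (1 / (8 / 3 * (1 + \<theta>) * (1 + \<delta>)))"
      using \<epsilon> by (intro mult_left_mono) auto
    then show ?thesis by (simp add: A_def B_def mult_ac)
  qed
  have "mass b \<le> real m * B powr ?q"
  proof (rule mass_le_count[OF x B])
    fix i assume i: "i < m" "x i < x (Suc i)"
    obtain c where c: "\<forall>s\<in>{x i..x (Suc i)}. \<bar>c - 2 * weight s\<bar> \<le> e"
      "c * (x (Suc i) - x i) ^ (r + 1) \<le> (1 + \<delta>) * ((1 - \<theta>)\<^sup>2 / (2 * (1 + \<theta>)\<^sup>2) * \<epsilon>)"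
      using c[OF i] unfolding \<delta>_def by blast
    have "weight s \<le> c / (2 * (1 - \<delta>))" if "s \<in> {x i..x (Suc i)}" for s
    proof -
      have "\<delta> * \<beta> \<le> \<delta> * weight s" using \<delta> weight_ge by (intro mult_left_mono) auto
      moreover have "0 \<le> \<delta> * \<beta>" using \<delta> \<beta> by simp
      ultimately have "2 * weight s - 2 * (\<delta> * weight s) \<le> c"
        using bspec[OF c(1) that] e2 by linarith
      then have "2 * (1 - \<delta>) * weight s \<le> c" by (simp add: algebra_simps)
      then show ?thesis using \<delta> by (simp add: pos_le_divide_eq mult.commute)
    qed
    moreover have "c / (2 * (1 - \<delta>)) * (x (Suc i) - x i) ^ (r + 1) \<le> B"
      using divide_right_mono[OF c(2), of "2 * (1 - \<delta>)"] \<delta> by (simp add: B_def)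
    ultimately show "\<exists>k. (\<forall>s\<in>{x i..x (Suc i)}. weight s \<le> k) \<and> k * (x (Suc i) - x i) ^ (r + 1) \<le> B"
      by blast
  qed
  also have "\<dots> \<le> real m * A powr ?q"
    using \<open>B \<le> A\<close> B by (intro mult_left_mono powr_mono2) auto
  finally have upper: "mass b \<le> real m * A powr ?q" .
  show ?thesis
  proof (cases M)
    case (Suc n)
    have props: "X i < X (Suc i) \<and> X i < b \<and>
     (\<exists>g c. \<bar>g - weight (X i)\<bar> \<le> e \<and>
        (\<forall>s\<in>{X i..X (Suc i)}. \<bar>c - 2 * weight s\<bar> \<le> e) \<and>
        (Suc i < M \<longrightarrow> 8 / 3 * (1 + \<theta>) * g * (X (Suc i) - X i) ^ (r + 1) = \<epsilon>))" if "i < M" for i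
      using X that unfolding balanced_mesh_def by blast
    have "real n * A powr ?q < mass b"
    proof (rule count_less_mass)
      show "weak_mesh a b (Suc n) X" using X Suc by (simp add: balanced_mesh_def)
      show "X n < b" using props[of n] Suc by simp
      fix i assume i: "i < n"
      then obtain g c where "X i < X (Suc i)" and g: "\<bar>g - weight (X i)\<bar> \<le> e"
        and c: "\<forall>s\<in>{X i..X (Suc i)}. \<bar>c - 2 * weight s\<bar> \<le> e"
        and step: "8 / 3 * (1 + \<theta>) * g * (X (Suc i) - X i) ^ (r + 1) = \<epsilon>"
        using props[of i] Suc by auto
      have ci: "\<bar>c - 2 * weight (X i)\<bar> \<le> e" using c \<open>X i < X (Suc i)\<close> by simp
      have "g / (1 + \<delta>) \<le> weight s" if "s \<in> {X i..X (Suc i)}" for s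
      proof -
        have "\<delta> * \<beta> \<le> \<delta> * weight s" using \<delta> weight_ge by (intro mult_left_mono) auto
        moreover have "g \<le> weight s + \<delta> * \<beta>"
          using g ci bspec[OF c that] e2 by linarith
        ultimately have "g \<le> (1 + \<delta>) * weight s" by (simp add: algebra_simps)
        then show ?thesis using \<delta> by (simp add: pos_divide_le_eq mult.commute)
      qed
      moreover have "0 \<le> g / (1 + \<delta>)"
      proof -
        have "e \<le> 1 * \<beta>" unfolding e using \<theta> \<beta> by (intro mult_right_mono) auto
        then show ?thesis using g weight_ge[of "X i"] \<delta> by simp
      qed
      moreover have "A \<le> g / (1 + \<delta>) * (X (Suc i) - X i) ^ (r + 1)"
      proof -
        have "8 / 3 * t * g * P / (8 / 3 * t * s) = g / s * P" if "t \<noteq> 0" for t s P :: real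
          using that by simp
        from this[of "1 + \<theta>"] show ?thesis unfolding A_def step[symmetric] using \<theta> by simp
      qed
      ultimately show "\<exists>k\<ge>0. (\<forall>s\<in>{X i..X (Suc i)}. k \<le> weight s) \<and> A \<le> k * (X (Suc i) - X i) ^ (r + 1)"
        by blast
    qed (use A in simp)
    with upper have "real n * A powr ?q < real m * A powr ?q" by linarith
    then have "real n < real m" using A by simp
    then show ?thesis using Suc by simp
  qed simp
qed

end

text \<open>The set \<open>D\<close> in the definition of the class contains the unit neighbourhood of the solution in the
maximum norm, hence also the one in the Euclidean norm, which is the tube that the locale asks for.\<close>

lemma F_class_weighted_ivp:
  fixes f :: "('d::finite) rhs"
  assumes f: "f \<in> F_class r a b \<eta>" and "a < b" "1 \<le> r" "0 < \<beta>"
  obtains L z S G where "weighted_ivp f a b L r z S G \<beta>" "z a = \<eta>"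
proof -
  define z where "z = ivp_solution f a b \<eta>"
  define B where "B = (SUP t\<in>{a..b}. infnorm (z t)) + 1"
  define S where "S = {a..b} \<times> {y :: real ^ 'd. infnorm y \<le> B}"
  define n where "n = sqrt (real DIM(real ^ 'd))"
  have n: "0 \<le> n" by (simp add: n_def)
  have norm_le: "norm y \<le> n * infnorm y" for y :: "real ^ 'd"
    unfolding n_def by (rule norm_le_infnorm)
  from f obtain L0 where cont: "continuous_on ({a..b} \<times> UNIV) (\<lambda>(t, y). f t y)" and "0 \<le> L0"
    and L0: "\<forall>t\<in>{a..b}. \<forall>y y'. infnorm (f t y - f t y') \<le> L0 * infnorm (y - y')"
    and Ck: "C_k_on r S (\<lambda>(t, y). f t y)"
    unfolding F_class_def S_def B_def z_def by blast
  define L where "L = n * L0"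
  have "norm (f t y - f t y') \<le> L * norm (y - y')" if t: "t \<in> {a..b}" for t y y'
  proof -
    have "norm (f t y - f t y') \<le> n * infnorm (f t y - f t y')" by (rule norm_le)
    also have "\<dots> \<le> n * (L0 * norm (y - y'))"
    proof (rule mult_left_mono[OF _ n])
      have "infnorm (f t y - f t y') \<le> L0 * infnorm (y - y')" using L0 t by blast
      also have "\<dots> \<le> L0 * norm (y - y')" by (intro mult_left_mono infnorm_le_norm \<open>0 \<le> L0\<close>)
      finally show "infnorm (f t y - f t y') \<le> L0 * norm (y - y')" .
    qed
    finally show ?thesis by (simp add: L_def mult.assoc)
  qed
  then interpret lipschitz_rhs f a b L
    using n \<open>0 \<le> L0\<close> cont by unfold_locales (auto simp: L_def)
  have z: "solves_ivp f a b \<eta> z" unfolding z_def using \<open>a < b\<close> by (intro ivp_solution_solves) auto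
  then have za: "z a = \<eta>" by (simp add: solves_ivp_def)
  have "bounded {y :: real ^ 'd. infnorm y \<le> B}"
    unfolding bounded_iff
  proof (intro exI ballI)
    fix y :: "real ^ 'd" assume "y \<in> {y. infnorm y \<le> B}"
    then show "norm y \<le> n * B" using norm_le[of y] mult_left_mono[of "infnorm y" B n] n by simp
  qed
  moreover have "closed {y :: real ^ 'd. infnorm y \<le> B}"
    by (intro closed_Collect_le continuous_on_infnorm continuous_on_id continuous_on_const)
  ultimately have S_compact: "compact S"
    unfolding S_def by (intro compact_Times) (auto simp: compact_eq_bounded_closed)
  have "bdd_above ((\<lambda>t. infnorm (z t)) ` {a..b})"
    by (intro bounded_imp_bdd_above compact_imp_bounded compact_continuous_image continuous_on_infnorm
        solves_ivp_continuous[OF z]) auto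
  then have SUP: "infnorm (z t) + 1 \<le> B" if "t \<in> {a..b}" for t
    unfolding B_def using that by (intro add_right_mono cSUP_upper)
  have tube: "(t, y) \<in> S" if "t \<in> {a..b}" "norm (y - z t) \<le> 1" for t y
  proof -
    have "infnorm y \<le> infnorm (z t) + infnorm (y - z t)"
      using infnorm_triangle[of "z t" "y - z t"] by simp
    also have "\<dots> \<le> infnorm (z t) + 1" using that(2) infnorm_le_norm[of "y - z t"] by linarith
    finally show ?thesis using SUP[OF that(1)] that(1) by (simp add: S_def)
  qed
  obtain G where G: "G 0 = (\<lambda>(t, y). f t y)" "\<forall>j\<le>r. continuous_on S (G j)"
    "\<forall>j<r. \<forall>u v y z t. solves_ivp f u v y z \<longrightarrow> (\<forall>t\<in>{u..v}. (t, z t) \<in> S) \<longrightarrow> t \<in> {u..v} \<longrightarrow>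
      ((\<lambda>t. G j (t, z t)) has_vector_derivative G (Suc j) (t, z t)) (at t within {u..v})"
    using derivatives_along_flow_exist[OF Ck Ck] by blast
  have "weighted_ivp f a b L r z S G \<beta>"
    using assms(2-4) z za S_compact tube G by unfold_locales auto
  then show thesis using za by (rule that)
qed

theorem theorem3:
  fixes a b \<beta> \<theta> :: real and r :: nat and \<eta> :: "real ^ 'd::finite"
    and lseq :: "nat \<Rightarrow> real" and K :: "'d rhs \<Rightarrow> real" and k0 :: "'d rhs \<Rightarrow> nat"
    and h :: "real \<Rightarrow> real" and f :: "'d rhs" and \<phi> :: "'d ivp_method"
  assumes "a < b" and "1 \<le> r"
    and "antimono lseq" and "lseq \<longlonglongrightarrow> 0"
    and "0 < \<beta>" and "0 < \<theta>" and "\<theta> < 1"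
    and "\<forall>\<epsilon>\<in>{0<..<1}. 0 < h \<epsilon>"
    and "h \<in> O[at_right 0](\<lambda>\<epsilon>. \<epsilon> powr (1 / real (r + 1)))"
    and "f \<in> F_class r a b \<eta>"
    and "is_method (F_class r a b \<eta>) \<phi>" and "0 < evals \<phi>"
    and "assumption_A 2 \<beta> r a b \<eta> lseq K k0 \<phi>"
    and "\<forall>\<^sub>F \<epsilon> in at_right 0. \<forall>m. m_star r a b \<eta> \<beta> \<theta> h f \<epsilon> = enat m \<longrightarrow>
           admissible lseq (K f) (k0 f) m (adapt_mesh r a b \<eta> \<beta> \<theta> h f \<epsilon>)"
  defines "p1 \<equiv> (1 + \<theta>) / (1 - \<theta>)"
    and "p \<equiv> (1 - \<theta>)\<^sup>2 / (2 * (1 + \<theta>)\<^sup>2)"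
    and "mhat \<equiv> (\<lambda>\<psi>. m_hat 2 \<beta> r a b \<eta> lseq (K f) (k0 f) \<psi> f)"
    and "mstar \<equiv> m_star r a b \<eta> \<beta> \<theta> h f"
    and "\<kappa>ratio \<equiv> ereal (2 * real (evals (phi_star r :: 'd ivp_method)) / real (evals \<phi>))"
  shows "\<exists>\<epsilon>0\<in>{0<..<1}. \<forall>\<epsilon>. 0 < \<epsilon> \<and> \<epsilon> \<le> \<epsilon>0 \<longrightarrow>
           mstar \<epsilon> < \<infinity> \<and>
           mhat \<phi> (p1 * \<epsilon>) \<le> mhat (phi_star r) \<epsilon> \<and>
           mhat (phi_star r) \<epsilon> \<le> mstar \<epsilon> \<and>
           mstar \<epsilon> \<le> mhat \<phi> (p * \<epsilon>) \<and>
           \<kappa>ratio * cost \<phi> (mhat \<phi> (p1 * \<epsilon>)) \<le> adapt_cost r a b \<eta> \<beta> \<theta> h f \<epsilon> \<and>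
           adapt_cost r a b \<eta> \<beta> \<theta> h f \<epsilon> \<le> \<kappa>ratio * cost \<phi> (mhat \<phi> (p * \<epsilon>))"
proof -
  obtain L z S G where W: "weighted_ivp f a b L r z S G \<beta>" and \<eta>: "z a = \<eta>"
    by (rule F_class_weighted_ivp[OF assms(10,1,2,5)])
  interpret weighted_ivp f a b L r z S G \<beta> by (rule W)
  let ?P = "\<lambda>m x. weak_mesh a b m x \<and> admissible lseq (K f) (k0 f) m x"
  let ?X = "\<lambda>\<epsilon>. adapt_mesh r a b \<eta> \<beta> \<theta> h f \<epsilon>"
  have follow: "coeffs_follow_weight \<phi> ?P"
    using assms(13,10,3,4) unfolding \<eta>[symmetric] by (rule method_coeffs_follow_weight)
  have follow_star: "coeffs_follow_weight (phi_star r) ?P"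
    by (rule phi_star_coeffs_follow_weight)
  have p1: "1 < p1" using assms(6,7) by (simp add: p1_def)
  have p: "0 < p" using assms(6,7) by (simp add: p_def)
  have lim: "(h \<longlongrightarrow> 0) (at_right 0)"
  proof -
    have "((\<lambda>\<epsilon>::real. \<epsilon> powr (1 / real (r + 1))) \<longlongrightarrow> 0) (at_right 0)"
      by (rule tendsto_zero_powrI[where b = "1 / real (r + 1)"]) (auto intro!: tendsto_intros eventually_mono[OF eventually_at_right_less])
    then have Z: "((\<lambda>\<epsilon>::real. C * norm (\<epsilon> powr (1 / real (r + 1)))) \<longlongrightarrow> 0) (at_right 0)" for C :: real
      by (intro tendsto_mult_right_zero tendsto_norm_zero)
    from assms(9) obtain C :: real
      where "\<forall>\<^sub>F \<epsilon> in at_right 0. norm (h \<epsilon>) \<le> C * norm (\<epsilon> powr (1 / real (r + 1)))"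
      by (rule landau_o.bigE)
    then show ?thesis using Z[of C] by (rule Lim_null_comparison)
  qed
  define e where "e = \<theta> / 6 * \<beta>"
  have e: "0 < e" "e \<le> \<beta> / 6" using assms(5-7) by (auto simp: e_def)
  obtain d where d: "0 < d" "\<And>m x. fine_steps d m x \<and> ?P m x \<Longrightarrow>
     (\<forall>i<m. norm (node_value \<phi> f (z a) x i - z (x i)) \<le> e \<and>
       (x i < x (Suc i) \<longrightarrow>
         (\<exists>c. error_coeff 2 \<beta> r {x i..x (Suc i)} (local_solution \<phi> f (z a) x i) = ereal c \<and>
              (\<forall>s\<in>{x i..x (Suc i)}. \<bar>c - 2 * weight s\<bar> \<le> e))))"
    using follow[unfolded coeffs_follow_weight_def, rule_format, OF e(1)] by blast
  have small: "\<forall>\<^sub>F \<epsilon> in at_right 0. \<epsilon> < c" if "0 < c" for c :: real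
    using that unfolding eventually_at_right_field by blast
  have "0 < 2 * \<beta> * d ^ (r + 1) / ((1 + \<theta> / 3) * p)" using assms(5-7) d(1) p by simp
  note ev = k_hat_compare[OF follow follow_star p1]
    adapt_mesh_balanced[OF e(1) assms(6,8) lim] assms(14) small[OF this] eventually_at_right_less[of 0]
  have "\<forall>\<^sub>F \<epsilon> in at_right 0. mstar \<epsilon> < \<infinity> \<and>
      mhat \<phi> (p1 * \<epsilon>) \<le> mhat (phi_star r) \<epsilon> \<and> mhat (phi_star r) \<epsilon> \<le> mstar \<epsilon> \<and>
      mstar \<epsilon> \<le> mhat \<phi> (p * \<epsilon>)"
    using ev
  proof eventually_elim
    case (elim \<epsilon>)
    then obtain M where M: "mstar \<epsilon> = enat M" and bal: "balanced_mesh e \<theta> \<epsilon> M (?X \<epsilon>)"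
      unfolding mstar_def \<eta> by blast
    have adm: "admissible lseq (K f) (k0 f) M (?X \<epsilon>)" using elim(3) M unfolding mstar_def by blast
    have "mhat \<phi> (p1 * \<epsilon>) \<le> mhat (phi_star r) \<epsilon>"
      unfolding mhat_def using elim(1) unfolding \<eta> by (intro m_hat_geI m_hat_leI) blast
    moreover have "mhat (phi_star r) \<epsilon> \<le> enat M"
      unfolding mhat_def
    proof (intro m_hat_leI k_hat_leI[OF assms(1) _ adm])
      show "weak_mesh a b M (?X \<epsilon>)" using bal by (simp add: balanced_mesh_def)
      show "local_bound 2 \<beta> r (phi_star r) f \<eta> (?X \<epsilon>) i \<le> ereal \<epsilon>" if "i < M" for i
        using balanced_mesh_bound[OF bal e(2) assms(6) that] unfolding \<eta> .
    qed
    moreover have "enat M \<le> mhat \<phi> (p * \<epsilon>)"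
      unfolding mhat_def
    proof (rule m_hat_geI)
      fix m assume k: "k_hat 2 \<beta> r a b \<eta> lseq (K f) (k0 f) \<phi> f m \<le> ereal (p * \<epsilon>)"
      \<comment> \<open>The factor \<open>1 + \<theta> / 3\<close> pays for the infimum in \<open>k_hat\<close>, which need not be attained.\<close>
      have "p * \<epsilon> < (1 + \<theta> / 3) * (p * \<epsilon>)" using p elim(5) assms(6) by simp
      then have "ereal (p * \<epsilon>) < ereal ((1 + \<theta> / 3) * (p * \<epsilon>))" by simp
      with k have "k_hat 2 \<beta> r a b \<eta> lseq (K f) (k0 f) \<phi> f m < ereal ((1 + \<theta> / 3) * (p * \<epsilon>))"
        by (rule order_le_less_trans)
      then obtain x where x: "weak_mesh a b m x" "admissible lseq (K f) (k0 f) m x"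
        "\<And>i. i < m \<Longrightarrow> local_bound 2 \<beta> r \<phi> f \<eta> x i \<le> ereal ((1 + \<theta> / 3) * (p * \<epsilon>))"
        by (rule k_hat_lessD) blast
      have "(1 + \<theta> / 3) * (p * \<epsilon>) \<le> 2 * \<beta> * d ^ (r + 1)"
        using elim(4) p assms(6) by (simp add: pos_less_divide_eq mult_ac del: power_Suc)
      then have fine: "fine_steps d m x" using x d(1) by (intro fine_steps_of_bounds)
      have "M \<le> m"
      proof (rule balanced_mesh_count[OF bal e_def assms(6,7) elim(5) x(1)])
        fix i assume i: "i < m" "x i < x (Suc i)"
        obtain c where c: "error_coeff 2 \<beta> r {x i..x (Suc i)} (local_solution \<phi> f \<eta> x i) = ereal c"
          "\<forall>s\<in>{x i..x (Suc i)}. \<bar>c - 2 * weight s\<bar> \<le> e"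
          using d(2)[of m x] fine x(1,2) i unfolding \<eta> by blast
        have "c * (x (Suc i) - x i) ^ (r + 1) \<le> (1 + \<theta> / 3) * (p * \<epsilon>)"
          using x(3)[OF i(1)] i c(1) by (simp add: local_bound_def)
        then show "\<exists>c. (\<forall>s\<in>{x i..x (Suc i)}. \<bar>c - 2 * weight s\<bar> \<le> e) \<and>
            c * (x (Suc i) - x i) ^ (r + 1) \<le> (1 + \<theta> / 3) * ((1 - \<theta>)\<^sup>2 / (2 * (1 + \<theta>)\<^sup>2) * \<epsilon>)"
          using c(2) unfolding p_def by blast
      qed
      then show "enat M \<le> enat m" by simp
    qed
    ultimately show ?case using M by simp
  qed
  then obtain c where "0 < c" and main: "\<And>\<epsilon>. 0 < \<epsilon> \<Longrightarrow> \<epsilon> < c \<Longrightarrow> mstar \<epsilon> < \<infinity> \<and>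
      mhat \<phi> (p1 * \<epsilon>) \<le> mhat (phi_star r) \<epsilon> \<and> mhat (phi_star r) \<epsilon> \<le> mstar \<epsilon> \<and>
      mstar \<epsilon> \<le> mhat \<phi> (p * \<epsilon>)"
    unfolding eventually_at_right_field by blast
  have cost_\<phi>: "\<kappa>ratio * cost \<phi> m = ereal (2 * real (r\<^sup>2)) * ereal_of_enat m" for m
    using assms(12)
    by (simp add: \<kappa>ratio_def cost_def phi_star_def mult.assoc[symmetric])
  have cost_adapt: "adapt_cost r a b \<eta> \<beta> \<theta> h f \<epsilon> = ereal (2 * real (r\<^sup>2)) * ereal_of_enat (mstar \<epsilon>)" for \<epsilon>
    by (simp add: adapt_cost_def cost_def phi_star_def mstar_def mult.assoc[symmetric] numeral_eq_ereal)
  have mono: "ereal (2 * real (r\<^sup>2)) * ereal_of_enat m \<le> ereal (2 * real (r\<^sup>2)) * ereal_of_enat m'"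
    if "m \<le> m'" for m m'
    using that by (intro ereal_mult_left_mono) auto
  show ?thesis
  proof (intro bexI[of _ "min (c / 2) (1 / 2)"] allI impI)
    fix \<epsilon> assume "0 < \<epsilon> \<and> \<epsilon> \<le> min (c / 2) (1 / 2)"
    then have "0 < \<epsilon>" "\<epsilon> < c" using \<open>0 < c\<close> by auto
    note main = main[OF this]
    then have "mhat \<phi> (p1 * \<epsilon>) \<le> mstar \<epsilon>" by (blast intro: order_trans)
    with main show "mstar \<epsilon> < \<infinity> \<and> mhat \<phi> (p1 * \<epsilon>) \<le> mhat (phi_star r) \<epsilon> \<and>
           mhat (phi_star r) \<epsilon> \<le> mstar \<epsilon> \<and> mstar \<epsilon> \<le> mhat \<phi> (p * \<epsilon>) \<and>
           \<kappa>ratio * cost \<phi> (mhat \<phi> (p1 * \<epsilon>)) \<le> adapt_cost r a b \<eta> \<beta> \<theta> h f \<epsilon> \<and>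
           adapt_cost r a b \<eta> \<beta> \<theta> h f \<epsilon> \<le> \<kappa>ratio * cost \<phi> (mhat \<phi> (p * \<epsilon>))"
      unfolding cost_\<phi> cost_adapt by (blast intro: mono)
  qed (use \<open>0 < c\<close> in auto)
qed

end
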